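(* Let $n\ge 1$ and $k\ge 1$ be integers. On $k$-component virtual string links, $L_n$-equivalence and $(n-1)$-equivalence coincide: for any two Gauss diagrams $D$, $D'$ on $k$ strands, $D$ and $D'$ are $L_n$-equivalent if and only if they are $(n-1)$-equivalent.
   Context: **Gauss diagrams.** A Gauss diagram on $k$ strands consists of $k$ ordered oriented intervals together with finitely many arrows (oriented chords) with pairwise distinct endpoints in the interiors of the intervals, each arrow carrying a sign $\pm1$; diagrams are taken up to isotopy of the intervals (only the order of the endpoints along each interval matters). The trivial Gauss diagram has no arrows. **Reidemeister moves.** RI: add or delete an arrow whose two endpoints are adjacent on an interval (any sign, either direction). RII: add or delete two arrows of opposite signs whose tails are adjacent and whose heads are adjacent (in any order). RIII: let $s_1,s_2,s_3$ be three disjoint segments of the intervals containing exactly the endpoints of three arrows of the same sign, $a$ from $s_1$ to $s_2$, $b$ from $s_1$ to $s_3$, $c$ from $s_2$ to $s_3$; the move exchanges the configuration in which the orders are $(a,b)$ on $s_1$, $(a,c)$ on $s_2$, $(b,c)$ on $s_3$ with the configuration in which the order is reversed on each of $s_1,s_2,s_3$. Two Gauss diagrams are equivalent ($\sim$) if related by a finite sequence of Reidemeister moves; an equivalence class of Gauss diagrams on $k$ strands is a $k$-component virtual string link. **Pure virtual braid group.** $PV_m$ is the group generated by $\mu_{ij}$ ($1\le i,j\le m$, $i\ne j$) with relations $\mu_{ij}\mu_{il}\mu_{jl}=\mu_{jl}\mu_{il}\mu_{ij}$ for distinct $i,j,l$ and $\mu_{ij}\mu_{lp}=\mu_{lp}\mu_{ij}$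 for distinct $i,j,l,p$. A word in the $\mu_{ij}^{\pm1}$ is drawn on $m$ vertical strands oriented from top to bottom, read from left to right as from top to bottom, $\mu_{ij}^{\epsilon}$ being a horizontal arrow of sign $\epsilon$ from the $i$-th to the $j$-th strand. Put $\Gamma_1(G)=G$, $\Gamma_n(G)=[\Gamma_{n-1}(G),G]$. **Attaching.** Let $E$ be a Gauss diagram on $m$ strands (for example, the diagram of a word in $PV_m$) and let $e$ be an embedding of its $m$ strands onto $m$ pairwise disjoint segments of the intervals of $D$ containing no endpoints of arrows of $D$; each strand may be embedded preserving or reversing orientation. Attaching $E$ to $D$ by $e$ means adding to $D$ the images of the arrows of $E$, where the sign of an arrow is multiplied by $-1$ if exactly one of its two endpoints lies on an orientation-reversed strand. For $h\in PV_m$, represented by a word, $D^{(h,e)}$ denotes the result of attaching $h$ to $D$ by $e$; its equivalence class does not depend on the word. **$L_n$-equivalence.** An $L_n$-move replaces $D$ by $D^{(h,e)}$, where $m\ge1$, $h\in\Gamma_n(PV_m)$, $h\notin\Gamma_{n+1}(PV_m)$, and $e$ is an embedding of the $m$ strands of $h$ onto $m$ pairwise disjoint segments of the intervals of $D$ containing no endpoints of arrows of $D$, each strand being embedded preserving or reversing orientation. Two Gauss diagrams are $L_n$-equivalent if they are related by a finite sequence of $L_n$-moves and Reidemeister moves. **$n$-equivalence.** For $n\ge0$, a Gauss diagram $E$ on several strands is $n$-trivial if there are $n+1$ non-empty pairwise disjoint subsets $A_1,\dots,A_{n+1}$ of the set of arrows of $E$ such that for every non-empty subfamily $S$ of $\{A_1,\dots,A_{n+1}\}$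 the Gauss diagram obtained from $E$ by deleting all arrows belonging to members of $S$ can be transformed into the trivial Gauss diagram by a finite sequence of RII moves. For $n\ge 1$, $D_2$ is obtained from $D_1$ by an $n$-variation if $D_2$ is obtained from $D_1$ by attaching an $(n-1)$-trivial Gauss diagram on several strands to segments of $D_1$ without endpoints of arrows. For $n\ge0$, two Gauss diagrams are $n$-equivalent if they are related by a finite sequence of $(n+1)$-variations and Reidemeister moves. *)

theory Defs
  imports
    "HOL-Algebra.Generated_Groups"
    "HOL-Combinatorics.Transposition"
    "HOL-Library.Disjoint_Sets"
begin

section \<open>Gauss diagrams\<close>

text \<open>
  A diagram is the list of its strands, a strand being the list of arrow endpoints met along the
  interval. Arrows are named by labels; the sign function is only relevant on labels in use.
  The names of the labels carry no information, so diagrams are only considered up to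
  relabelling (\<open>isotopic\<close> below).
\<close>

datatype 'a endpoint = Tail (arrow_of: 'a) | Head (arrow_of: 'a)

datatype 'a gauss_diagram =
  Gauss_Diagram (strands: "'a endpoint list list") (sign: "'a \<Rightarrow> int")

definition endpoints :: "'a gauss_diagram \<Rightarrow> 'a endpoint set" where
  "endpoints D = set (concat (strands D))"

definition arrows :: "'a gauss_diagram \<Rightarrow> 'a set" where
  "arrows D = arrow_of ` endpoints D"

definition gauss_diagrams :: "nat \<Rightarrow> 'a gauss_diagram set" where
  "gauss_diagrams k = {D. length (strands D) = k \<and> distinct (concat (strands D)) \<and>
     (\<forall>a. Tail a \<in> endpoints D \<longleftrightarrow> Head a \<in> endpoints D) \<and>
     (\<forall>a\<in>arrows D. sign D a \<in> {1, -1})}"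

definition isotopic :: "'a gauss_diagram \<Rightarrow> 'b gauss_diagram \<Rightarrow> bool" where
  "isotopic D E \<longleftrightarrow> (\<exists>f. inj_on f (arrows D) \<and>
     strands E = map (map (map_endpoint f)) (strands D) \<and>
     (\<forall>a\<in>arrows D. sign E (f a) = sign D a))"

definition trivial_diagram :: "nat \<Rightarrow> 'a gauss_diagram" where
  "trivial_diagram k = Gauss_Diagram (replicate k []) (\<lambda>_. 1)"

definition delete_arrows :: "'a set \<Rightarrow> 'a gauss_diagram \<Rightarrow> 'a gauss_diagram" where
  "delete_arrows A D = Gauss_Diagram (map (filter (\<lambda>x. arrow_of x \<notin> A)) (strands D)) (sign D)"


section \<open>Reidemeister moves\<close>

definition consecutive :: "'a gauss_diagram \<Rightarrow> 'a endpoint \<Rightarrow> 'a endpoint \<Rightarrow> bool" where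
  "consecutive D x y \<longleftrightarrow> (\<exists>u v. u @ [x, y] @ v \<in> set (strands D))"

definition adjacent :: "'a gauss_diagram \<Rightarrow> 'a endpoint \<Rightarrow> 'a endpoint \<Rightarrow> bool" where
  "adjacent D x y \<longleftrightarrow> consecutive D x y \<or> consecutive D y x"

text \<open>
  Each relation describes its move in one direction only (for RI and RII the deletion of arrows);
  the inverse moves enter through the symmetric closure.
\<close>

definition RI :: "'a gauss_diagram \<Rightarrow> 'a gauss_diagram \<Rightarrow> bool" where
  "RI D D' \<longleftrightarrow> (\<exists>a\<in>arrows D. adjacent D (Tail a) (Head a) \<and> D' = delete_arrows {a} D)"

definition RII :: "'a gauss_diagram \<Rightarrow> 'a gauss_diagram \<Rightarrow> bool" where
  "RII D D' \<longleftrightarrow> (\<exists>a\<in>arrows D. \<exists>b\<in>arrows D. a \<noteq> b \<and> sign D a = - sign D b \<and>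
     adjacent D (Tail a) (Tail b) \<and> adjacent D (Head a) (Head b) \<and>
     D' = delete_arrows {a, b} D)"

text \<open>
  Reversing the order of the two consecutive endpoints \<open>x, y\<close> on a segment amounts to
  exchanging the letters \<open>x\<close> and \<open>y\<close>, since each of them occurs only once.
  The three segments are disjoint because the six endpoints are distinct.
\<close>

definition RIII :: "'a gauss_diagram \<Rightarrow> 'a gauss_diagram \<Rightarrow> bool" where
  "RIII D D' \<longleftrightarrow> (\<exists>a\<in>arrows D. \<exists>b\<in>arrows D. \<exists>c\<in>arrows D. a \<noteq> b \<and> a \<noteq> c \<and> b \<noteq> c \<and>
     sign D a = sign D b \<and> sign D b = sign D c \<and>
     consecutive D (Tail a) (Tail b) \<and> consecutive D (Head a) (Tail c) \<and>
     consecutive D (Head b) (Head c) \<and>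
     D' = Gauss_Diagram
       (map (map (transpose (Tail a) (Tail b) \<circ> transpose (Head a) (Tail c) \<circ>
                  transpose (Head b) (Head c))) (strands D))
       (sign D))"

definition reidemeister :: "'a gauss_diagram \<Rightarrow> 'a gauss_diagram \<Rightarrow> bool" where
  "reidemeister D D' \<longleftrightarrow> RI D D' \<or> RII D D' \<or> RIII D D'"

text \<open>
  The equivalence relation on Gauss diagrams on \<open>k\<close> strands generated by isotopy and
  the moves in \<open>R\<close>.
\<close>

definition generated_equiv ::
  "nat \<Rightarrow> ('a gauss_diagram \<Rightarrow> 'a gauss_diagram \<Rightarrow> bool) \<Rightarrow> 'a gauss_diagram \<Rightarrow> 'a gauss_diagram \<Rightarrow> bool"
  where
  "generated_equiv k R = equivclp (\<lambda>D D'. D \<in> gauss_diagrams k \<and> D' \<in> gauss_diagrams k \<and>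
     (isotopic D D' \<or> R D D'))"


section \<open>Attaching a diagram to segments of another one\<close>

text \<open>
  An embedding of \<open>m\<close> strands onto disjoint segments of the intervals of \<open>D\<close> containing no
  endpoints is recorded by inserting, into the strands of \<open>D\<close>, one slot for every index
  \<open>j < m\<close> (the image of the \<open>j\<close>-th strand). Several slots may lie between two consecutive
  endpoints of \<open>D\<close>. The Boolean in \<open>Slot j r\<close> says whether the strand is reversed.
\<close>

datatype 'a item = Old "'a endpoint" | Slot nat bool

type_synonym 'a embedding = "'a item list list"

fun old_part :: "'a item \<Rightarrow> 'a endpoint list" where
  "old_part (Old x) = [x]"
| "old_part (Slot j r) = []"

fun slot_part :: "'a item \<Rightarrow> nat list" where
  "slot_part (Old x) = []"
| "slot_part (Slot j r) = [j]"

definition embedding :: "nat \<Rightarrow> 'a gauss_diagram \<Rightarrow> 'a embedding \<Rightarrow> bool" where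
  "embedding m D e \<longleftrightarrow> map (\<lambda>s. concat (map old_part s)) e = strands D \<and>
     distinct (concat (map slot_part (concat e))) \<and>
     set (concat (map slot_part (concat e))) = {..<m}"

fun fill :: "'b gauss_diagram \<Rightarrow> 'a item \<Rightarrow> ('a + 'b) endpoint list" where
  "fill E (Old x) = [map_endpoint Inl x]"
| "fill E (Slot j r) = map (map_endpoint Inr) (if r then rev (strands E ! j) else strands E ! j)"

definition on_reversed :: "'a embedding \<Rightarrow> 'b gauss_diagram \<Rightarrow> 'b endpoint \<Rightarrow> bool" where
  "on_reversed e E x \<longleftrightarrow>
     (\<exists>j<length (strands E). x \<in> set (strands E ! j) \<and> Slot j True \<in> set (concat e))"

definition attach ::
  "'a gauss_diagram \<Rightarrow> 'b gauss_diagram \<Rightarrow> 'a embedding \<Rightarrow> ('a + 'b) gauss_diagram" where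
  "attach D E e = Gauss_Diagram (map (\<lambda>s. concat (map (fill E) s)) e)
     (case_sum (sign D)
       (\<lambda>b. if on_reversed e E (Tail b) \<noteq> on_reversed e E (Head b) then - sign E b else sign E b))"


section \<open>Pure virtual braid groups and lower central series\<close>

text \<open>
  The letter \<open>(i, j, True)\<close> stands for the generator \<open>\<mu>\<^sub>i\<^sub>j\<close> and \<open>(i, j, False)\<close> for its inverse.
  Strands are numbered from \<open>0\<close> to \<open>m - 1\<close>.
\<close>

type_synonym pv_word = "(nat \<times> nat \<times> bool) list"

definition pv_words :: "nat \<Rightarrow> pv_word set" where
  "pv_words m = lists {(i, j, p). i < m \<and> j < m \<and> i \<noteq> j}"

inductive pv_step :: "nat \<Rightarrow> pv_word \<Rightarrow> pv_word \<Rightarrow> bool" for m where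
  cancel: "\<lbrakk>u \<in> pv_words m; v \<in> pv_words m; i < m; j < m; i \<noteq> j\<rbrakk> \<Longrightarrow>
    pv_step m (u @ [(i, j, p), (i, j, \<not> p)] @ v) (u @ v)"
| triple: "\<lbrakk>u \<in> pv_words m; v \<in> pv_words m; i < m; j < m; l < m; distinct [i, j, l]\<rbrakk> \<Longrightarrow>
    pv_step m (u @ [(i, j, True), (i, l, True), (j, l, True)] @ v)
              (u @ [(j, l, True), (i, l, True), (i, j, True)] @ v)"
| commute: "\<lbrakk>u \<in> pv_words m; v \<in> pv_words m; i < m; j < m; l < m; p < m; distinct [i, j, l, p]\<rbrakk> \<Longrightarrow>
    pv_step m (u @ [(i, j, True), (l, p, True)] @ v) (u @ [(l, p, True), (i, j, True)] @ v)"

definition pv_rel :: "nat \<Rightarrow> (pv_word \<times> pv_word) set" where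
  "pv_rel m = {(u, v). u \<in> pv_words m \<and> v \<in> pv_words m \<and> equivclp (pv_step m) u v}"

definition PV :: "nat \<Rightarrow> pv_word set monoid" where
  "PV m = \<lparr>carrier = pv_words m // pv_rel m,
           monoid.mult = (\<lambda>A B. \<Union>a\<in>A. \<Union>b\<in>B. pv_rel m `` {a @ b}),
           one = pv_rel m `` {[]}\<rparr>"

lemma pv_step_context:
  assumes "pv_step m u v" "x \<in> pv_words m" "y \<in> pv_words m"
  shows "pv_step m (x @ u @ y) (x @ v @ y)"
  using assms(1)
proof cases
  case (cancel u' v' i j p)
  then show ?thesis using assms pv_step.cancel[of "x @ u'" m "v' @ y" i j p] by (simp add: pv_words_def)
next
  case (triple u' v' i j l)
  then show ?thesis using assms pv_step.triple[of "x @ u'" m "v' @ y" i j l] by (simp add: pv_words_def)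
next
  case (commute u' v' i j l p)
  then show ?thesis using assms pv_step.commute[of "x @ u'" m "v' @ y" i j l p] by (simp add: pv_words_def)
qed

lemma pv_equiv_context:
  assumes "equivclp (pv_step m) u v" "x \<in> pv_words m" "y \<in> pv_words m"
  shows "equivclp (pv_step m) (x @ u @ y) (x @ v @ y)"
  using assms(1)
proof (induction rule: equivclp_induct)
  case base
  show ?case by simp
next
  case (step v w)
  then show ?case using assms pv_step_context by (meson equivclp_into_equivclp)
qed

lemma equiv_pv_rel: "equiv (pv_words m) (pv_rel m)"
  by (rule equivI)
    (auto simp: pv_rel_def refl_on_def intro!: symI transI intro: equivclp_sym equivclp_trans)

lemma append_pv_words: "u \<in> pv_words m \<Longrightarrow> v \<in> pv_words m \<Longrightarrow> u @ v \<in> pv_words m"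
  by (simp add: pv_words_def)

lemma congruent2_append: "(\<lambda>a b. pv_rel m `` {a @ b}) respects2 pv_rel m"
proof (rule congruent2I')
  fix a a' b b' assume "(a, a') \<in> pv_rel m" "(b, b') \<in> pv_rel m"
  then have "equivclp (pv_step m) (a @ b) (a' @ b)" "equivclp (pv_step m) (a' @ b) (a' @ b')"
    and "a @ b \<in> pv_words m" "a' @ b' \<in> pv_words m"
    using pv_equiv_context[of m a a' "[]" b] pv_equiv_context[of m b b' a' "[]"]
    by (auto simp: pv_rel_def pv_words_def)
  then have "(a @ b, a' @ b') \<in> pv_rel m"
    unfolding pv_rel_def using equivclp_trans by fastforce
  then show "pv_rel m `` {a @ b} = pv_rel m `` {a' @ b'}"
    by (rule equiv_class_eq[OF equiv_pv_rel])
qed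

lemma PV_mult:
  assumes "a \<in> pv_words m" "b \<in> pv_words m"
  shows "pv_rel m `` {a} \<otimes>\<^bsub>PV m\<^esub> pv_rel m `` {b} = pv_rel m `` {a @ b}"
  using UN_equiv_class2[OF equiv_pv_rel equiv_pv_rel congruent2_append assms] by (simp add: PV_def)

lemma PV_inv_word:
  "u \<in> pv_words m \<Longrightarrow> \<exists>v\<in>pv_words m. (v @ u, []) \<in> pv_rel m"
proof (induction u)
  case Nil
  then show ?case by (auto simp: pv_rel_def intro!: bexI[of _ "[]"])
next
  case (Cons x u)
  obtain i j p where x: "x = (i, j, p)" "i < m" "j < m" "i \<noteq> j"
    using Cons.prems by (cases x) (auto simp: pv_words_def)
  have u: "u \<in> pv_words m" using Cons.prems by (simp add: pv_words_def)
  then obtain v where v: "v \<in> pv_words m" "(v @ u, []) \<in> pv_rel m" using Cons.IH by blast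
  have "pv_step m (v @ [(i, j, \<not> p), x] @ u) (v @ u)"
    using pv_step.cancel[OF v(1) u x(2-4), of "\<not> p"] x by simp
  then have "equivclp (pv_step m) (v @ [(i, j, \<not> p), x] @ u) []"
    using v(2) by (auto simp: pv_rel_def intro: equivclp_trans r_into_equivclp)
  then show ?case using u v x by (intro bexI[of _ "v @ [(i, j, \<not> p)]"]) (auto simp: pv_rel_def pv_words_def)
qed

lemma group_PV: "group (PV m)"
proof (rule groupI)
  have Nil: "[] \<in> pv_words m" by (simp add: pv_words_def)
  have carrier: "carrier (PV m) = pv_words m // pv_rel m" and one: "\<one>\<^bsub>PV m\<^esub> = pv_rel m `` {[]}"
    by (simp_all add: PV_def)
  note simps = carrier one PV_mult append_pv_words Nil
  show "\<one>\<^bsub>PV m\<^esub> \<in> carrier (PV m)" by (simp add: simps quotientI)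
  show "x \<otimes>\<^bsub>PV m\<^esub> y \<in> carrier (PV m)" if "x \<in> carrier (PV m)" "y \<in> carrier (PV m)" for x y
    using that unfolding carrier by (auto elim!: quotientE simp: simps intro!: quotientI)
  show "x \<otimes>\<^bsub>PV m\<^esub> y \<otimes>\<^bsub>PV m\<^esub> z = x \<otimes>\<^bsub>PV m\<^esub> (y \<otimes>\<^bsub>PV m\<^esub> z)"
    if "x \<in> carrier (PV m)" "y \<in> carrier (PV m)" "z \<in> carrier (PV m)" for x y z
    using that unfolding carrier by (auto elim!: quotientE simp: simps)
  show "\<one>\<^bsub>PV m\<^esub> \<otimes>\<^bsub>PV m\<^esub> x = x" if "x \<in> carrier (PV m)" for x
    using that unfolding carrier by (auto elim!: quotientE simp: simps)
  show "\<exists>y\<in>carrier (PV m). y \<otimes>\<^bsub>PV m\<^esub> x = \<one>\<^bsub>PV m\<^esub>" if "x \<in> carrier (PV m)" for x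
  proof -
    obtain u where u: "u \<in> pv_words m" "x = pv_rel m `` {u}"
      using \<open>x \<in> carrier (PV m)\<close> unfolding carrier by (auto elim!: quotientE)
    then obtain v where v: "v \<in> pv_words m" "(v @ u, []) \<in> pv_rel m" using PV_inv_word by blast
    then have "pv_rel m `` {v} \<otimes>\<^bsub>PV m\<^esub> x = \<one>\<^bsub>PV m\<^esub>"
      using u equiv_class_eq[OF equiv_pv_rel v(2)] by (simp add: simps)
    then show ?thesis using v by (auto simp: carrier intro: quotientI)
  qed
qed

text \<open>The series is indexed from \<open>1\<close>; the value at \<open>0\<close> is a convention and is never used.\<close>

fun lower_central :: "('a, 'b) monoid_scheme \<Rightarrow> nat \<Rightarrow> 'a set" where
  "lower_central G 0 = carrier G"
| "lower_central G (Suc 0) = carrier G"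
| "lower_central G (Suc (Suc n)) = generate G
     (\<Union>x\<in>lower_central G (Suc n). \<Union>y\<in>carrier G.
        {x \<otimes>\<^bsub>G\<^esub> y \<otimes>\<^bsub>G\<^esub> inv\<^bsub>G\<^esub> x \<otimes>\<^bsub>G\<^esub> inv\<^bsub>G\<^esub> y})"

text \<open>The arrow given by the letter at position \<open>q\<close> of a word gets the label \<open>q\<close>.\<close>

definition letter_on :: "nat \<Rightarrow> pv_word \<Rightarrow> nat \<Rightarrow> nat endpoint list" where
  "letter_on s w q = (case w ! q of (i, j, p) \<Rightarrow>
     if s = i then [Tail q] else if s = j then [Head q] else [])"

definition word_diagram :: "nat \<Rightarrow> pv_word \<Rightarrow> nat gauss_diagram" where
  "word_diagram m w = Gauss_Diagram
     (map (\<lambda>s. concat (map (letter_on s w) [0..<length w])) [0..<m])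
     (\<lambda>q. case w ! q of (i, j, p) \<Rightarrow> if p then 1 else -1)"


section \<open>The two families of equivalence relations\<close>

definition L_move :: "nat \<Rightarrow> nat gauss_diagram \<Rightarrow> nat gauss_diagram \<Rightarrow> bool" where
  "L_move n D D' \<longleftrightarrow> (\<exists>m\<ge>1. \<exists>h w e.
     h \<in> lower_central (PV m) n \<and> h \<notin> lower_central (PV m) (Suc n) \<and> w \<in> h \<and>
     embedding m D e \<and> isotopic (attach D (word_diagram m w) e) D')"

definition L_equivalent :: "nat \<Rightarrow> nat \<Rightarrow> nat gauss_diagram \<Rightarrow> nat gauss_diagram \<Rightarrow> bool" where
  "L_equivalent k n = generated_equiv k (\<lambda>D D'. L_move n D D' \<or> reidemeister D D')"

definition n_trivial :: "nat \<Rightarrow> nat \<Rightarrow> 'a gauss_diagram \<Rightarrow> bool" where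
  "n_trivial m n E \<longleftrightarrow> (\<exists>A :: nat \<Rightarrow> 'a set.
     (\<forall>i\<le>n. A i \<noteq> {} \<and> A i \<subseteq> arrows E) \<and> disjoint_family_on A {..n} \<and>
     (\<forall>S. S \<noteq> {} \<longrightarrow> S \<subseteq> {..n} \<longrightarrow>
        generated_equiv m RII (delete_arrows (\<Union>(A ` S)) E) (trivial_diagram m)))"

definition variation :: "nat \<Rightarrow> nat gauss_diagram \<Rightarrow> nat gauss_diagram \<Rightarrow> bool" where
  "variation n D D' \<longleftrightarrow> (\<exists>m. \<exists>E::nat gauss_diagram. \<exists>e.
     E \<in> gauss_diagrams m \<and> n_trivial m (n - 1) E \<and>
     embedding m D e \<and> isotopic (attach D E e) D')"

definition n_equivalent :: "nat \<Rightarrow> nat \<Rightarrow> nat gauss_diagram \<Rightarrow> nat gauss_diagram \<Rightarrow> bool" where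
  "n_equivalent k n = generated_equiv k (\<lambda>D D'. variation (n + 1) D D' \<or> reidemeister D D')"

end

theory Submission
  imports Defs
    "HOL-Computational_Algebra.Formal_Power_Series"
    "HOL-Library.Countable"
    "HOL-Library.Multiset"
    "HOL-Library.Nat_Bijection"
begin

text \<open>
  Both relations allow isotopies and Reidemeister moves, so only the two kinds of attachments have to
  be expressed by each other.

  \<^emph>\<open>Deep words are variations.\<close> An element of \<open>\<Gamma>\<^sub>n\<close> is a product of iterated commutators with \<open>n\<close> entries
  and of their inverses.
  Give each entry a colour of its own: if the letters of some of the colours are deleted, the
  commutators collapse by free cancellation (\<open>lower_central_coloured\<close>). Free cancellations are second
  Reidemeister moves, so the diagram of such a word is \<open>(n - 1)\<close>-trivial. An \<open>L\<^sub>n\<close>-move may use any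
  other word of the same class, but the relations of the group are Reidemeister moves, also on
  reversed strands (\<open>attach_pv_rel\<close>); there the third move is needed for all patterns of signs, and
  these follow from the one with equal signs by means of the second move (\<open>triangle_all\<close>).

  \<^emph>\<open>Variations are deep words.\<close> Let \<open>E\<close> be \<open>(n - 1)\<close>-trivial with respect to the disjoint sets
  \<open>A\<^sub>0, \<dots>, A\<^sub>n\<^sub>-\<^sub>1\<close> of arrows. Regard \<open>E\<close> as a collection of words, at first one letter for each arrow, every
  word occupying slots of its own on the strands. To move a slot of a word \<open>h\<close> past a slot of a word
  \<open>g\<close> one has to insert the commutator \<open>[h, g]\<close> on new slots (\<open>L_RII_swap\<close>). Depths add up under this
  operation, as \<open>[\<Gamma>\<^sub>i, \<Gamma>\<^sub>j] \<subseteq> \<Gamma>\<^sub>i\<^sub>+\<^sub>j\<close>, and words of depth at least \<open>n\<close> can be inserted and removed freely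
  (\<open>insert_deep_word\<close>). Hence the slots can be sorted in finitely many steps (\<open>sort_configuration\<close>).

  Each word carries as its label the set \<open>T\<close> of the indices of those \<open>A\<^sub>i\<close> whose arrows went into it. The
  number of elements of \<open>T\<close> is at most the depth, hence less than \<open>n\<close>. If some \<open>A\<^sub>i\<close> are deleted, the
  words whose labels contain one of the indices \<open>i\<close> disappear, and all steps above remain valid for
  what is left. Sort the words such that a label comes after its subsets; then \<open>E\<close> is a stack of
  diagrams \<open>C\<^sub>T\<close>, where \<open>C\<^sub>T\<close> consists of the words with label \<open>T\<close>. Deleting all \<open>A\<^sub>i\<close> with \<open>i \<notin> T\<close>, which is
  at least one of them, leaves the stack of the \<open>C\<^sub>U\<close> with \<open>U \<subseteq> T\<close>, and this stack is trivial by assumption.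
  By induction all \<open>C\<^sub>U\<close> with \<open>U \<subset> T\<close> are trivial, therefore so is \<open>C\<^sub>T\<close>, and it can be taken off the stack
  (\<open>eliminate_configuration\<close>).

  An \<open>L\<^sub>n\<close>-move must use a word that is not in \<open>\<Gamma>\<^sub>n\<^sub>+\<^sub>1\<close>. A deeper word is inserted together with a word of
  exact depth \<open>n\<close> on the same strands, which is then cancelled by its inverse; such words exist
  because the lower central series is strictly decreasing (\<open>engel_word_not_deeper\<close>).
\<close>

section \<open>The lower central series\<close>

context group
begin

abbreviation commutator :: "'a \<Rightarrow> 'a \<Rightarrow> 'a" where
  "commutator x y \<equiv> x \<otimes> y \<otimes> inv x \<otimes> inv y"

lemma inv_cancel_left [simp]:
  "\<lbrakk>x \<in> carrier G; y \<in> carrier G\<rbrakk> \<Longrightarrow> inv x \<otimes> (x \<otimes> y) = y"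
  "\<lbrakk>x \<in> carrier G; y \<in> carrier G\<rbrakk> \<Longrightarrow> x \<otimes> (inv x \<otimes> y) = y"
  by (simp_all add: m_assoc[symmetric])

text \<open>
  Descent and normality are proved together: the inclusion of the next term uses that the present
  term is normal, and then \<open>y x y\<inverse> = [x, y]\<inverse> x\<close> shows that the next term is normal.
\<close>

lemma lower_central_subgroup_normal:
  "subgroup (lower_central G n) G \<and> lower_central G (Suc n) \<subseteq> lower_central G n \<and>
   (\<forall>x\<in>lower_central G n. \<forall>y\<in>carrier G. y \<otimes> x \<otimes> inv y \<in> lower_central G n)"
proof (induction n)
  case 0
  show ?case by (simp add: subgroup_self)
next
  case (Suc n)
  show ?case
  proof (cases n)
    case 0
    have "lower_central G (Suc (Suc 0)) \<subseteq> carrier G"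
      unfolding lower_central.simps by (rule subgroup.subset[OF generate_is_subgroup]) auto
    then show ?thesis unfolding 0 lower_central.simps(2) using subgroup_self by auto
  next
    case (Suc k)
    let ?L = "lower_central G (Suc n)"
    let ?gens = "\<lambda>A. \<Union>x\<in>A. \<Union>y\<in>carrier G. {commutator x y}"
    have L: "?L = generate G (?gens (lower_central G n))" by (simp add: Suc)
    have sub0: "subgroup (lower_central G n) G" and
      desc: "?L \<subseteq> lower_central G n" using Suc.IH by auto
    then have carr: "lower_central G n \<subseteq> carrier G" by (simp add: subgroup.subset)
    have sub: "subgroup ?L G" unfolding L using carr by (intro generate_is_subgroup) auto
    have comm: "commutator x y \<in> ?L" if "x \<in> lower_central G n" "y \<in> carrier G" for x y
      unfolding L using that by (intro generate.incl) auto
    have conj: "y \<otimes> x \<otimes> inv y \<in> ?L" if x: "x \<in> ?L" and y: "y \<in> carrier G" for x y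
    proof -
      have "commutator x y \<in> ?L" using x y comm desc by auto
      moreover have xc: "x \<in> carrier G" using subgroup.mem_carrier[OF sub x] .
      moreover have "y \<otimes> x \<otimes> inv y = inv (commutator x y) \<otimes> x"
        using xc y by (simp add: m_assoc inv_mult_group)
      ultimately show ?thesis using subgroup.m_closed[OF sub subgroup.m_inv_closed[OF sub] x] by simp
    qed
    have "lower_central G (Suc (Suc n)) = generate G (?gens ?L)" by simp
    also have "\<dots> \<subseteq> ?L"
    proof (rule generate_subgroup_incl[OF _ sub], clarify)
      fix x y assume x: "x \<in> ?L" and y: "y \<in> carrier G"
      have xc: "x \<in> carrier G" using subgroup.mem_carrier[OF sub x] .
      have "commutator x y = x \<otimes> (y \<otimes> inv x \<otimes> inv y)" using xc y by (simp add: m_assoc)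
      then show "commutator x y \<in> ?L"
        using subgroup.m_closed[OF sub x conj[OF subgroup.m_inv_closed[OF sub x] y]] by simp
    qed
    finally show ?thesis using sub conj by blast
  qed
qed

lemma lower_central_subgroup: "subgroup (lower_central G n) G"
  using lower_central_subgroup_normal by blast

lemma lower_central_carrier: "x \<in> lower_central G n \<Longrightarrow> x \<in> carrier G"
  using subgroup.mem_carrier[OF lower_central_subgroup] .

lemma lower_central_normal: "lower_central G n \<lhd> G"
  unfolding normal_inv_iff using lower_central_subgroup_normal by blast

lemma lower_central_Suc_subset: "lower_central G (Suc n) \<subseteq> lower_central G n"
  using lower_central_subgroup_normal by blast

lemma lower_central_antimono: "m \<le> n \<Longrightarrow> lower_central G n \<subseteq> lower_central G m"
  using lower_central_Suc_subset by (rule lift_Suc_antimono_le)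

lemma lower_central_commutator_Suc:
  assumes "1 \<le> n" "x \<in> lower_central G n" "y \<in> carrier G"
  shows "commutator x y \<in> lower_central G (Suc n)"
proof -
  obtain k where "n = Suc k" using assms by (cases n) auto
  then show ?thesis using assms by (auto intro!: generate.incl)
qed

lemma commutator_eq_one_iff:
  "\<lbrakk>x \<in> carrier G; y \<in> carrier G\<rbrakk> \<Longrightarrow> commutator x y = \<one> \<longleftrightarrow> x \<otimes> y = y \<otimes> x"
proof -
  assume xy: "x \<in> carrier G" "y \<in> carrier G"
  then have eq: "commutator x y \<otimes> (y \<otimes> x) = x \<otimes> y" by (simp add: m_assoc)
  have "commutator x y = \<one> \<longleftrightarrow> commutator x y \<otimes> (y \<otimes> x) = \<one> \<otimes> (y \<otimes> x)"
    using xy right_cancel[of "y \<otimes> x" "commutator x y" \<one>] by simp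
  then show ?thesis using xy eq by simp
qed

text \<open>
  The three subgroups lemma for elements: conjugation by \<open>a\<close> multiplies \<open>x\<close> by a central element and
  \<open>y\<close> by an element \<open>u\<close> that commutes with \<open>x\<close> and with \<open>y x\<inverse> y\<inverse>\<close>, so it fixes \<open>[x, y]\<close>.
\<close>

lemma commutator_commutator_one:
  assumes carr: "a \<in> carrier G" "x \<in> carrier G" "y \<in> carrier G"
    and central: "\<And>w. w \<in> carrier G \<Longrightarrow> commutator a x \<otimes> w = w \<otimes> commutator a x"
    and ux: "commutator a y \<otimes> x = x \<otimes> commutator a y"
    and uyx: "commutator a y \<otimes> (y \<otimes> inv x \<otimes> inv y) = (y \<otimes> inv x \<otimes> inv y) \<otimes> commutator a y"
  shows "commutator a (commutator x y) = \<one>"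
proof -
  define c u where "c = commutator a x" and "u = commutator a y"
  have c: "c \<in> carrier G" and u: "u \<in> carrier G" using carr by (auto simp: c_def u_def)
  have ax: "a \<otimes> x \<otimes> inv a = c \<otimes> x" and ay: "a \<otimes> y \<otimes> inv a = u \<otimes> y"
    using carr by (simp_all add: c_def u_def m_assoc)
  have "a \<otimes> commutator x y \<otimes> inv a =
      (a \<otimes> x \<otimes> inv a) \<otimes> (a \<otimes> y \<otimes> inv a) \<otimes> inv (a \<otimes> x \<otimes> inv a) \<otimes> inv (a \<otimes> y \<otimes> inv a)"
    using carr by (simp add: m_assoc inv_mult_group)
  also have "\<dots> = c \<otimes> (x \<otimes> u \<otimes> y \<otimes> inv x) \<otimes> inv c \<otimes> (inv y \<otimes> inv u)"
    unfolding ax ay using carr c u by (simp add: m_assoc inv_mult_group)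
  also have "c \<otimes> (x \<otimes> u \<otimes> y \<otimes> inv x) = (x \<otimes> u \<otimes> y \<otimes> inv x) \<otimes> c"
    using central[folded c_def] carr u by simp
  also have "(x \<otimes> u \<otimes> y \<otimes> inv x) \<otimes> c \<otimes> inv c \<otimes> (inv y \<otimes> inv u) =
      (x \<otimes> u) \<otimes> (y \<otimes> inv x \<otimes> inv y) \<otimes> inv u"
    using carr u c by (simp add: m_assoc)
  also have "x \<otimes> u = u \<otimes> x" using ux by (simp add: u_def)
  also have "(u \<otimes> x) \<otimes> (y \<otimes> inv x \<otimes> inv y) \<otimes> inv u = (x \<otimes> u) \<otimes> (y \<otimes> inv x \<otimes> inv y) \<otimes> inv u"
    using ux by (simp add: u_def)
  also have "\<dots> = x \<otimes> (u \<otimes> (y \<otimes> inv x \<otimes> inv y)) \<otimes> inv u" using carr u by (simp add: m_assoc)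
  also have "u \<otimes> (y \<otimes> inv x \<otimes> inv y) = (y \<otimes> inv x \<otimes> inv y) \<otimes> u" using uyx by (simp add: u_def)
  also have "x \<otimes> ((y \<otimes> inv x \<otimes> inv y) \<otimes> u) \<otimes> inv u = commutator x y"
    using carr u by (simp add: m_assoc)
  finally show ?thesis using carr by simp
qed

text \<open>
  Induction on \<open>j\<close>. A generator of \<open>\<Gamma>\<^sub>j\<^sub>+\<^sub>1\<close> is \<open>[x, y]\<close> with \<open>x \<in> \<Gamma>\<^sub>j\<close>. Modulo \<open>\<Gamma>\<^sub>i\<^sub>+\<^sub>j\<^sub>+\<^sub>1\<close> the element \<open>[a, x]\<close> is
  central and \<open>[a, y] \<in> \<Gamma>\<^sub>i\<^sub>+\<^sub>1\<close> commutes with \<open>\<Gamma>\<^sub>j\<close>, both by the induction hypothesis.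
\<close>

theorem lower_central_commutator:
  "\<lbrakk>1 \<le> i; 1 \<le> j; a \<in> lower_central G i; z \<in> lower_central G j\<rbrakk>
    \<Longrightarrow> commutator a z \<in> lower_central G (i + j)"
proof (induction j arbitrary: i a z)
  case 0
  then show ?case by simp
next
  case (Suc j)
  show ?case
  proof (cases j)
    case 0
    then show ?thesis using Suc.prems lower_central_commutator_Suc by simp
  next
    case (Suc k)
    define N where "N = lower_central G (i + Suc j)"
    have N: "N \<lhd> G" and subN: "subgroup N G"
      by (simp_all add: N_def lower_central_normal lower_central_subgroup)
    interpret N: normal N G by (rule N)
    define Q \<phi> where "Q = G Mod N" and "\<phi> = (\<lambda>x. N #> x)"
    interpret q: group_hom G Q \<phi>
      unfolding Q_def \<phi>_def using N.factorgroup_is_group N.r_coset_hom_Mod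
      by (intro group_hom.intro group_hom_axioms.intro is_group)
    have in_N: "\<phi> x = \<one>\<^bsub>Q\<^esub> \<longleftrightarrow> x \<in> N" if "x \<in> carrier G" for x
      using that subN coset_join1[of N x] coset_join2[of x N] subgroup.subset[OF subN]
      by (auto simp: FactGroup_def Q_def \<phi>_def)
    have surj: "\<exists>w'\<in>carrier G. w = \<phi> w'" if "w \<in> carrier Q" for w
      using that by (auto simp: FactGroup_def RCOSETS_def Q_def \<phi>_def)
    have in_N_comm: "\<phi> x \<otimes>\<^bsub>Q\<^esub> \<phi> y = \<phi> y \<otimes>\<^bsub>Q\<^esub> \<phi> x"
      if "commutator x y \<in> N" "x \<in> carrier G" "y \<in> carrier G" for x y
    proof -
      have "q.H.commutator (\<phi> x) (\<phi> y) = \<phi> (commutator x y)" using that by simp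
      also have "\<dots> = \<one>\<^bsub>Q\<^esub>" using that in_N[of "commutator x y"] by simp
      finally show ?thesis using that q.H.commutator_eq_one_iff by simp
    qed
    have basic: "commutator a (commutator x y) \<in> N"
      if a: "a \<in> lower_central G i" and x: "x \<in> lower_central G j" and y: "y \<in> carrier G" for a x y
    proof -
      have ac: "a \<in> carrier G" and xc: "x \<in> carrier G" using a x lower_central_carrier by auto
      have ax: "commutator a x \<in> lower_central G (i + j)"
        using Suc.IH[OF Suc.prems(1) _ a x] Suc by simp
      have ay: "commutator a y \<in> lower_central G (Suc i)"
        using lower_central_commutator_Suc[OF Suc.prems(1) a y] .
      have cw: "commutator (commutator a x) w \<in> N" if "w \<in> carrier G" for w
        using lower_central_commutator_Suc[OF _ ax that] Suc.prems by (simp add: N_def)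
      have uv: "commutator (commutator a y) v \<in> N" if "v \<in> lower_central G j" for v
        using Suc.IH[OF _ _ ay that] Suc by (simp add: N_def)
      have v: "y \<otimes> inv x \<otimes> inv y \<in> lower_central G j"
        using x y lower_central_subgroup_normal[of j] subgroup.m_inv_closed[OF lower_central_subgroup x] by blast
      have vc: "y \<otimes> inv x \<otimes> inv y \<in> carrier G" using xc y by simp
      have "q.H.commutator (\<phi> a) (q.H.commutator (\<phi> x) (\<phi> y)) = \<one>\<^bsub>Q\<^esub>"
      proof (rule q.H.commutator_commutator_one)
        fix w assume "w \<in> carrier Q"
        then obtain w' where w': "w' \<in> carrier G" "w = \<phi> w'" using surj by blast
        show "q.H.commutator (\<phi> a) (\<phi> x) \<otimes>\<^bsub>Q\<^esub> w = w \<otimes>\<^bsub>Q\<^esub> q.H.commutator (\<phi> a) (\<phi> x)"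
          using in_N_comm[OF cw[OF w'(1)]] ac xc w' by simp
      next
        show "q.H.commutator (\<phi> a) (\<phi> y) \<otimes>\<^bsub>Q\<^esub> \<phi> x = \<phi> x \<otimes>\<^bsub>Q\<^esub> q.H.commutator (\<phi> a) (\<phi> y)"
          using in_N_comm[OF uv[OF x]] ac xc y by simp
        show "q.H.commutator (\<phi> a) (\<phi> y) \<otimes>\<^bsub>Q\<^esub> (\<phi> y \<otimes>\<^bsub>Q\<^esub> inv\<^bsub>Q\<^esub> \<phi> x \<otimes>\<^bsub>Q\<^esub> inv\<^bsub>Q\<^esub> \<phi> y) =
          \<phi> y \<otimes>\<^bsub>Q\<^esub> inv\<^bsub>Q\<^esub> \<phi> x \<otimes>\<^bsub>Q\<^esub> inv\<^bsub>Q\<^esub> \<phi> y \<otimes>\<^bsub>Q\<^esub> q.H.commutator (\<phi> a) (\<phi> y)"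
          using in_N_comm[OF uv[OF v]] ac xc y by simp
      qed (use ac xc y in auto)
      then show ?thesis using in_N[of "commutator a (commutator x y)"] ac xc y by simp
    qed
    have inv_case: "commutator a (inv z) \<in> N"
      if "commutator a z \<in> N" "a \<in> carrier G" "z \<in> carrier G" for a z
    proof -
      have "commutator a (inv z) = inv z \<otimes> inv (commutator a z) \<otimes> inv (inv z)"
        using that by (simp add: m_assoc inv_mult_group)
      then show ?thesis
        using N.inv_op_closed2[of "inv z" "inv (commutator a z)"] subgroup.m_inv_closed[OF subN that(1)] that
        by simp
    qed
    have "z \<in> generate G (\<Union>x\<in>lower_central G j. \<Union>y\<in>carrier G. {commutator x y})"
      using Suc.prems(4) Suc by simp
    then have "\<forall>a\<in>lower_central G i. commutator a z \<in> N"
    proof (induction z rule: generate.induct)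
      case one
      then show ?case using lower_central_carrier subN by (simp add: subgroup.one_closed)
    next
      case (incl h)
      then show ?case using basic by auto
    next
      case (inv h)
      then obtain x y where "h = commutator x y" "x \<in> lower_central G j" "y \<in> carrier G" by auto
      then show ?case using basic inv_case lower_central_carrier by simp
    next
      case (eng h1 h2)
      have h: "h1 \<in> carrier G" "h2 \<in> carrier G"
        using eng(1,2) Suc lower_central_carrier[of h1 "Suc j"] lower_central_carrier[of h2 "Suc j"]
        by simp_all
      show ?case
      proof
        fix a assume a: "a \<in> lower_central G i"
        have ac: "a \<in> carrier G" using a lower_central_carrier by auto
        have "commutator a (h1 \<otimes> h2) = commutator a h1 \<otimes> (h1 \<otimes> commutator a h2 \<otimes> inv h1)"
          using h ac by (simp add: m_assoc inv_mult_group)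
        then show "commutator a (h1 \<otimes> h2) \<in> N"
          using subgroup.m_closed[OF subN _ N.inv_op_closed2[OF h(1)]] eng.IH a by simp
      qed
    qed
    then show ?thesis using Suc.prems(3) by (simp add: N_def)
  qed
qed

end

lemma lower_central_hom:
  assumes "group_hom G H \<phi>" "x \<in> lower_central G n"
  shows "\<phi> x \<in> lower_central H n"
  using assms(2)
proof (induction n arbitrary: x)
  case 0
  then show ?case using assms(1) by (simp add: group_hom.hom_closed)
next
  case (Suc n)
  interpret group_hom G H \<phi> by (rule assms(1))
  show ?case
  proof (cases n)
    case 0
    then show ?thesis using Suc.prems by simp
  next
    case (Suc k)
    let ?A = "\<Union>x\<in>lower_central G n. \<Union>y\<in>carrier G. {G.commutator x y}"
    let ?B = "\<Union>x\<in>lower_central H n. \<Union>y\<in>carrier H. {H.commutator x y}"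
    have A: "?A \<subseteq> carrier G" using G.lower_central_carrier by auto
    have "\<phi> x \<in> \<phi> ` generate G ?A" using Suc.prems Suc by simp
    also have "\<dots> = generate H (\<phi> ` ?A)" using generate_img[OF A] by simp
    also have "\<dots> \<subseteq> generate H ?B"
    proof (rule mono_generate)
      show "\<phi> ` ?A \<subseteq> ?B"
      proof clarify
        fix x y assume x: "x \<in> lower_central G n" and y: "y \<in> carrier G"
        have "\<phi> (G.commutator x y) = H.commutator (\<phi> x) (\<phi> y)"
          using G.lower_central_carrier[OF x] y by simp
        then show "\<phi> (G.commutator x y) \<in> ?B" using Suc.IH[OF x] hom_closed[OF y] by blast
      qed
    qed
    finally show ?thesis using Suc by simp
  qed
qed

section \<open>Words in pure virtual braid groups\<close>

definition pv_class :: "nat \<Rightarrow> pv_word \<Rightarrow> pv_word set" where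
  "pv_class m w = pv_rel m `` {w}"

fun inv_letter :: "nat \<times> nat \<times> bool \<Rightarrow> nat \<times> nat \<times> bool" where
  "inv_letter (i, j, p) = (i, j, \<not> p)"

definition inv_word :: "pv_word \<Rightarrow> pv_word" where
  "inv_word w = rev (map inv_letter w)"

lemma inv_word_simps [simp]:
  "inv_word [] = []" "inv_word (l # w) = inv_word w @ [inv_letter l]"
  "inv_word (u @ v) = inv_word v @ inv_word u"
  by (simp_all add: inv_word_def)

lemma pv_words_simps [simp]:
  "[] \<in> pv_words m" "u @ v \<in> pv_words m \<longleftrightarrow> u \<in> pv_words m \<and> v \<in> pv_words m"
  "(i, j, p) # w \<in> pv_words m \<longleftrightarrow> i < m \<and> j < m \<and> i \<noteq> j \<and> w \<in> pv_words m"
  by (auto simp: pv_words_def)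

lemma pv_words_iff: "w \<in> pv_words m \<longleftrightarrow> (\<forall>(i, j, p)\<in>set w. i < m \<and> j < m \<and> i \<noteq> j)"
  by (auto simp: pv_words_def lists_eq_set)

lemma inv_word_pv_words [simp]: "inv_word w \<in> pv_words m \<longleftrightarrow> w \<in> pv_words m"
  by (induction w) auto

lemma pv_class_self: "w \<in> pv_words m \<Longrightarrow> w \<in> pv_class m w"
  by (simp add: pv_class_def pv_rel_def)

lemma pv_class_eqI: "(u, v) \<in> pv_rel m \<Longrightarrow> pv_class m u = pv_class m v"
  unfolding pv_class_def by (rule equiv_class_eq[OF equiv_pv_rel])

lemma pv_class_carrier [simp]: "w \<in> pv_words m \<Longrightarrow> pv_class m w \<in> carrier (PV m)"
  by (simp add: pv_class_def PV_def quotientI)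

lemma PV_carrierE:
  assumes "x \<in> carrier (PV m)"
  obtains w where "w \<in> pv_words m" "x = pv_class m w"
  using assms by (auto simp: pv_class_def PV_def elim!: quotientE)

lemma pv_class_of_member:
  assumes "h \<in> carrier (PV m)" "w \<in> h"
  shows "w \<in> pv_words m" "h = pv_class m w"
proof -
  obtain u where u: "u \<in> pv_words m" "h = pv_class m u" using assms(1) by (rule PV_carrierE)
  then have "(u, w) \<in> pv_rel m" using assms(2) by (simp add: pv_class_def)
  then show "w \<in> pv_words m" "h = pv_class m w" using u pv_class_eqI by (auto simp: pv_rel_def)
qed

lemma pv_class_append:
  "\<lbrakk>u \<in> pv_words m; v \<in> pv_words m\<rbrakk> \<Longrightarrow> pv_class m u \<otimes>\<^bsub>PV m\<^esub> pv_class m v = pv_class m (u @ v)"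
  by (simp add: pv_class_def PV_mult)

lemma pv_class_Nil: "pv_class m [] = \<one>\<^bsub>PV m\<^esub>"
  by (simp add: pv_class_def PV_def)

lemma pv_class_step: "pv_step m u v \<Longrightarrow> u \<in> pv_words m \<Longrightarrow> v \<in> pv_words m \<Longrightarrow> pv_class m u = pv_class m v"
  by (rule pv_class_eqI) (auto simp: pv_rel_def)

lemma pv_class_cancel:
  "\<lbrakk>u \<in> pv_words m; v \<in> pv_words m; i < m; j < m; i \<noteq> j\<rbrakk> \<Longrightarrow>
    pv_class m (u @ [(i, j, p), (i, j, \<not> p)] @ v) = pv_class m (u @ v)"
  by (rule pv_class_step[OF pv_step.cancel]) auto

lemma pv_class_inv_word:
  assumes "w \<in> pv_words m"
  shows "inv\<^bsub>PV m\<^esub> pv_class m w = pv_class m (inv_word w)"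
proof -
  interpret group "PV m" by (rule group_PV)
  have "pv_class m (inv_word w @ w) = \<one>\<^bsub>PV m\<^esub>" using assms
  proof (induction w)
    case Nil
    then show ?case by (simp add: pv_class_Nil)
  next
    case (Cons l w)
    obtain i j p where l: "l = (i, j, p)" by (cases l)
    then show ?case using Cons pv_class_cancel[of "inv_word w" m w i j "\<not> p"] by simp
  qed
  then show ?thesis using assms by (intro inv_equality) (simp_all add: pv_class_append)
qed

text \<open>
  The presentation as a universal property. It yields the homomorphisms induced by injections of
  strands and the homomorphism that detects depth.
\<close>

fun eval_letter :: "('a, 'b) monoid_scheme \<Rightarrow> (nat \<Rightarrow> nat \<Rightarrow> 'a) \<Rightarrow> nat \<times> nat \<times> bool \<Rightarrow> 'a" where
  "eval_letter H f (i, j, p) = (if p then f i j else inv\<^bsub>H\<^esub> f i j)"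

primrec eval_word :: "('a, 'b) monoid_scheme \<Rightarrow> (nat \<Rightarrow> nat \<Rightarrow> 'a) \<Rightarrow> pv_word \<Rightarrow> 'a" where
  "eval_word H f [] = \<one>\<^bsub>H\<^esub>"
| "eval_word H f (l # w) = eval_letter H f l \<otimes>\<^bsub>H\<^esub> eval_word H f w"

lemma PV_universal:
  fixes H (structure)
  assumes H: "group H"
    and f: "\<And>i j. \<lbrakk>i < m; j < m; i \<noteq> j\<rbrakk> \<Longrightarrow> f i j \<in> carrier H"
    and triple: "\<And>i j l. \<lbrakk>i < m; j < m; l < m; distinct [i, j, l]\<rbrakk> \<Longrightarrow>
      f i j \<otimes> (f i l \<otimes> f j l) = f j l \<otimes> (f i l \<otimes> f i j)"
    and commute: "\<And>i j l p. \<lbrakk>i < m; j < m; l < m; p < m; distinct [i, j, l, p]\<rbrakk> \<Longrightarrow>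
      f i j \<otimes> f l p = f l p \<otimes> f i j"
  obtains \<phi> where "group_hom (PV m) H \<phi>" "\<And>w. w \<in> pv_words m \<Longrightarrow> \<phi> (pv_class m w) = eval_word H f w"
proof -
  interpret group H by (rule H)
  have letter: "eval_letter H f (i, j, p) \<in> carrier H" if "i < m" "j < m" "i \<noteq> j" for i j p
    using that f by simp
  have closed: "eval_word H f w \<in> carrier H" if "w \<in> pv_words m" for w
    using that
  proof (induction w)
    case (Cons l w)
    then show ?case using letter by (cases l) (simp del: eval_letter.simps)
  qed simp
  have append: "eval_word H f (u @ v) = eval_word H f u \<otimes> eval_word H f v"
    if "u \<in> pv_words m" "v \<in> pv_words m" for u v
    using that(1)
  proof (induction u)
    case Nil
    then show ?case using closed that by simp
  next
    case (Cons l u)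
    then show ?case using letter closed that by (cases l) (simp add: m_assoc del: eval_letter.simps)
  qed
  have step: "eval_word H f u = eval_word H f v" if "pv_step m u v" for u v
    using that
  proof cases
    case (cancel x y i j p)
    then show ?thesis using f[of i j] closed by (simp add: append)
  next
    case (triple x y i j l)
    have "eval_word H f ([(i, j, True), (i, l, True), (j, l, True)] @ y) =
        eval_word H f ([(j, l, True), (i, l, True), (i, j, True)] @ y)"
      using triple f assms(3)[of i j l] closed[of y] by (simp add: m_assoc[symmetric])
    then show ?thesis using triple by (simp add: append)
  next
    case (commute x y i j l p)
    have "eval_word H f ([(i, j, True), (l, p, True)] @ y) = eval_word H f ([(l, p, True), (i, j, True)] @ y)"
      using commute f assms(4)[of i j l p] closed[of y] by (simp add: m_assoc[symmetric])
    then show ?thesis using commute by (simp add: append)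
  qed
  have equiv: "eval_word H f u = eval_word H f v" if "(u, v) \<in> pv_rel m" for u v
  proof -
    have "equivclp (pv_step m) u v" using that by (simp add: pv_rel_def)
    then show ?thesis by (induction rule: equivclp_induct) (use step in \<open>auto\<close>)
  qed
  define \<phi> where "\<phi> A = eval_word H f (SOME w. w \<in> A)" for A
  have \<phi>: "\<phi> (pv_class m w) = eval_word H f w" if "w \<in> pv_words m" for w
  proof -
    have "(SOME v. v \<in> pv_class m w) \<in> pv_class m w" using pv_class_self[OF that] by (rule someI)
    then have "(w, SOME v. v \<in> pv_class m w) \<in> pv_rel m" by (simp add: pv_class_def)
    then show ?thesis unfolding \<phi>_def using equiv by metis
  qed
  have "\<phi> \<in> hom (PV m) H"
    by (rule homI) (auto elim!: PV_carrierE simp: \<phi> closed pv_class_append append)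
  then have "group_hom (PV m) H \<phi>"
    using group_PV H by (intro group_hom.intro group_hom_axioms.intro)
  then show thesis using \<phi> that by blast
qed

fun map_letter :: "(nat \<Rightarrow> nat) \<Rightarrow> nat \<times> nat \<times> bool \<Rightarrow> nat \<times> nat \<times> bool" where
  "map_letter \<sigma> (i, j, p) = (\<sigma> i, \<sigma> j, p)"

text \<open>
  The number of strands of the ambient group does not matter for the depth of a word: the maps
  between pure virtual braid groups induced by injections of strands preserve it.
\<close>

definition depth_ge :: "nat \<Rightarrow> pv_word \<Rightarrow> bool" where
  "depth_ge d w \<longleftrightarrow> (\<exists>m. w \<in> pv_words m \<and> pv_class m w \<in> lower_central (PV m) d)"

lemma lower_central_map_letter:
  assumes inj: "inj_on \<sigma> {..<m}" and im: "\<sigma> ` {..<m} \<subseteq> {..<m'}"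
    and w: "w \<in> pv_words m" "pv_class m w \<in> lower_central (PV m) d"
  shows "map (map_letter \<sigma>) w \<in> pv_words m' \<and> pv_class m' (map (map_letter \<sigma>) w) \<in> lower_central (PV m') d"
proof -
  interpret H: group "PV m'" by (rule group_PV)
  define f where "f = (\<lambda>i j. pv_class m' [(\<sigma> i, \<sigma> j, True)])"
  have lt: "\<sigma> i < m'" if "i < m" for i using im that by auto
  have ne: "\<sigma> i \<noteq> \<sigma> j" if "i < m" "j < m" "i \<noteq> j" for i j using inj that by (auto dest: inj_onD)
  have inv_letter_class: "inv\<^bsub>PV m'\<^esub> f i j = pv_class m' [(\<sigma> i, \<sigma> j, False)]" if "i < m" "j < m" "i \<noteq> j" for i j
    unfolding f_def using that lt ne by (subst pv_class_inv_word) simp_all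
  obtain \<phi> where \<phi>: "group_hom (PV m) (PV m') \<phi>"
      "\<And>w. w \<in> pv_words m \<Longrightarrow> \<phi> (pv_class m w) = eval_word (PV m') f w"
  proof (rule PV_universal[of "PV m'" m f])
    fix i j l assume "i < m" "j < m" "l < m" "distinct [i, j, l]"
    then show "f i j \<otimes>\<^bsub>PV m'\<^esub> (f i l \<otimes>\<^bsub>PV m'\<^esub> f j l) = f j l \<otimes>\<^bsub>PV m'\<^esub> (f i l \<otimes>\<^bsub>PV m'\<^esub> f i j)"
      using lt ne pv_class_step[OF pv_step.triple[of "[]" m' "[]" "\<sigma> i" "\<sigma> j" "\<sigma> l"]]
      by (simp add: f_def pv_class_append)
  next
    fix i j l p assume "i < m" "j < m" "l < m" "p < m" "distinct [i, j, l, p]"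
    then show "f i j \<otimes>\<^bsub>PV m'\<^esub> f l p = f l p \<otimes>\<^bsub>PV m'\<^esub> f i j"
      using lt ne pv_class_step[OF pv_step.commute[of "[]" m' "[]" "\<sigma> i" "\<sigma> j" "\<sigma> l" "\<sigma> p"]]
      by (simp add: f_def pv_class_append)
  qed (use lt ne in \<open>auto simp: f_def group_PV\<close>)
  have words: "map (map_letter \<sigma>) v \<in> pv_words m'" if "v \<in> pv_words m" for v
    using that lt ne by (fastforce simp: pv_words_iff)
  have "eval_word (PV m') f v = pv_class m' (map (map_letter \<sigma>) v)" if "v \<in> pv_words m" for v
    using that
  proof (induction v)
    case Nil
    then show ?case by (simp add: pv_class_Nil)
  next
    case (Cons l v)
    obtain i j p where l: "l = (i, j, p)" by (cases l)
    have "eval_letter (PV m') f l = pv_class m' [map_letter \<sigma> l]"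
      using Cons.prems inv_letter_class by (cases p) (auto simp: l f_def)
    then show ?case using Cons lt ne words[of v] by (simp add: l pv_class_append)
  qed
  then show ?thesis using words \<phi> lower_central_hom[OF \<phi>(1) w(2)] w(1) by simp
qed

lemma depth_ge_map_letter:
  assumes "inj \<sigma>" "depth_ge d w"
  shows "depth_ge d (map (map_letter \<sigma>) w)"
proof -
  obtain m where m: "w \<in> pv_words m" "pv_class m w \<in> lower_central (PV m) d"
    using assms(2) by (auto simp: depth_ge_def)
  obtain m' where "\<sigma> ` {..<m} \<subseteq> {..<m'}"
    using finite_nat_set_iff_bounded[of "\<sigma> ` {..<m}"] by blast
  then show ?thesis
    using lower_central_map_letter[OF inj_on_subset[OF assms(1)], of m m' w d] m
    by (auto simp: depth_ge_def)
qed

lemma depth_ge_obtain: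
  assumes "depth_ge d w"
  obtains m where "w \<in> pv_words m" "pv_class m w \<in> lower_central (PV m) d" "K \<le> m"
proof -
  obtain m where m: "w \<in> pv_words m" "pv_class m w \<in> lower_central (PV m) d"
    using assms by (auto simp: depth_ge_def)
  have "map_letter (\<lambda>x. x) = (\<lambda>x. x)" by auto
  then have "w \<in> pv_words (max m K) \<and> pv_class (max m K) w \<in> lower_central (PV (max m K)) d"
    using lower_central_map_letter[of "\<lambda>x. x" m "max m K" w d] m by simp
  then show thesis using that by auto
qed

lemma depth_ge_commutator:
  assumes "1 \<le> d" "1 \<le> d'" "depth_ge d u" "depth_ge d' v"
  shows "depth_ge (d + d') (u @ v @ inv_word u @ inv_word v)"
proof -
  obtain m1 where m1: "v \<in> pv_words m1" "pv_class m1 v \<in> lower_central (PV m1) d'"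
    using assms(4) by (auto simp: depth_ge_def)
  obtain m where m: "u \<in> pv_words m" "pv_class m u \<in> lower_central (PV m) d" "m1 \<le> m"
    using depth_ge_obtain[OF assms(3)] by blast
  have "map_letter (\<lambda>x. x) = (\<lambda>x. x)" by auto
  then have v: "v \<in> pv_words m" "pv_class m v \<in> lower_central (PV m) d'"
    using lower_central_map_letter[of "\<lambda>x. x" m1 m v d'] m1 m(3) by auto
  interpret group "PV m" by (rule group_PV)
  have "commutator (pv_class m u) (pv_class m v) = pv_class m (u @ v @ inv_word u @ inv_word v)"
    using m v by (simp add: pv_class_inv_word pv_class_append)
  then show ?thesis
    using lower_central_commutator[OF assms(1,2) m(2) v(2)] m(1) v(1)
    by (auto simp: depth_ge_def intro!: exI[of _ m])
qed

lemma depth_ge_1: "(\<And>i j p. (i, j, p) \<in> set w \<Longrightarrow> i \<noteq> j) \<Longrightarrow> depth_ge 1 w"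
proof -
  assume ne: "\<And>i j p. (i, j, p) \<in> set w \<Longrightarrow> i \<noteq> j"
  obtain m where "fst ` set w \<union> (fst \<circ> snd) ` set w \<subseteq> {..<m}"
    using finite_nat_set_iff_bounded[of "fst ` set w \<union> (fst \<circ> snd) ` set w"] by blast
  then have "w \<in> pv_words m" using ne by (fastforce simp: pv_words_iff)
  then show ?thesis by (auto simp: depth_ge_def intro!: exI[of _ m])
qed

section \<open>The lower central series of a pure virtual braid group is strictly decreasing\<close>

text \<open>
  The pair \<open>(u, f)\<close> stands for the affine map \<open>x \<mapsto> u x + f\<close> of the ring of power series in \<open>t\<close>.
  Commutators with \<open>(1 + t, 0)\<close> multiply translations by \<open>- t\<close>, so this group detects the depth.
\<close>

definition affine_group :: "(rat fps \<times> rat fps) monoid" where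
  "affine_group = \<lparr>carrier = {(u, f). fps_nth u 0 = 1},
     monoid.mult = (\<lambda>(u, f) (v, g). (u * v, f + u * g)), one = (1, 0)\<rparr>"

lemma fps_unit: "fps_nth u 0 = 1 \<Longrightarrow> inverse u * u = 1" "fps_nth u 0 = 1 \<Longrightarrow> u * inverse u = 1"
  for u :: "rat fps"
  using inverse_mult_eq_1[of u] by (simp_all add: mult.commute)

lemma group_affine_group: "group affine_group"
proof (rule groupI)
  show "\<exists>y\<in>carrier affine_group. y \<otimes>\<^bsub>affine_group\<^esub> x = \<one>\<^bsub>affine_group\<^esub>"
    if "x \<in> carrier affine_group" for x
    using that fps_unit(1)[of "fst x"]
    by (intro bexI[of _ "(inverse (fst x), - inverse (fst x) * snd x)"]) (auto simp: affine_group_def)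
qed (auto simp: affine_group_def algebra_simps)

lemma affine_group_simps:
  "(u, f) \<otimes>\<^bsub>affine_group\<^esub> (v, g) = (u * v, f + u * g)"
  "\<one>\<^bsub>affine_group\<^esub> = (1, 0)" "(u, f) \<in> carrier affine_group \<longleftrightarrow> fps_nth u 0 = 1"
  by (simp_all add: affine_group_def)

lemma affine_group_inv:
  "fps_nth u 0 = 1 \<Longrightarrow> inv\<^bsub>affine_group\<^esub> (u, f) = (inverse u, - inverse u * f)"
  by (rule group.inv_equality[OF group_affine_group]) (simp_all add: affine_group_simps fps_unit)

lemma affine_group_commutator:
  assumes "fps_nth u 0 = 1" "fps_nth v 0 = 1"
  shows "(u, f) \<otimes>\<^bsub>affine_group\<^esub> (v, g) \<otimes>\<^bsub>affine_group\<^esub> inv\<^bsub>affine_group\<^esub> (u, f) \<otimes>\<^bsub>affine_group\<^esub> inv\<^bsub>affine_group\<^esub> (v, g)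
    = (1, (1 - v) * f - (1 - u) * g)"
proof -
  have iu: "u * inverse u = 1" "inverse u * u = 1" and iv: "v * inverse v = 1" "inverse v * v = 1"
    using fps_unit assms by auto
  have 1: "u * v * inverse u = v" using iu by (metis mult.assoc mult.commute mult.right_neutral)
  have "u * v * inverse u * inverse v = 1" by (simp only: 1 iv)
  moreover have "f + u * g + u * v * (- inverse u * f) + u * v * inverse u * (- inverse v * g)
      = f + u * g - (u * v * inverse u) * f - (u * v * inverse u * inverse v) * g"
    by (simp add: algebra_simps)
  then have "f + u * g + u * v * (- inverse u * f) + u * v * inverse u * (- inverse v * g)
      = (1 - v) * f - (1 - u) * g"
    by (simp only: 1 iv) (simp add: algebra_simps)
  ultimately show ?thesis using assms by (simp add: affine_group_inv affine_group_simps mult.assoc)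
qed

text \<open>
  For \<open>n \<ge> 1\<close> the linear part is even \<open>1\<close>; the weaker condition holds for \<open>n = 0\<close> as well and makes the
  induction uniform.
\<close>

lemma lower_central_affine_group:
  "(u, f) \<in> lower_central affine_group (Suc n) \<Longrightarrow> fps_X ^ n dvd f \<and> fps_X ^ Suc n dvd 1 - u"
proof (induction n arbitrary: u f)
  case 0
  then have "fps_nth (1 - u) 0 = 0" by (simp add: affine_group_def)
  then have "1 - u = fps_X * fps_shift 1 (1 - u)"
    by (simp add: fps_eq_iff)
  then have "fps_X dvd 1 - u" by (rule dvdI)
  then show ?case by simp
next
  case (Suc n)
  interpret group affine_group by (rule group_affine_group)
  let ?T = "{(u, f). fps_nth u 0 = 1 \<and> fps_X ^ Suc n dvd f \<and> fps_X ^ Suc (Suc n) dvd 1 - u} :: (rat fps \<times> rat fps) set"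
  have T: "subgroup ?T affine_group"
  proof (rule subgroupI)
    show "?T \<subseteq> carrier affine_group" by (auto simp: affine_group_def)
    have "(1, 0) \<in> ?T" by simp
    then show "?T \<noteq> {}" by blast
  next
    fix a assume "a \<in> ?T"
    then obtain u f where a: "a = (u, f)" "fps_nth u 0 = 1" "fps_X ^ Suc n dvd f" "fps_X ^ Suc (Suc n) dvd 1 - u"
      by auto
    have "1 - inverse u = - inverse u * (1 - u)" using fps_unit[OF a(2)] by (simp add: algebra_simps)
    then have "fps_X ^ Suc (Suc n) dvd 1 - inverse u" using a(4) by (metis dvd_mult)
    moreover have "fps_X ^ Suc n dvd - inverse u * f" using a(3) by (rule dvd_mult)
    ultimately show "inv\<^bsub>affine_group\<^esub> a \<in> ?T" using a(1,2) by (simp add: affine_group_inv)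
  next
    fix a b assume "a \<in> ?T" "b \<in> ?T"
    then obtain u f v g where a: "a = (u, f)" "fps_nth u 0 = 1" "fps_X ^ Suc n dvd f" "fps_X ^ Suc (Suc n) dvd 1 - u"
      and b: "b = (v, g)" "fps_nth v 0 = 1" "fps_X ^ Suc n dvd g" "fps_X ^ Suc (Suc n) dvd 1 - v" by auto
    have "1 - u * v = (1 - u) + u * (1 - v)" by (simp add: algebra_simps)
    then have "fps_X ^ Suc (Suc n) dvd 1 - u * v" using a(4) b(4) by (metis dvd_add dvd_mult)
    moreover have "fps_X ^ Suc n dvd f + u * g" using a(3) b(3) by (intro dvd_add dvd_mult)
    ultimately show "a \<otimes>\<^bsub>affine_group\<^esub> b \<in> ?T" using a(1,2) b(1,2) by (simp add: affine_group_simps)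
  qed
  have "lower_central affine_group (Suc (Suc n)) \<subseteq> ?T"
    unfolding lower_central.simps
  proof (rule generate_subgroup_incl[OF UN_least[OF UN_least] T])
    fix a b assume a: "a \<in> lower_central affine_group (Suc n)" and b: "b \<in> carrier affine_group"
    obtain u f v g where ab: "a = (u, f)" "b = (v, g)" by (cases a; cases b)
    have x: "(u, f) \<in> lower_central affine_group (Suc n)" and y: "(v, g) \<in> carrier affine_group"
      using a b ab by auto
    have u: "fps_nth u 0 = 1" using lower_central_carrier[OF x] by (simp add: affine_group_simps)
    have v: "fps_nth v 0 = 1" using y by (simp add: affine_group_simps)
    have "fps_nth (1 - v) 0 = 0" using v by simp
    then have "1 - v = fps_X * fps_shift 1 (1 - v)" by (simp add: fps_eq_iff)
    then have "fps_X dvd 1 - v" by (rule dvdI)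
    then have "fps_X ^ Suc n dvd (1 - v) * f" using Suc.IH[OF x] by (simp add: mult_dvd_mono)
    moreover have "fps_X ^ Suc n dvd (1 - u) * g" using Suc.IH[OF x] by (simp add: dvd_mult2)
    ultimately have "fps_X ^ Suc n dvd (1 - v) * f - (1 - u) * g" by (rule dvd_diff)
    then show "{commutator a b} \<subseteq> ?T"
      unfolding ab using affine_group_commutator[OF u v] by simp
  qed
  then show ?case using Suc.prems by blast
qed

text \<open>The iterated commutator \<open>[\<dots>[[\<mu>\<^sub>i\<^sub>j, \<mu>\<^sub>j\<^sub>i], \<mu>\<^sub>j\<^sub>i], \<dots>]\<close>.\<close>

fun engel_word :: "nat \<Rightarrow> nat \<Rightarrow> nat \<Rightarrow> pv_word" where
  "engel_word i j 0 = [(i, j, True)]"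
| "engel_word i j (Suc n) =
    engel_word i j n @ [(j, i, True)] @ inv_word (engel_word i j n) @ [(j, i, False)]"

lemma engel_word_pv_words: "\<lbrakk>i < m; j < m; i \<noteq> j\<rbrakk> \<Longrightarrow> engel_word i j n \<in> pv_words m"
  by (induction n) auto

lemma engel_word_letters: "set (engel_word i j n) \<subseteq> {i, j} \<times> {i, j} \<times> UNIV"
proof -
  have "inv_letter ` A \<subseteq> {i, j} \<times> {i, j} \<times> UNIV" if "A \<subseteq> {i, j} \<times> {i, j} \<times> UNIV" for A
    using that by auto
  then show ?thesis by (induction n) (auto simp: inv_word_def)
qed

lemma engel_word_class:
  assumes "i < m" "j < m" "i \<noteq> j"
  shows "pv_class m (engel_word i j (Suc n)) = pv_class m (engel_word i j n) \<otimes>\<^bsub>PV m\<^esub> pv_class m [(j, i, True)]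
    \<otimes>\<^bsub>PV m\<^esub> inv\<^bsub>PV m\<^esub> pv_class m (engel_word i j n) \<otimes>\<^bsub>PV m\<^esub> inv\<^bsub>PV m\<^esub> pv_class m [(j, i, True)]"
  using assms engel_word_pv_words[OF assms, of n] by (simp add: pv_class_inv_word pv_class_append)

lemma engel_word_depth:
  assumes "i < m" "j < m" "i \<noteq> j"
  shows "pv_class m (engel_word i j n) \<in> lower_central (PV m) (Suc n)"
proof -
  interpret group "PV m" by (rule group_PV)
  show ?thesis
  proof (induction n)
    case 0
    then show ?case using assms by simp
  next
    case (Suc n)
    then show ?case unfolding engel_word_class[OF assms]
      using assms by (intro lower_central_commutator_Suc) auto
  qed
qed

lemma engel_word_not_deeper:
  assumes ij: "i < m" "j < m" "i \<noteq> j"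
  shows "pv_class m (engel_word i j n) \<notin> lower_central (PV m) (Suc (Suc n))"
proof
  assume deep: "pv_class m (engel_word i j n) \<in> lower_central (PV m) (Suc (Suc n))"
  interpret group affine_group by (rule group_affine_group)
  define f :: "nat \<Rightarrow> nat \<Rightarrow> rat fps \<times> rat fps" where
    "f a b = (if a = i \<and> b = j then (1, 1) else if a = j \<and> b = i then (1 + fps_X, 0) else (1, 0))" for a b
  have one: "f a b = \<one>\<^bsub>affine_group\<^esub>" if "{a, b} \<noteq> {i, j}" for a b
    using that by (auto simp: f_def affine_group_simps)
  have f: "f a b \<in> carrier affine_group" for a b
    by (simp add: f_def affine_group_simps)
  obtain \<phi> where \<phi>: "group_hom (PV m) affine_group \<phi>"
      "\<And>w. w \<in> pv_words m \<Longrightarrow> \<phi> (pv_class m w) = eval_word affine_group f w"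
  proof (rule PV_universal[OF group_affine_group, of m f])
    \<comment> \<open>Among three distinct strands at most one pair is \<open>{i, j}\<close>, so two of three factors are trivial.\<close>
    fix a b c :: nat assume "distinct [a, b, c]"
    then consider "f a b = \<one>\<^bsub>affine_group\<^esub>" "f a c = \<one>\<^bsub>affine_group\<^esub>" | "f a b = \<one>\<^bsub>affine_group\<^esub>" "f b c = \<one>\<^bsub>affine_group\<^esub>"
      | "f a c = \<one>\<^bsub>affine_group\<^esub>" "f b c = \<one>\<^bsub>affine_group\<^esub>"
      using one[of a b] one[of a c] one[of b c] by (auto simp: doubleton_eq_iff)
    then show "f a b \<otimes>\<^bsub>affine_group\<^esub> (f a c \<otimes>\<^bsub>affine_group\<^esub> f b c) =
        f b c \<otimes>\<^bsub>affine_group\<^esub> (f a c \<otimes>\<^bsub>affine_group\<^esub> f a b)"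
      by cases (use f in simp_all)
  next
    fix a b c d :: nat assume "distinct [a, b, c, d]"
    then have "f a b = \<one>\<^bsub>affine_group\<^esub> \<or> f c d = \<one>\<^bsub>affine_group\<^esub>"
      using one[of a b] one[of c d] by (auto simp: doubleton_eq_iff)
    then show "f a b \<otimes>\<^bsub>affine_group\<^esub> f c d = f c d \<otimes>\<^bsub>affine_group\<^esub> f a b"
      using f by auto
  qed (use f in auto)
  interpret \<phi>: group_hom "PV m" affine_group \<phi> by (rule \<phi>(1))
  have ji: "\<phi> (pv_class m [(j, i, True)]) = (1 + fps_X, 0)"
    using \<phi>(2) ij by (simp add: f_def affine_group_simps)
  have "\<phi> (pv_class m (engel_word i j n)) = (1, (- fps_X) ^ n)"
  proof (induction n)
    case 0
    then show ?case using \<phi>(2) ij by (simp add: f_def affine_group_simps)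
  next
    case (Suc n)
    then show ?case unfolding engel_word_class[OF ij]
      using ij engel_word_pv_words[OF ij] ji affine_group_commutator[of 1 "1 + fps_X"] by simp
  qed
  then have "(1, (- fps_X) ^ n) \<in> lower_central affine_group (Suc (Suc n))"
    using lower_central_hom[OF \<phi>(1) deep] by simp
  then have "fps_X ^ Suc n dvd ((- fps_X) ^ n :: rat fps)"
    using lower_central_affine_group[of 1 "(- fps_X) ^ n" "Suc n"] by blast
  then obtain k :: "rat fps" where k: "(- fps_X) ^ n = fps_X ^ Suc n * k" by (rule dvdE)
  have "fps_nth ((- fps_X :: rat fps) ^ n) n = (-1) ^ n"
    by (cases "even n") (simp_all add: fps_X_power_nth)
  moreover have "fps_nth (fps_X ^ Suc n * k) n = 0" by (simp only: fps_X_power_mult_nth) simp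
  ultimately show False using k by simp
qed

section \<open>Generated equivalences and isotopy\<close>

lemma generated_equiv_refl [simp]: "generated_equiv k R D D"
  by (simp add: generated_equiv_def)

lemma generated_equiv_sym: "generated_equiv k R D E \<Longrightarrow> generated_equiv k R E D"
  unfolding generated_equiv_def by (rule equivclp_sym)

lemma generated_equiv_trans [trans]:
  "generated_equiv k R D E \<Longrightarrow> generated_equiv k R E F \<Longrightarrow> generated_equiv k R D F"
  unfolding generated_equiv_def by (rule equivclp_trans)

lemma generated_equivI:
  "\<lbrakk>D \<in> gauss_diagrams k; E \<in> gauss_diagrams k; isotopic D E \<or> R D E\<rbrakk> \<Longrightarrow> generated_equiv k R D E"
  unfolding generated_equiv_def by (rule r_into_equivclp) simp

lemma generated_equiv_map:
  assumes "generated_equiv m R D E"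
    and "\<And>D E. \<lbrakk>D \<in> gauss_diagrams m; E \<in> gauss_diagrams m; isotopic D E\<rbrakk> \<Longrightarrow> generated_equiv k R' (F D) (F E)"
    and "\<And>D E. \<lbrakk>D \<in> gauss_diagrams m; E \<in> gauss_diagrams m; R D E\<rbrakk> \<Longrightarrow> generated_equiv k R' (F D) (F E)"
  shows "generated_equiv k R' (F D) (F E)"
  using assms(1) unfolding generated_equiv_def[of m]
proof (induction rule: equivclp_induct)
  case base
  then show ?case by simp
next
  case (step y z)
  then show ?case using assms(2,3) generated_equiv_sym generated_equiv_trans by metis
qed

lemma generated_equiv_mono:
  assumes "generated_equiv k R D E"
    and "\<And>D E. \<lbrakk>D \<in> gauss_diagrams k; E \<in> gauss_diagrams k; R D E\<rbrakk> \<Longrightarrow> generated_equiv k R' D E"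
  shows "generated_equiv k R' D E"
  using generated_equiv_map[OF assms(1), of k R' "\<lambda>D. D"] assms(2) by (simp add: generated_equivI)

lemma map_endpoint_simps [simp]:
  "arrow_of (map_endpoint f x) = f (arrow_of x)"
  by (cases x) auto

lemma map_endpoint_inj: "inj_on f A \<Longrightarrow> arrow_of x \<in> A \<Longrightarrow> arrow_of y \<in> A \<Longrightarrow>
    map_endpoint f x = map_endpoint f y \<longleftrightarrow> x = y"
  by (cases x; cases y) (auto dest: inj_onD)

lemma Tail_map_endpoint_iff: "Tail b = map_endpoint f x \<longleftrightarrow> (\<exists>a. x = Tail a \<and> b = f a)"
  and Head_map_endpoint_iff: "Head b = map_endpoint f x \<longleftrightarrow> (\<exists>a. x = Head a \<and> b = f a)"
  by (cases x; auto)+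

lemma strands_map_endpoint:
  assumes "strands E = map (map (map_endpoint f)) (strands D)"
  shows "endpoints E = map_endpoint f ` endpoints D" "arrows E = f ` arrows D"
proof -
  show "endpoints E = map_endpoint f ` endpoints D"
    by (simp add: assms endpoints_def image_UN)
  then show "arrows E = f ` arrows D" by (simp add: arrows_def image_image)
qed

lemma isotopic_refl [simp]: "isotopic D D"
  by (auto simp: isotopic_def endpoint.map_id0 list.map_id0 intro!: exI[of _ id])

lemma isotopic_trans [trans]:
  assumes "isotopic D E" "isotopic E F"
  shows "isotopic D F"
proof -
  obtain f where f: "inj_on f (arrows D)" "strands E = map (map (map_endpoint f)) (strands D)"
      "\<forall>a\<in>arrows D. sign E (f a) = sign D a" using assms(1) by (auto simp: isotopic_def)
  obtain g where g: "inj_on g (arrows E)" "strands F = map (map (map_endpoint g)) (strands E)"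
      "\<forall>a\<in>arrows E. sign F (g a) = sign E a" using assms(2) by (auto simp: isotopic_def)
  have arr: "arrows E = f ` arrows D" by (rule strands_map_endpoint(2)[OF f(2)])
  show ?thesis unfolding isotopic_def
    using f g arr by (intro exI[of _ "g \<circ> f"]) (auto simp: comp_inj_on endpoint.map_comp)
qed

lemma isotopic_sym:
  assumes "isotopic D E"
  shows "isotopic E D"
proof -
  obtain f where f: "inj_on f (arrows D)" "strands E = map (map (map_endpoint f)) (strands D)"
      "\<forall>a\<in>arrows D. sign E (f a) = sign D a" using assms(1) by (auto simp: isotopic_def)
  have arr: "arrows E = f ` arrows D" by (rule strands_map_endpoint(2)[OF f(2)])
  define g where "g = inv_into (arrows D) f"
  have g: "g (f a) = a" if "a \<in> arrows D" for a using that f(1) by (simp add: g_def)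
  have "map_endpoint g (map_endpoint f x) = x" if "x \<in> endpoints D" for x
    using g that by (cases x) (force simp: arrows_def)+
  then have "map (map (map_endpoint g)) (strands E) = strands D"
    unfolding f(2) map_map comp_def by (intro map_idI) (auto simp: endpoints_def)
  moreover have "inj_on g (arrows E)" unfolding arr by (rule inj_onI) (use g in auto)
  ultimately show ?thesis using f arr g by (auto simp: isotopic_def intro!: exI[of _ g])
qed

lemma isotopic_gauss_diagrams:
  assumes "isotopic D E" "D \<in> gauss_diagrams k"
  shows "E \<in> gauss_diagrams k"
proof -
  obtain f where f: "inj_on f (arrows D)" "strands E = map (map (map_endpoint f)) (strands D)"
      "\<forall>a\<in>arrows D. sign E (f a) = sign D a" using assms(1) by (auto simp: isotopic_def)
  have arr: "arrows E = f ` arrows D" and ends: "endpoints E = map_endpoint f ` endpoints D"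
    by (rule strands_map_endpoint[OF f(2)])+
  have conc: "concat (strands E) = map (map_endpoint f) (concat (strands D))"
    by (simp add: f(2) map_concat)
  have "inj_on (map_endpoint f) (endpoints D)"
    by (rule inj_onI) (use f(1) map_endpoint_inj in \<open>force simp: arrows_def\<close>)
  then have "distinct (concat (strands E))"
    using assms(2) unfolding conc distinct_map by (simp add: gauss_diagrams_def endpoints_def)
  moreover have "Tail b \<in> endpoints E \<longleftrightarrow> Head b \<in> endpoints E" for b
    using assms(2) unfolding ends
    by (auto simp: image_iff Tail_map_endpoint_iff Head_map_endpoint_iff gauss_diagrams_def)
  ultimately show ?thesis using assms(2) f arr by (auto simp: gauss_diagrams_def)
qed

lemma isotopic_same_strandsI:
  "\<lbrakk>strands D = strands E; \<And>a. a \<in> arrows D \<Longrightarrow> sign D a = sign E a\<rbrakk> \<Longrightarrow> isotopic D E"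
  by (auto simp: isotopic_def endpoint.map_id0 list.map_id0 intro!: exI[of _ id])

definition relabel :: "('a \<Rightarrow> 'b) \<Rightarrow> 'a gauss_diagram \<Rightarrow> 'b gauss_diagram" where
  "relabel f D = Gauss_Diagram (map (map (map_endpoint f)) (strands D)) (sign D \<circ> inv_into UNIV f)"

lemma isotopic_relabel: "inj f \<Longrightarrow> isotopic D (relabel f D)"
  by (auto simp: isotopic_def relabel_def intro!: exI[of _ f] inj_on_subset[of f UNIV])

lemma arrow_endpoints:
  assumes "D \<in> gauss_diagrams k" "a \<in> arrows D"
  shows "Tail a \<in> endpoints D" "Head a \<in> endpoints D"
proof -
  obtain x where "x \<in> endpoints D" "a = arrow_of x" using assms(2) by (auto simp: arrows_def)
  then show "Tail a \<in> endpoints D" "Head a \<in> endpoints D"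
    using assms(1) by (cases x; auto simp: gauss_diagrams_def)+
qed

lemma strands_delete_arrows:
  "strands (delete_arrows A D) = map (filter (\<lambda>x. arrow_of x \<notin> A)) (strands D)"
  and sign_delete_arrows [simp]: "sign (delete_arrows A D) = sign D"
  by (simp_all add: delete_arrows_def)

lemma endpoints_delete_arrows [simp]:
  "endpoints (delete_arrows A D) = {x \<in> endpoints D. arrow_of x \<notin> A}"
  by (auto simp: delete_arrows_def endpoints_def)

lemma arrows_delete_arrows [simp]: "arrows (delete_arrows A D) = arrows D - A"
  by (auto simp: arrows_def)

lemma delete_arrows_gauss_diagrams:
  assumes "D \<in> gauss_diagrams k"
  shows "delete_arrows A D \<in> gauss_diagrams k"
proof -
  have "concat (strands (delete_arrows A D)) = filter (\<lambda>x. arrow_of x \<notin> A) (concat (strands D))"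
    by (simp add: strands_delete_arrows filter_concat)
  then show ?thesis using assms by (auto simp: gauss_diagrams_def strands_delete_arrows)
qed

lemma RII_gauss_diagrams: "\<lbrakk>RII D E; D \<in> gauss_diagrams k\<rbrakk> \<Longrightarrow> E \<in> gauss_diagrams k"
  by (auto simp: RII_def delete_arrows_gauss_diagrams)

lemma consecutive_relabel:
  assumes "consecutive D x y"
  shows "consecutive (relabel f D) (map_endpoint f x) (map_endpoint f y)"
proof -
  obtain u v where "u @ [x, y] @ v \<in> set (strands D)" using assms by (auto simp: consecutive_def)
  then have "map (map_endpoint f) (u @ [x, y] @ v) \<in> set (strands (relabel f D))"
    unfolding relabel_def gauss_diagram.sel set_map by (rule imageI)
  then show ?thesis unfolding consecutive_def by auto
qed

lemma sign_relabel [simp]: "inj f \<Longrightarrow> sign (relabel f D) (f a) = sign D a"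
  by (simp add: relabel_def)

lemma arrows_relabel [simp]: "arrows (relabel f D) = f ` arrows D"
  by (rule strands_map_endpoint(2)) (simp add: relabel_def)

lemma relabel_delete_arrows: "inj f \<Longrightarrow> relabel f (delete_arrows A D) = delete_arrows (f ` A) (relabel f D)"
  by (auto simp: relabel_def delete_arrows_def filter_map comp_def inj_image_mem_iff intro!: filter_cong)

lemma RII_relabel:
  assumes "inj f" "RII D E"
  shows "RII (relabel f D) (relabel f E)"
proof -
  obtain a b where ab: "a \<in> arrows D" "b \<in> arrows D" "a \<noteq> b" "sign D a = - sign D b"
    "adjacent D (Tail a) (Tail b)" "adjacent D (Head a) (Head b)" "E = delete_arrows {a, b} D"
    using assms(2) by (auto simp: RII_def)
  have "f a \<noteq> f b" using assms(1) ab(3) by (auto dest: injD)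
  moreover have "adjacent (relabel f D) (Tail (f a)) (Tail (f b))" "adjacent (relabel f D) (Head (f a)) (Head (f b))"
    using ab(5,6) consecutive_relabel[of D _ _ f] unfolding adjacent_def by (metis endpoint.map)+
  ultimately show ?thesis
    using ab assms(1) unfolding RII_def
    by (intro bexI[of _ "f a"] bexI[of _ "f b"]) (auto simp: relabel_delete_arrows)
qed

text \<open>The permutation of endpoints performed by the third Reidemeister move.\<close>

definition swap3 :: "'a \<Rightarrow> 'a \<Rightarrow> 'a \<Rightarrow> 'a endpoint \<Rightarrow> 'a endpoint" where
  "swap3 a b c = transpose (Tail a) (Tail b) \<circ> transpose (Head a) (Tail c) \<circ> transpose (Head b) (Head c)"

lemma swap3_map_endpoint:
  assumes "inj f"
  shows "swap3 (f a) (f b) (f c) (map_endpoint f x) = map_endpoint f (swap3 a b c x)"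
proof -
  have *: "transpose (map_endpoint f u) (map_endpoint f v) (map_endpoint f y) = map_endpoint f (transpose u v y)"
    for u v y using assms by (auto simp: transpose_def map_endpoint_inj[OF assms])
  have "map_endpoint f (swap3 a b c x) = transpose (map_endpoint f (Tail a)) (map_endpoint f (Tail b))
    (transpose (map_endpoint f (Head a)) (map_endpoint f (Tail c))
    (transpose (map_endpoint f (Head b)) (map_endpoint f (Head c)) (map_endpoint f x)))"
    unfolding * by (simp add: swap3_def)
  then show ?thesis by (simp add: swap3_def)
qed

lemma RIII_relabel:
  assumes "inj f" "RIII D E"
  shows "RIII (relabel f D) (relabel f E)"
proof -
  obtain a b c where abc: "a \<in> arrows D" "b \<in> arrows D" "c \<in> arrows D" "a \<noteq> b" "a \<noteq> c" "b \<noteq> c"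
    "sign D a = sign D b" "sign D b = sign D c"
    "consecutive D (Tail a) (Tail b)" "consecutive D (Head a) (Tail c)" "consecutive D (Head b) (Head c)"
    "E = Gauss_Diagram (map (map (swap3 a b c)) (strands D)) (sign D)"
    using assms(2) unfolding RIII_def swap3_def by blast
  have ne: "f a \<noteq> f b" "f a \<noteq> f c" "f b \<noteq> f c" using assms(1) abc(4-6) by (auto dest: injD)
  have "relabel f E = Gauss_Diagram (map (map (swap3 (f a) (f b) (f c))) (strands (relabel f D))) (sign (relabel f D))"
    by (simp add: abc(12) relabel_def swap3_map_endpoint[OF assms(1)])
  moreover note abc(9-11)[THEN consecutive_relabel, of f, simplified endpoint.map]
  ultimately show ?thesis
    using abc ne assms(1) unfolding RIII_def swap3_def[symmetric]
    by (intro bexI[of _ "f a"] bexI[of _ "f b"] bexI[of _ "f c"]) auto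
qed

lemma RIII_gauss_diagrams:
  assumes "RIII D E" "D \<in> gauss_diagrams k"
  shows "E \<in> gauss_diagrams k"
proof -
  obtain a b c where abc: "a \<in> arrows D" "b \<in> arrows D" "c \<in> arrows D"
    "E = Gauss_Diagram (map (map (swap3 a b c)) (strands D)) (sign D)"
    using assms(1) unfolding RIII_def swap3_def by blast
  have ends: "Tail a \<in> endpoints D" "Tail b \<in> endpoints D" "Head a \<in> endpoints D" "Tail c \<in> endpoints D"
    "Head b \<in> endpoints D" "Head c \<in> endpoints D"
    using abc arrow_endpoints[OF assms(2)] by auto
  have inj: "inj (swap3 a b c)" unfolding swap3_def
    by (intro inj_compose) (simp_all add: inj_transpose)
  have mem: "swap3 a b c x \<in> endpoints D" if "x \<in> endpoints D" for x
    using that ends by (auto simp: swap3_def transpose_def)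
  have fin: "finite (endpoints D)" by (simp add: endpoints_def)
  have "swap3 a b c ` endpoints D = endpoints D"
    using mem by (intro card_subset_eq fin) (auto simp: card_image inj_on_subset[OF inj])
  then have E: "endpoints E = endpoints D" by (simp add: abc(4) endpoints_def image_UN)
  have "concat (strands E) = map (swap3 a b c) (concat (strands D))" by (simp add: abc(4) map_concat)
  then have "distinct (concat (strands E))"
    using assms(2) inj_on_subset[OF inj] by (simp add: distinct_map gauss_diagrams_def)
  then show ?thesis using assms(2) E by (auto simp: gauss_diagrams_def arrows_def abc(4))
qed

section \<open>Attaching and reversing strands\<close>

lemma map_endpoint_Inl_neq_Inr [simp]: "map_endpoint Inl y \<noteq> map_endpoint Inr z"
  by (cases y; cases z) simp_all

lemmas map_endpoint_Inr_neq_Inl [simp] = map_endpoint_Inl_neq_Inr[symmetric]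

lemma map_endpoint_Inl_eq [simp]: "map_endpoint Inl y = map_endpoint Inl z \<longleftrightarrow> y = z"
  by (cases y; cases z) simp_all

lemma map_endpoint_Inr_eq [simp]: "map_endpoint Inr y = map_endpoint Inr z \<longleftrightarrow> y = z"
  by (cases y; cases z) simp_all

lemma distinct_concat_nth_disjoint:
  "\<lbrakk>distinct (concat xss); i < length xss; j < length xss; i \<noteq> j\<rbrakk> \<Longrightarrow> set (xss ! i) \<inter> set (xss ! j) = {}"
proof (induction xss arbitrary: i j)
  case Nil
  then show ?case by simp
next
  case (Cons xs xss)
  have "set xs \<inter> set (xss ! k) = {}" if "k < length xss" for k
    using Cons.prems(1) that by fastforce
  then show ?case using Cons by (cases i; cases j) (auto simp: Int_commute)
qed

lemma distinct_concat_nth: "\<lbrakk>distinct (concat xss); i < length xss\<rbrakk> \<Longrightarrow> distinct (xss ! i)"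
  by (induction xss arbitrary: i) (auto simp: nth_Cons split: nat.splits)

lemma concat_map_fill:
  assumes "distinct (concat (map old_part s))" "distinct (concat (map slot_part s))"
    and "set (concat (map slot_part s)) \<subseteq> {..<length (strands E)}"
    and "distinct (concat (strands E))"
  shows "distinct (concat (map (fill E) s)) \<and> set (concat (map (fill E) s)) =
    map_endpoint Inl ` set (concat (map old_part s)) \<union>
    (\<Union>j\<in>set (concat (map slot_part s)). map_endpoint Inr ` set (strands E ! j))"
  using assms(1-3)
proof (induction s)
  case Nil
  then show ?case by simp
next
  case (Cons x s)
  have IH: "distinct (concat (map (fill E) s))" "set (concat (map (fill E) s)) =
    map_endpoint Inl ` set (concat (map old_part s)) \<union>
    (\<Union>j\<in>set (concat (map slot_part s)). map_endpoint Inr ` set (strands E ! j))"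
    using Cons.IH Cons.prems by auto
  show ?case
  proof (cases x)
    case (Old y)
    then show ?thesis using IH Cons.prems by (auto simp del: set_concat)
  next
    case (Slot j r)
    have disj: "set (strands E ! j) \<inter> set (strands E ! i) = {}" if "i \<in> set (concat (map slot_part s))" for i
      using that Cons.prems Slot by (intro distinct_concat_nth_disjoint[OF assms(4)]) auto
    have "distinct (strands E ! j)" using Cons.prems Slot by (intro distinct_concat_nth[OF assms(4)]) auto
    then have "distinct (map (map_endpoint Inr) (strands E ! j))"
      by (auto simp: distinct_map inj_on_def)
    then have "distinct (fill E x)" "set (fill E x) = map_endpoint Inr ` set (strands E ! j)"
      using Slot by (simp_all flip: rev_map)
    moreover have "set (fill E x) \<inter> set (concat (map (fill E) s)) = {}"
      unfolding IH(2) calculation(2) using disj by (fastforce simp del: set_concat)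
    ultimately show ?thesis using IH Slot by (auto simp del: set_concat)
  qed
qed

lemma set_concat_nth: "set (concat xss) = (\<Union>j<length xss. set (xss ! j))"
proof -
  have "set xss = (\<lambda>j. xss ! j) ` {..<length xss}" by (auto simp: set_conv_nth)
  then show ?thesis by simp
qed

lemma concat_map_concat: "concat (map (\<lambda>s. concat (map g s)) e) = concat (map g (concat e))"
  by (induction e) auto

lemma attach_endpoints:
  assumes "embedding m D e" "length (strands E) = m" "distinct (concat (strands D))" "distinct (concat (strands E))"
  shows "distinct (concat (strands (attach D E e)))"
    "endpoints (attach D E e) = map_endpoint Inl ` endpoints D \<union> map_endpoint Inr ` endpoints E"
proof -
  have old: "concat (map old_part (concat e)) = concat (strands D)"
    using assms(1) by (simp add: embedding_def flip: concat_map_concat)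
  have slots: "distinct (concat (map slot_part (concat e)))" "set (concat (map slot_part (concat e))) = {..<m}"
    using assms(1) by (auto simp: embedding_def)
  have eq: "concat (strands (attach D E e)) = concat (map (fill E) (concat e))"
    by (simp add: attach_def concat_map_concat)
  note * = concat_map_fill[of "concat e" E, unfolded old slots(2), OF assms(3) slots(1) _ assms(4)]
  show "distinct (concat (strands (attach D E e)))" unfolding eq using * assms(2) by blast
  have "(\<Union>j<m. g ` set (strands E ! j)) = g ` endpoints E" for g :: "'b endpoint \<Rightarrow> ('a + 'b) endpoint"
    using assms(2) by (auto simp: endpoints_def set_concat_nth simp del: set_concat)
  then show "endpoints (attach D E e) = map_endpoint Inl ` endpoints D \<union> map_endpoint Inr ` endpoints E"
    using * assms(2) by (simp add: endpoints_def eq del: set_concat)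
qed

lemma embedding_length: "embedding m D e \<Longrightarrow> length e = length (strands D)"
  unfolding embedding_def by (metis length_map)

lemma arrows_attach:
  assumes "embedding m D e" "length (strands E) = m" "distinct (concat (strands D))" "distinct (concat (strands E))"
  shows "arrows (attach D E e) = Inl ` arrows D \<union> Inr ` arrows E"
  unfolding arrows_def attach_endpoints(2)[OF assms] by (simp add: image_Un image_image)

lemma attach_gauss_diagrams:
  assumes "embedding m D e" "D \<in> gauss_diagrams k" "E \<in> gauss_diagrams m"
  shows "attach D E e \<in> gauss_diagrams k"
proof -
  have D: "length (strands D) = k" "distinct (concat (strands D))"
    and E: "length (strands E) = m" "distinct (concat (strands E))"
    using assms by (auto simp: gauss_diagrams_def)
  note ends = attach_endpoints[OF assms(1) E(1) D(2) E(2)]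
  have "Tail a \<in> endpoints (attach D E e) \<longleftrightarrow> Head a \<in> endpoints (attach D E e)" for a
  proof -
    have "Tail b \<in> endpoints D \<longleftrightarrow> Head b \<in> endpoints D" "Tail c \<in> endpoints E \<longleftrightarrow> Head c \<in> endpoints E" for b c
      using assms(2,3) by (auto simp: gauss_diagrams_def)
    then show ?thesis
      unfolding ends(2) by (cases a) (auto simp: image_iff Tail_map_endpoint_iff Head_map_endpoint_iff)
  qed
  moreover have "sign (attach D E e) a \<in> {1, -1}" if a: "a \<in> arrows (attach D E e)" for a
  proof -
    have D: "sign D b = 1 \<or> sign D b = -1" if "b \<in> arrows D" for b
      using that assms(2) by (simp add: gauss_diagrams_def)
    have E: "sign E b = 1 \<or> sign E b = -1" if "b \<in> arrows E" for b
      using that assms(3) by (simp add: gauss_diagrams_def)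
    consider b where "a = Inl b" "b \<in> arrows D" | b where "a = Inr b" "b \<in> arrows E"
      using a arrows_attach[OF assms(1) \<open>length (strands E) = m\<close> \<open>distinct (concat (strands D))\<close>
        \<open>distinct (concat (strands E))\<close>] by auto
    then show ?thesis
    proof cases
      case 1
      then show ?thesis using D by (simp add: attach_def)
    next
      case 2
      then show ?thesis using E[OF 2(2)] by (auto simp: attach_def)
    qed
  qed
  ultimately show ?thesis using ends(1) D(1) embedding_length[OF assms(1)]
    by (simp add: gauss_diagrams_def attach_def)
qed

definition unreversed :: "'a embedding \<Rightarrow> bool" where
  "unreversed e \<longleftrightarrow> (\<forall>j. Slot j True \<notin> set (concat e))"

lemma unreversed_attach:
  "unreversed e \<Longrightarrow> attach D E e = Gauss_Diagram (map (\<lambda>s. concat (map (fill E) s)) e) (case_sum (sign D) (sign E))"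
  by (simp add: attach_def on_reversed_def unreversed_def)

lemma sign_attach [simp]:
  "sign (attach D E e) (Inl a) = sign D a"
  "unreversed e \<Longrightarrow> sign (attach D E e) (Inr b) = sign E b"
  by (simp_all add: attach_def on_reversed_def unreversed_def)

definition map_unreversed :: "'a embedding \<Rightarrow> 'a embedding" where
  "map_unreversed e = map (map (\<lambda>x. case x of Old y \<Rightarrow> Old y | Slot j r \<Rightarrow> Slot j False)) e"

definition on_strands :: "nat set \<Rightarrow> 'a gauss_diagram \<Rightarrow> 'a endpoint \<Rightarrow> bool" where
  "on_strands J E x \<longleftrightarrow> (\<exists>j\<in>J. j < length (strands E) \<and> x \<in> set (strands E ! j))"

text \<open>
  The effect of reversing some strands of an embedding, transferred to the attached diagram.
\<close>

definition reverse_strands :: "nat set \<Rightarrow> 'a gauss_diagram \<Rightarrow> 'a gauss_diagram" where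
  "reverse_strands J E = Gauss_Diagram
     (map (\<lambda>j. if j \<in> J then rev (strands E ! j) else strands E ! j) [0..<length (strands E)])
     (\<lambda>a. if on_strands J E (Tail a) \<noteq> on_strands J E (Head a) then - sign E a else sign E a)"

lemma unreversed_map_unreversed: "unreversed (map_unreversed e)"
  by (auto simp: unreversed_def map_unreversed_def split: item.splits)

lemma embedding_map_unreversed:
  assumes "embedding m D e"
  shows "embedding m D (map_unreversed e)"
proof -
  have "old_part (case x of Old y \<Rightarrow> Old y | Slot j r \<Rightarrow> Slot j False) = old_part x"
    "slot_part (case x of Old y \<Rightarrow> Old y | Slot j r \<Rightarrow> Slot j False) = slot_part x" for x :: "'a item"
    by (auto split: item.splits)
  then show ?thesis using assms
    by (simp add: embedding_def map_unreversed_def comp_def flip: map_concat del: set_concat)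
qed

lemma Slot_unique:
  "\<lbrakk>distinct (concat (map slot_part s)); Slot j r \<in> set s; Slot j r' \<in> set s\<rbrakk> \<Longrightarrow> r = r'"
proof (induction s)
  case (Cons x s)
  have *: "j \<in> set (concat (map slot_part s))" if "Slot j q \<in> set s" for q
    using that by (auto intro!: bexI[of _ "Slot j q"])
  show ?case using Cons * by (cases x) auto
qed simp

text \<open>
  It therefore suffices to study attachments that preserve all orientations.
\<close>

lemma attach_reverse_strands:
  assumes "embedding m D e" "length (strands E) = m"
  shows "attach D E e = attach D (reverse_strands {j. Slot j True \<in> set (concat e)} E) (map_unreversed e)"
proof -
  let ?J = "{j. Slot j True \<in> set (concat e)}"
  have fill: "fill (reverse_strands ?J E) (case x of Old y \<Rightarrow> Old y | Slot j r \<Rightarrow> Slot j False) = fill E x"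
    if "x \<in> set (concat e)" for x
  proof (cases x)
    case (Slot j r)
    have "j \<in> set (concat (map slot_part (concat e)))" using that Slot by (auto intro!: bexI[of _ x])
    then have "j < length (strands E)" using assms unfolding embedding_def by blast
    moreover have "r \<longleftrightarrow> j \<in> ?J"
      using Slot_unique[of "concat e" j r True] that assms(1) Slot by (cases r) (auto simp: embedding_def)
    ultimately show ?thesis using Slot by (simp add: reverse_strands_def)
  qed simp
  have "map (\<lambda>s. concat (map (fill E) s)) e =
      map (\<lambda>s. concat (map (fill (reverse_strands ?J E)) s)) (map_unreversed e)"
    unfolding map_unreversed_def map_map comp_def
  proof (rule map_cong[OF refl])
    fix s assume "s \<in> set e"
    then have "map (fill E) s = map (\<lambda>x. fill (reverse_strands ?J E) (case x of Old y \<Rightarrow> Old y | Slot j r \<Rightarrow> Slot j False)) s"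
      by (intro map_cong[OF refl] fill[symmetric]) auto
    then show "concat (map (fill E) s) =
      concat (map (\<lambda>x. fill (reverse_strands ?J E) (case x of Old y \<Rightarrow> Old y | Slot j r \<Rightarrow> Slot j False)) s)"
      by (rule arg_cong)
  qed
  moreover have "on_reversed e E = on_strands ?J E"
    by (auto simp: on_reversed_def on_strands_def fun_eq_iff)
  ultimately show ?thesis
    unfolding unreversed_attach[OF unreversed_map_unreversed]
    by (simp add: attach_def reverse_strands_def)
qed

lemma length_reverse_strands [simp]: "length (strands (reverse_strands J E)) = length (strands E)"
  by (simp add: reverse_strands_def)

lemma nth_reverse_strands:
  "j < length (strands E) \<Longrightarrow> strands (reverse_strands J E) ! j = (if j \<in> J then rev (strands E ! j) else strands E ! j)"
  by (simp add: reverse_strands_def)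

lemma endpoints_reverse_strands [simp]: "endpoints (reverse_strands J E) = endpoints E"
  by (auto simp: endpoints_def nth_reverse_strands set_concat_nth simp del: set_concat split: if_splits)

lemma sign_reverse_strands: "sign (reverse_strands J E) a =
    (if on_strands J E (Tail a) \<noteq> on_strands J E (Head a) then - sign E a else sign E a)"
  by (simp add: reverse_strands_def)

lemma arrows_reverse_strands [simp]: "arrows (reverse_strands J E) = arrows E"
  by (simp add: arrows_def)

lemma distinct_concat_nthI:
  assumes "\<And>i. i < length xss \<Longrightarrow> distinct (xss ! i)"
    and "\<And>i j. \<lbrakk>i < length xss; j < length xss; i \<noteq> j\<rbrakk> \<Longrightarrow> set (xss ! i) \<inter> set (xss ! j) = {}"
  shows "distinct (concat xss)"
  using assms
proof (induction xss)
  case (Cons xs xss)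
  have "distinct (concat xss)"
    using Cons.prems(1)[of "Suc _"] Cons.prems(2)[of "Suc _" "Suc _"] by (intro Cons.IH) auto
  moreover have "set xs \<inter> set (xss ! k) = {}" if "k < length xss" for k
    using Cons.prems(2)[of 0 "Suc k"] that by simp
  then have "set xs \<inter> set (concat xss) = {}" by (fastforce simp: in_set_conv_nth)
  ultimately show ?case using Cons.prems(1)[of 0] by simp
qed simp

lemma reverse_strands_gauss_diagrams:
  assumes "E \<in> gauss_diagrams m"
  shows "reverse_strands J E \<in> gauss_diagrams m"
proof -
  have d: "distinct (concat (strands E))" using assms by (simp add: gauss_diagrams_def)
  have "distinct (concat (strands (reverse_strands J E)))"
    using distinct_concat_nth[OF d] distinct_concat_nth_disjoint[OF d]
    by (intro distinct_concat_nthI) (auto simp: nth_reverse_strands)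
  then show ?thesis using assms by (auto simp: gauss_diagrams_def) (auto simp: reverse_strands_def)
qed

lemma on_strands_map_endpoint:
  assumes "inj_on f (arrows E)" "strands E' = map (map (map_endpoint f)) (strands E)" "x \<in> endpoints E"
  shows "on_strands J E' (map_endpoint f x) = on_strands J E x"
proof -
  have "map_endpoint f x \<in> set (strands E' ! j) \<longleftrightarrow> x \<in> set (strands E ! j)" if j: "j < length (strands E)" for j
  proof -
    have "y \<in> endpoints E" if "y \<in> set (strands E ! j)" for y
      using that j by (auto simp: endpoints_def)
    then have "map_endpoint f x = map_endpoint f y \<longleftrightarrow> x = y" if "y \<in> set (strands E ! j)" for y
      using map_endpoint_inj[OF assms(1), of x y] that assms(3) by (auto simp: arrows_def)
    then show ?thesis using j assms(2) by auto
  qed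
  then show ?thesis using assms(2) by (auto simp: on_strands_def)
qed

lemma isotopic_reverse_strands:
  assumes "isotopic E E'" "E \<in> gauss_diagrams m"
  shows "isotopic (reverse_strands J E) (reverse_strands J E')"
proof -
  obtain f where f: "inj_on f (arrows E)" "strands E' = map (map (map_endpoint f)) (strands E)"
      "\<forall>a\<in>arrows E. sign E' (f a) = sign E a" using assms(1) by (auto simp: isotopic_def)
  have "on_strands J E' (Tail (f a)) = on_strands J E (Tail a)"
    "on_strands J E' (Head (f a)) = on_strands J E (Head a)" if "a \<in> arrows E" for a
    using on_strands_map_endpoint[OF f(1,2)] arrow_endpoints[OF assms(2) that]
    by (metis endpoint.map)+
  moreover have "strands (reverse_strands J E') = map (map (map_endpoint f)) (strands (reverse_strands J E))"
    using f(2) by (intro nth_equalityI) (auto simp: nth_reverse_strands rev_map)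
  ultimately show ?thesis using f(1,3) unfolding isotopic_def
    by (intro exI[of _ f]) (auto simp: sign_reverse_strands)
qed

lemma isotopic_delete_reverse_strands:
  assumes "E \<in> gauss_diagrams m"
  shows "isotopic (delete_arrows A (reverse_strands J E)) (reverse_strands J (delete_arrows A E))"
proof (rule isotopic_same_strandsI)
  show "strands (delete_arrows A (reverse_strands J E)) = strands (reverse_strands J (delete_arrows A E))"
    by (rule nth_equalityI) (auto simp: strands_delete_arrows nth_reverse_strands rev_filter)
  fix a assume "a \<in> arrows (delete_arrows A (reverse_strands J E))"
  then have "on_strands J (delete_arrows A E) (Tail a) = on_strands J E (Tail a)"
    "on_strands J (delete_arrows A E) (Head a) = on_strands J E (Head a)"
    by (auto simp: on_strands_def strands_delete_arrows)
  then show "sign (delete_arrows A (reverse_strands J E)) a = sign (reverse_strands J (delete_arrows A E)) a"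
    by (simp add: sign_reverse_strands)
qed

lemma consecutiveE:
  assumes "consecutive E x y"
  obtains j u v where "j < length (strands E)" "strands E ! j = u @ [x, y] @ v"
  using assms unfolding consecutive_def by (metis in_set_conv_nth)

lemma consecutive_on_strands:
  assumes "consecutive E x y" "E \<in> gauss_diagrams m"
  shows "on_strands J E x = on_strands J E y"
proof -
  obtain j u v where j: "j < length (strands E)" "strands E ! j = u @ [x, y] @ v"
    using assms(1) by (rule consecutiveE)
  have d: "distinct (concat (strands E))" using assms(2) by (simp add: gauss_diagrams_def)
  have "z \<in> set (strands E ! i) \<longleftrightarrow> i = j" if "i < length (strands E)" "z \<in> {x, y}" for i z
  proof -
    have "z \<in> set (strands E ! j)" using that(2) j(2) by auto
    then show ?thesis using distinct_concat_nth_disjoint[OF d that(1) j(1)] by blast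
  qed
  then show ?thesis unfolding on_strands_def by blast
qed

lemma adjacent_reverse_strands:
  assumes "adjacent E x y"
  shows "adjacent (reverse_strands J E) x y"
proof -
  have "adjacent (reverse_strands J E) x y" if "consecutive E x y" for x y
  proof -
    obtain j u v where j: "j < length (strands E)" "strands E ! j = u @ [x, y] @ v"
      using \<open>consecutive E x y\<close> by (rule consecutiveE)
    then have "strands (reverse_strands J E) ! j \<in> set (strands (reverse_strands J E))" by simp
    then have "u @ [x, y] @ v \<in> set (strands (reverse_strands J E)) \<or>
        rev v @ [y, x] @ rev u \<in> set (strands (reverse_strands J E))"
      using j by (auto simp: nth_reverse_strands split: if_splits)
    then show ?thesis by (auto simp: adjacent_def consecutive_def)
  qed
  then show ?thesis using assms unfolding adjacent_def by blast
qed

lemma RII_reverse_strands: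
  assumes "RII E E'" "E \<in> gauss_diagrams m"
  shows "generated_equiv m RII (reverse_strands J E) (reverse_strands J E')"
proof -
  obtain a b where ab: "a \<in> arrows E" "b \<in> arrows E" "a \<noteq> b" "sign E a = - sign E b"
    "adjacent E (Tail a) (Tail b)" "adjacent E (Head a) (Head b)" "E' = delete_arrows {a, b} E"
    using assms(1) by (auto simp: RII_def)
  have "on_strands J E (Tail a) = on_strands J E (Tail b)" "on_strands J E (Head a) = on_strands J E (Head b)"
    using ab(5,6) consecutive_on_strands[OF _ assms(2)] unfolding adjacent_def by blast+
  then have "sign (reverse_strands J E) a = - sign (reverse_strands J E) b"
    using ab(4) by (simp add: sign_reverse_strands)
  then have RII: "RII (reverse_strands J E) (delete_arrows {a, b} (reverse_strands J E))"
    using ab adjacent_reverse_strands unfolding RII_def by (intro bexI[of _ a] bexI[of _ b]) auto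
  have gd: "reverse_strands J E \<in> gauss_diagrams m" using assms(2) by (rule reverse_strands_gauss_diagrams)
  then have "generated_equiv m RII (reverse_strands J E) (delete_arrows {a, b} (reverse_strands J E))"
    using RII RII_gauss_diagrams by (intro generated_equivI) auto
  also have "generated_equiv m RII \<dots> (reverse_strands J E')"
    unfolding ab(7) using isotopic_delete_reverse_strands[OF assms(2)] gd assms(2)
    by (intro generated_equivI) (auto intro: delete_arrows_gauss_diagrams reverse_strands_gauss_diagrams)
  finally show ?thesis .
qed

lemma generated_equiv_RII_reverse_strands:
  assumes "generated_equiv m RII E E'"
  shows "generated_equiv m RII (reverse_strands J E) (reverse_strands J E')"
  using assms
  by (rule generated_equiv_map)
    (auto intro: RII_reverse_strands generated_equivI isotopic_reverse_strands reverse_strands_gauss_diagrams)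

lemma n_trivial_reverse_strands:
  assumes "n_trivial m n E" "E \<in> gauss_diagrams m"
  shows "n_trivial m n (reverse_strands J E)"
proof -
  obtain A where A: "\<forall>i\<le>n. A i \<noteq> {} \<and> A i \<subseteq> arrows E" "disjoint_family_on A {..n}"
    "\<And>S. \<lbrakk>S \<noteq> {}; S \<subseteq> {..n}\<rbrakk> \<Longrightarrow> generated_equiv m RII (delete_arrows (\<Union>(A ` S)) E) (trivial_diagram m)"
    using assms(1) unfolding n_trivial_def by blast
  define T :: "'a gauss_diagram" where "T = trivial_diagram m"
  have triv: "T \<in> gauss_diagrams m"
    by (auto simp: T_def trivial_diagram_def gauss_diagrams_def endpoints_def arrows_def)
  have "generated_equiv m RII (delete_arrows (\<Union>(A ` S)) (reverse_strands J E)) (trivial_diagram m)"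
    if S: "S \<noteq> {}" "S \<subseteq> {..n}" for S
  proof -
    let ?B = "\<Union>(A ` S)"
    have "generated_equiv m RII (delete_arrows ?B (reverse_strands J E)) (reverse_strands J (delete_arrows ?B E))"
      using isotopic_delete_reverse_strands[OF assms(2)] assms(2)
      by (intro generated_equivI) (auto intro: delete_arrows_gauss_diagrams reverse_strands_gauss_diagrams)
    also have "generated_equiv m RII \<dots> (reverse_strands J T)"
      using A(3)[OF S] unfolding T_def by (rule generated_equiv_RII_reverse_strands)
    also have "generated_equiv m RII \<dots> T"
    proof (rule generated_equivI)
      show "isotopic (reverse_strands J T) T \<or> RII (reverse_strands J T) T"
        by (rule disjI1, rule isotopic_same_strandsI)
          (auto simp: T_def trivial_diagram_def reverse_strands_def arrows_def endpoints_def map_replicate_trivial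
            intro!: nth_equalityI)
    qed (use triv reverse_strands_gauss_diagrams in auto)
    finally show ?thesis by (simp add: T_def)
  qed
  then show ?thesis using A(1,2) unfolding n_trivial_def by (intro exI[of _ A]) auto
qed

section \<open>Moves on an attached diagram\<close>

lemma embedding_slot_less:
  assumes "embedding m D e" "s \<in> set e" "Slot j r \<in> set s"
  shows "j < m"
proof -
  have "j \<in> set (concat (map slot_part (concat e)))" using assms(2,3) by (force intro!: bexI[of _ "Slot j r"])
  then show ?thesis using assms(1) unfolding embedding_def by blast
qed

lemma embedding_slot_exists:
  assumes "embedding m D e" "j < m"
  obtains s r where "s \<in> set e" "Slot j r \<in> set s"
proof -
  have "j \<in> set (concat (map slot_part (concat e)))" using assms unfolding embedding_def by blast
  then obtain s x where "s \<in> set e" "x \<in> set s" "j \<in> set (slot_part x)" by auto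
  then show thesis using that by (cases x) auto
qed

lemma part_map_item [simp]:
  "old_part (map_item f x) = map (map_endpoint f) (old_part x)" "slot_part (map_item f x) = slot_part x"
  by (cases x; simp)+

lemma concat_part_map_item:
  "concat (map old_part (map (map_item f) s)) = map (map_endpoint f) (concat (map old_part s))"
  "concat (map slot_part (map (map_item f) s)) = concat (map slot_part s)"
  by (simp_all add: map_concat comp_def)

lemma inj_on_map_sum:
  assumes "inj_on f A" "inj_on g B"
  shows "inj_on (map_sum f g) (Inl ` A \<union> Inr ` B)"
  by (rule inj_onI) (use assms in \<open>auto dest: inj_onD\<close>)

text \<open>The embedding carried along an isotopy of the target of an attachment.\<close>

lemma isotopic_attach_left:
  assumes "isotopic D D'" "embedding m D e" "D \<in> gauss_diagrams k" "E \<in> gauss_diagrams m"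
  obtains e' where "embedding m D' e'" "isotopic (attach D E e) (attach D' E e')"
proof -
  obtain f where f: "inj_on f (arrows D)" "strands D' = map (map (map_endpoint f)) (strands D)"
      "\<forall>a\<in>arrows D. sign D' (f a) = sign D a" using assms(1) by (auto simp: isotopic_def)
  define e' where "e' = map (map (map_item f)) e"
  have "map (\<lambda>s. concat (map old_part s)) e' = map (map (map_endpoint f)) (map (\<lambda>s. concat (map old_part s)) e)"
    by (simp add: e'_def map_concat comp_def)
  moreover have "concat (map slot_part (concat e')) = concat (map slot_part (concat e))"
    by (simp add: e'_def map_concat comp_def)
  ultimately have emb: "embedding m D' e'" using assms(2) f(2) unfolding embedding_def by metis
  have fill: "fill E (map_item f x) = map (map_endpoint (map_sum f id)) (fill E x)" for x
    by (cases x) (auto simp: endpoint.map_comp comp_def)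
  have rev: "on_reversed e' E x = on_reversed e E x" for x
  proof -
    have "Slot j True \<in> set (concat e') \<longleftrightarrow> Slot j True \<in> set (concat e)" for j
    proof -
      have "Slot j True = map_item f x \<longleftrightarrow> x = Slot j True" for x :: "'a item" by (cases x) auto
      then show ?thesis by (simp add: e'_def image_iff)
    qed
    then show ?thesis by (simp add: on_reversed_def)
  qed
  have arr: "arrows (attach D E e) = Inl ` arrows D \<union> Inr ` arrows E"
    using assms by (intro arrows_attach) (auto simp: gauss_diagrams_def)
  have "isotopic (attach D E e) (attach D' E e')" unfolding isotopic_def
  proof (intro exI[of _ "map_sum f id"] conjI ballI)
    show "inj_on (map_sum f id) (arrows (attach D E e))"
      unfolding arr using f(1) by (simp add: inj_on_map_sum)
    show "strands (attach D' E e') = map (map (map_endpoint (map_sum f id))) (strands (attach D E e))"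
      by (simp add: attach_def e'_def fill map_concat comp_def)
    show "sign (attach D' E e') (map_sum f id a) = sign (attach D E e) a" if "a \<in> arrows (attach D E e)" for a
      using that f(3) unfolding arr by (auto simp: attach_def rev)
  qed
  then show thesis using emb that by blast
qed

context
  fixes m k :: nat and D :: "'a gauss_diagram" and e :: "'a embedding"
  assumes emb: "embedding m D e" and unrev: "unreversed e" and D: "D \<in> gauss_diagrams k"
begin

lemma Slot_False: "s \<in> set e \<Longrightarrow> Slot j r \<in> set s \<Longrightarrow> r = False"
  using unrev by (cases r) (auto simp: unreversed_def)

lemma strands_attach_cong:
  assumes "\<And>x. old_part x = [] \<or> g (map_endpoint Inl (hd (old_part x))) = map_endpoint Inl (hd (old_part x))"
    and "\<And>j. j < m \<Longrightarrow> map g (map (map_endpoint Inr) (strands E ! j)) = map (map_endpoint Inr) (strands E' ! j)"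
  shows "strands (attach D E' e) = map (map g) (strands (attach D E e))"
proof -
  have "fill E' x = map g (fill E x)" if "s \<in> set e" "x \<in> set s" for s x
  proof (cases x)
    case (Old y)
    then show ?thesis using assms(1)[of x] by simp
  next
    case (Slot j r)
    then have "j < m" "r = False" using embedding_slot_less[OF emb that(1)] Slot_False[OF that(1)] that(2) by simp_all
    then show ?thesis using Slot assms(2)[of j] by simp
  qed
  then show ?thesis unfolding unreversed_attach[OF unrev] by (auto simp: map_concat comp_def intro!: arg_cong[of _ _ concat])
qed

lemma isotopic_attach_right:
  assumes "isotopic E E'" "E \<in> gauss_diagrams m"
  shows "isotopic (attach D E e) (attach D E' e)"
proof -
  obtain f where f: "inj_on f (arrows E)" "strands E' = map (map (map_endpoint f)) (strands E)"
      "\<forall>a\<in>arrows E. sign E' (f a) = sign E a" using assms(1) by (auto simp: isotopic_def)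
  have arr: "arrows (attach D E e) = Inl ` arrows D \<union> Inr ` arrows E"
    using assms emb D by (intro arrows_attach) (auto simp: gauss_diagrams_def)
  have comp: "map_sum id f \<circ> Inl = Inl" "map_sum id f \<circ> Inr = Inr \<circ> f" by (auto simp: fun_eq_iff)
  show ?thesis unfolding isotopic_def
  proof (intro exI[of _ "map_sum id f"] conjI ballI)
    show "inj_on (map_sum id f) (arrows (attach D E e))"
      unfolding arr using f(1) by (simp add: inj_on_map_sum)
    show "strands (attach D E' e) = map (map (map_endpoint (map_sum id f))) (strands (attach D E e))"
      using assms(2) by (intro strands_attach_cong) (auto simp: endpoint.map_comp comp f(2) gauss_diagrams_def)
    show "sign (attach D E' e) (map_sum id f a) = sign (attach D E e) a" if "a \<in> arrows (attach D E e)" for a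
      using that f(3) unrev unfolding arr by auto
  qed
qed

lemma consecutive_attach:
  assumes "consecutive E x y" "length (strands E) = m"
  shows "consecutive (attach D E e) (map_endpoint Inr x) (map_endpoint Inr y)"
proof -
  obtain j u v where j: "j < length (strands E)" "strands E ! j = u @ [x, y] @ v"
    using assms(1) by (rule consecutiveE)
  obtain s r where s: "s \<in> set e" "Slot j r \<in> set s" using embedding_slot_exists[OF emb] j(1) assms(2) by metis
  then have r: "\<not> r" using Slot_False by blast
  obtain s1 s2 where "s = s1 @ Slot j r # s2" using s(2) by (meson split_list)
  then have eq: "concat (map (fill E) s) = (concat (map (fill E) s1) @ map (map_endpoint Inr) u) @
      [map_endpoint Inr x, map_endpoint Inr y] @ (map (map_endpoint Inr) v @ concat (map (fill E) s2))"
    using r j(2) by simp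
  have "concat (map (fill E) s) \<in> set (strands (attach D E e))"
    using s(1) by (simp add: unreversed_attach[OF unrev])
  then show ?thesis unfolding consecutive_def eq by blast
qed

lemma adjacent_attach:
  "adjacent E x y \<Longrightarrow> length (strands E) = m \<Longrightarrow> adjacent (attach D E e) (map_endpoint Inr x) (map_endpoint Inr y)"
  unfolding adjacent_def using consecutive_attach by blast

lemma attach_delete_arrows:
  assumes "length (strands E) = m"
  shows "attach D (delete_arrows A E) e = delete_arrows (Inr ` A) (attach D E e)"
proof -
  have "fill (delete_arrows A E) x = filter (\<lambda>x. arrow_of x \<notin> Inr ` A) (fill E x)" if "s \<in> set e" "x \<in> set s" for s x
  proof (cases x)
    case (Slot j r)
    then have "j < m" "r = False" using embedding_slot_less[OF emb that(1)] Slot_False[OF that(1)] that(2) by simp_all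
    then show ?thesis using Slot assms
      by (simp add: strands_delete_arrows filter_map comp_def inj_image_mem_iff)
  qed auto
  then show ?thesis unfolding unreversed_attach[OF unrev] delete_arrows_def[of "Inr ` A"]
    by (auto simp: filter_concat comp_def intro!: arg_cong[of _ _ concat])
qed

lemma RII_attach:
  assumes "RII E E'" "E \<in> gauss_diagrams m"
  shows "RII (attach D E e) (attach D E' e)"
proof -
  have len: "length (strands E) = m" using assms(2) by (simp add: gauss_diagrams_def)
  have arr: "arrows (attach D E e) = Inl ` arrows D \<union> Inr ` arrows E"
    using assms(2) emb D by (intro arrows_attach) (auto simp: gauss_diagrams_def)
  obtain a b where ab: "a \<in> arrows E" "b \<in> arrows E" "a \<noteq> b" "sign E a = - sign E b"
    "adjacent E (Tail a) (Tail b)" "adjacent E (Head a) (Head b)" "E' = delete_arrows {a, b} E"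
    using assms(1) by (auto simp: RII_def)
  have "attach D E' e = delete_arrows {Inr a, Inr b} (attach D E e)"
    unfolding ab(7) using attach_delete_arrows[OF len] by simp
  then show ?thesis
    using ab unrev adjacent_attach[OF ab(5) len] adjacent_attach[OF ab(6) len] unfolding RII_def arr
    by (intro bexI[of _ "Inr a"] bexI[of _ "Inr b"]) auto
qed

lemma RIII_attach:
  assumes "RIII E E'" "E \<in> gauss_diagrams m"
  shows "RIII (attach D E e) (attach D E' e)"
proof -
  have len: "length (strands E) = m" using assms(2) by (simp add: gauss_diagrams_def)
  have arr: "arrows (attach D E e) = Inl ` arrows D \<union> Inr ` arrows E"
    using assms(2) emb D by (intro arrows_attach) (auto simp: gauss_diagrams_def)
  obtain a b c where abc: "a \<in> arrows E" "b \<in> arrows E" "c \<in> arrows E" "a \<noteq> b" "a \<noteq> c" "b \<noteq> c"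
    "sign E a = sign E b" "sign E b = sign E c"
    "consecutive E (Tail a) (Tail b)" "consecutive E (Head a) (Tail c)" "consecutive E (Head b) (Head c)"
    "E' = Gauss_Diagram (map (map (swap3 a b c)) (strands E)) (sign E)"
    using assms(1) unfolding RIII_def swap3_def by blast
  have inl: "swap3 (Inr a) (Inr b) (Inr c) (map_endpoint Inl y) = map_endpoint Inl y" for y
  proof -
    have "map_endpoint Inl y \<notin> range Tail \<inter> Tail ` range Inr" "map_endpoint Inl y \<notin> range Head \<inter> Head ` range Inr"
      by (cases y; auto)+
    then show ?thesis by (cases y) (auto simp: swap3_def transpose_def)
  qed
  have "strands (attach D E' e) = map (map (swap3 (Inr a) (Inr b) (Inr c))) (strands (attach D E e))"
    by (rule strands_attach_cong) (use inl len in \<open>auto simp: abc(12) swap3_map_endpoint[OF inj_Inr]\<close>)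
  then have "attach D E' e = Gauss_Diagram (map (map (swap3 (Inr a) (Inr b) (Inr c))) (strands (attach D E e)))
      (sign (attach D E e))"
    by (simp add: unreversed_attach[OF unrev] abc(12))
  then show ?thesis using abc(1-8) unrev abc(9-11)[THEN consecutive_attach, OF len, simplified endpoint.map]
    unfolding RIII_def swap3_def[symmetric] arr
    by (intro bexI[of _ "Inr a"] bexI[of _ "Inr b"] bexI[of _ "Inr c"]) auto
qed

text \<open>Attaching to an attached diagram is attaching to the whole: the slots of the outer embedding
  are replaced by the strands of the inner one.\<close>

lemma attach_attach:
  assumes "embedding n E e1" "E \<in> gauss_diagrams m" "W \<in> gauss_diagrams n"
  obtains e2 where "embedding n (attach D E e) e2"
    "isotopic (attach (attach D E e) W e2) (attach D (attach E W e1) e)"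
proof -
  define sub where "sub x = (case x of Old y \<Rightarrow> [Old (map_endpoint Inl y)] | Slot j r \<Rightarrow> map (map_item Inr) (e1 ! j))"
    for x :: "'a item"
  define e2 where "e2 = map (\<lambda>s. concat (map sub s)) e"
  have len: "length (strands E) = m" and len1: "length e1 = m"
    using assms embedding_length[OF assms(1)] by (auto simp: gauss_diagrams_def)
  have old_sub: "concat (map old_part (sub x)) = fill E x" if "s \<in> set e" "x \<in> set s" for s x
  proof (cases x)
    case (Slot j r)
    have "j < m" "r = False" using Slot embedding_slot_less[OF emb that(1)] Slot_False[OF that(1)] that(2) by simp_all
    moreover have "concat (map old_part (e1 ! j)) = strands E ! j"
      using assms(1) \<open>j < m\<close> len1 unfolding embedding_def by (metis nth_map)
    ultimately show ?thesis using Slot by (simp add: sub_def concat_part_map_item del: map_map)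
  qed (simp add: sub_def)
  have old: "map (\<lambda>s. concat (map old_part s)) e2 = strands (attach D E e)"
    unfolding unreversed_attach[OF unrev]
    by (simp add: e2_def comp_def concat_map_concat[symmetric] old_sub cong: map_cong)
  have slot_sub: "concat (map slot_part (concat (map sub s))) =
      concat (map (\<lambda>j. concat (map slot_part (e1 ! j))) (concat (map slot_part s)))" for s
  proof (induction s)
    case (Cons x s)
    then show ?case by (cases x) (simp_all add: sub_def concat_part_map_item del: map_map)
  qed simp
  have "concat (map slot_part (concat e2)) =
      concat (map (\<lambda>j. concat (map slot_part (e1 ! j))) (concat (map slot_part (concat e))))"
    unfolding slot_sub[symmetric] by (simp add: e2_def concat_map_concat)
  moreover have "mset (concat (map slot_part (concat e))) = mset [0..<m]"
    using emb by (subst set_eq_iff_mset_eq_distinct[symmetric]) (auto simp: embedding_def atLeast0LessThan)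
  then have "mset (map (\<lambda>j. concat (map slot_part (e1 ! j))) (concat (map slot_part (concat e)))) =
      mset (map (\<lambda>j. concat (map slot_part (e1 ! j))) [0..<m])" by (simp only: mset_map)
  then have "mset (concat (map (\<lambda>j. concat (map slot_part (e1 ! j))) (concat (map slot_part (concat e))))) =
      mset (concat (map (\<lambda>j. concat (map slot_part (e1 ! j))) [0..<m]))"
    by (simp only: mset_concat mset_map flip: sum_mset_sum_list)
  moreover have "map (\<lambda>j. concat (map slot_part (e1 ! j))) [0..<m] = map (\<lambda>s. concat (map slot_part s)) e1"
    using len1 by (intro nth_equalityI) auto
  ultimately have slots: "mset (concat (map slot_part (concat e2))) = mset (concat (map slot_part (concat e1)))"
    by (simp only: concat_map_concat)
  have emb2: "embedding n (attach D E e) e2"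
    using assms(1) old mset_eq_imp_distinct_iff[OF slots] mset_eq_setD[OF slots]
    unfolding embedding_def by metis
  have slot_iff: "Slot j True \<in> set (concat e2) \<longleftrightarrow> Slot j True \<in> set (concat e1)" for j
  proof
    assume "Slot j True \<in> set (concat e2)"
    then obtain s x where x: "s \<in> set e" "x \<in> set s" "Slot j True \<in> set (sub x)" by (auto simp: e2_def)
    then obtain i r where i: "x = Slot i r" by (cases x) (auto simp: sub_def)
    then have "(Slot j True :: ('a + 'b) item) \<in> map_item Inr ` set (e1 ! i)" using x(3) by (simp add: sub_def)
    then obtain y :: "'b item" where y: "y \<in> set (e1 ! i)" "(Slot j True :: ('a + 'b) item) = map_item Inr y" by blast
    have "y = Slot j True" using y(2) by (cases y) auto
    moreover have "i < m" using x i embedding_slot_less[OF emb] by blast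
    ultimately show "Slot j True \<in> set (concat e1)" using y len1 by auto
  next
    assume "Slot j True \<in> set (concat e1)"
    then have "Slot j True \<in> (\<Union>i<m. set (e1 ! i))" using len1 by (simp only: set_concat_nth)
    then obtain i where i: "i < m" "Slot j True \<in> set (e1 ! i)" by blast
    then obtain s r where s: "s \<in> set e" "Slot i r \<in> set s" using embedding_slot_exists[OF emb] by metis
    have "Slot j True \<in> set (sub (Slot i r))"
      using imageI[OF i(2), of "map_item Inr"] by (simp add: sub_def)
    then show "Slot j True \<in> set (concat e2)" using s by (auto simp: e2_def intro!: bexI[of _ s])
  qed
  define g :: "('a + 'b) + 'c \<Rightarrow> 'a + ('b + 'c)" where
    "g = case_sum (case_sum Inl (Inr \<circ> Inl)) (Inr \<circ> Inr)"
  have g: "g (Inl (Inl a)) = Inl a" "g (Inl (Inr b)) = Inr (Inl b)" "g (Inr c) = Inr (Inr c)" for a b c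
    by (simp_all add: g_def)
  have "inj g"
  proof (rule injI)
    fix x y assume "g x = g y"
    then show "x = y" by (cases x; cases y) (auto simp: g_def split: sum.splits)
  qed
  have comp: "g \<circ> Inl \<circ> Inl = Inl" "g \<circ> Inl \<circ> Inr = Inr \<circ> Inl" "g \<circ> Inr = Inr \<circ> Inr"
    by (auto simp: g_def)
  have fill1: "map (map_endpoint g) (fill W (map_item Inr y)) = map (map_endpoint Inr) (fill W y)" for y
    using comp by (cases y) (auto simp: endpoint.map_comp comp_assoc[symmetric])
  have fill_sub: "map (map_endpoint g) (concat (map (fill W) (sub x))) = fill (attach E W e1) x"
    if "s \<in> set e" "x \<in> set s" for s x
  proof (cases x)
    case (Old y)
    then show ?thesis using comp(1) by (simp add: sub_def endpoint.map_comp comp_assoc[symmetric])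
  next
    case (Slot j r)
    then have j: "j < m" "r = False" using embedding_slot_less[OF emb that(1)] Slot_False[OF that(1)] that(2) by simp_all
    then have "strands (attach E W e1) ! j = concat (map (fill W) (e1 ! j))" using len1 by (simp add: attach_def)
    then show ?thesis using Slot j by (simp add: sub_def map_concat comp_def fill1)
  qed
  have "strands (attach D (attach E W e1) e) = map (map (map_endpoint g)) (strands (attach (attach D E e) W e2))"
  proof -
    have "map (map_endpoint g) (concat (map (fill W) (concat (map sub s)))) = concat (map (fill (attach E W e1)) s)"
      if "s \<in> set e" for s
    proof -
      have "map (map_endpoint g) (concat (map (fill W) (concat (map sub s)))) =
          concat (map (\<lambda>x. map (map_endpoint g) (concat (map (fill W) (sub x)))) s)"
        by (simp add: comp_def concat_map_concat[symmetric]) (simp add: map_concat comp_def)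
      then show ?thesis using fill_sub[OF that] by (simp cong: map_cong)
    qed
    then show ?thesis
      by (simp add: unreversed_attach[OF unrev]) (simp add: attach_def e2_def comp_def)
  qed
  moreover have "sign (attach D (attach E W e1) e) (g x) = sign (attach (attach D E e) W e2) x" for x
  proof (cases x)
    case (Inl y)
    then show ?thesis using unrev by (cases y) (simp_all add: g)
  next
    case (Inr c)
    have "on_reversed e2 W = on_reversed e1 W" using slot_iff by (simp add: on_reversed_def fun_eq_iff)
    then have "sign (attach (attach D E e) W e2) (Inr c) = sign (attach E W e1) (Inr c)"
      by (simp add: attach_def[of _ W])
    then show ?thesis using unrev Inr by (simp add: g)
  qed
  ultimately have "isotopic (attach (attach D E e) W e2) (attach D (attach E W e1) e)"
    using inj_on_subset[OF \<open>inj g\<close>] unfolding isotopic_def by (intro exI[of _ g]) auto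
  then show thesis using emb2 that by blast
qed

end

text \<open>Attachments with natural numbers as labels, so that they can be iterated.\<close>

definition attach_nat :: "nat gauss_diagram \<Rightarrow> nat gauss_diagram \<Rightarrow> nat embedding \<Rightarrow> nat gauss_diagram" where
  "attach_nat D E e = relabel to_nat (attach D E e)"

lemma isotopic_attach_nat: "isotopic (attach D E e) (attach_nat D E e)"
  unfolding attach_nat_def by (rule isotopic_relabel) simp

lemma attach_nat_gauss_diagrams:
  "\<lbrakk>embedding m D e; D \<in> gauss_diagrams k; E \<in> gauss_diagrams m\<rbrakk> \<Longrightarrow> attach_nat D E e \<in> gauss_diagrams k"
  using isotopic_gauss_diagrams[OF isotopic_attach_nat attach_gauss_diagrams] .

lemma isotopic_relabel_relabel:
  assumes "isotopic D E" "inj f" "inj g"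
  shows "isotopic (relabel f D) (relabel g E)"
  using isotopic_trans[OF isotopic_sym[OF isotopic_relabel[OF assms(2)]]
      isotopic_trans[OF assms(1) isotopic_relabel[OF assms(3)]]] .

lemma word_diagram_strands: "length (strands (word_diagram m w)) = m"
  by (simp add: word_diagram_def)

text \<open>
  A move inside an attached diagram is a move of the whole diagram.
\<close>

lemma L_move_attach:
  assumes e: "embedding m D e" "unreversed e" "D \<in> gauss_diagrams k" "E \<in> gauss_diagrams m"
    and "L_move n E E'"
    and words: "\<And>j w. w \<in> pv_words j \<Longrightarrow> (word_diagram j w) \<in> gauss_diagrams j"
  shows "L_move n (attach_nat D E e) (attach_nat D E' e)"
proof -
  obtain j h w e1 where h: "j \<ge> 1" "h \<in> lower_central (PV j) n" "h \<notin> lower_central (PV j) (Suc n)" "w \<in> h"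
    "embedding j E e1" "isotopic (attach E (word_diagram j w) e1) E'"
    using assms(5) unfolding L_move_def by blast
  interpret group "PV j" by (rule group_PV)
  have w: "word_diagram j w \<in> gauss_diagrams j"
    using words pv_class_of_member[OF lower_central_carrier[OF h(2)] h(4)] by blast
  obtain e2 where e2: "embedding j (attach D E e) e2"
    "isotopic (attach (attach D E e) (word_diagram j w) e2) (attach D (attach E (word_diagram j w) e1) e)"
    using attach_attach[OF e(1-3) h(5) e(4) w] .
  obtain e3 where e3: "embedding j (attach_nat D E e) e3"
    "isotopic (attach (attach D E e) (word_diagram j w) e2) (attach (attach_nat D E e) (word_diagram j w) e3)"
    using isotopic_attach_left[OF isotopic_attach_nat e2(1) attach_gauss_diagrams[OF e(1,3,4)] w] .
  have "isotopic (attach (attach_nat D E e) (word_diagram j w) e3) (attach D (attach E (word_diagram j w) e1) e)"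
    using e2(2) e3(2) isotopic_sym isotopic_trans by blast
  also have "isotopic \<dots> (attach D E' e)"
    using isotopic_attach_right[OF e(1-3) h(6) attach_gauss_diagrams[OF h(5) e(4) w]] .
  also have "isotopic \<dots> (attach_nat D E' e)" by (rule isotopic_attach_nat)
  finally show ?thesis using h(1-4) e3(1) unfolding L_move_def by blast
qed

lemma generated_equiv_attach:
  assumes e: "embedding m D e" "unreversed e" "D \<in> gauss_diagrams k"
    and E: "generated_equiv m R E E'"
    and R: "\<And>E E'. \<lbrakk>E \<in> gauss_diagrams m; E' \<in> gauss_diagrams m; R E E'\<rbrakk> \<Longrightarrow> R' (attach_nat D E e) (attach_nat D E' e)"
  shows "generated_equiv k R' (attach_nat D E e) (attach_nat D E' e)"
  using E
proof (rule generated_equiv_map)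
  fix E E' :: "nat gauss_diagram" assume "E \<in> gauss_diagrams m" "E' \<in> gauss_diagrams m" and iso: "isotopic E E'"
  then show "generated_equiv k R' (attach_nat D E e) (attach_nat D E' e)"
    using isotopic_attach_right[OF e iso] attach_nat_gauss_diagrams[OF e(1,3)]
    by (intro generated_equivI) (auto simp: attach_nat_def isotopic_relabel_relabel)
next
  fix E E' :: "nat gauss_diagram" assume "E \<in> gauss_diagrams m" "E' \<in> gauss_diagrams m" "R E E'"
  then show "generated_equiv k R' (attach_nat D E e) (attach_nat D E' e)"
    using R attach_nat_gauss_diagrams[OF e(1,3)] by (intro generated_equivI) auto
qed

lemma RII_attach_nat:
  "\<lbrakk>embedding m D e; unreversed e; D \<in> gauss_diagrams k; E \<in> gauss_diagrams m; RII E E'\<rbrakk> \<Longrightarrow>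
    RII (attach_nat D E e) (attach_nat D E' e)"
  unfolding attach_nat_def by (rule RII_relabel[OF inj_to_nat RII_attach])

lemma RIII_attach_nat:
  "\<lbrakk>embedding m D e; unreversed e; D \<in> gauss_diagrams k; E \<in> gauss_diagrams m; RIII E E'\<rbrakk> \<Longrightarrow>
    RIII (attach_nat D E e) (attach_nat D E' e)"
  unfolding attach_nat_def by (rule RIII_relabel[OF inj_to_nat RIII_attach])

section \<open>Diagrams realising words\<close>

type_synonym 'a lword = "('a \<times> nat \<times> nat \<times> bool) list"

fun letter_ends :: "nat \<Rightarrow> 'a \<times> nat \<times> nat \<times> bool \<Rightarrow> 'a endpoint list" where
  "letter_ends s (q, i, j, p) = (if s = i then [Tail q] else if s = j then [Head q] else [])"

definition slot_ends :: "nat \<Rightarrow> 'a lword \<Rightarrow> 'a endpoint list" where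
  "slot_ends s w = concat (map (letter_ends s) w)"

text \<open>
  The list \<open>x\<close> gives the slots on each strand; a letter \<open>(i, j, p)\<close> is an arrow from slot \<open>i\<close> to slot
  \<open>j\<close>. The letters carry the labels of their arrows, so that permuting or deleting letters does not
  rename the other arrows.
\<close>

definition lreal :: "nat list list \<Rightarrow> 'a lword \<Rightarrow> 'a gauss_diagram" where
  "lreal x w = Gauss_Diagram (map (\<lambda>s. concat (map (\<lambda>j. slot_ends j w) s)) x)
     (\<lambda>q. case map_of w q of Some (i, j, p) \<Rightarrow> if p then 1 else -1 | None \<Rightarrow> 1)"

definition realise :: "nat list list \<Rightarrow> pv_word \<Rightarrow> nat gauss_diagram" where
  "realise x w = lreal x (zip [0..<length w] w)"

definition support :: "pv_word \<Rightarrow> nat set" where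
  "support w = (\<Union>(i, j, p)\<in>set w. {i, j})"

definition placed :: "nat list list \<Rightarrow> pv_word \<Rightarrow> bool" where
  "placed x w \<longleftrightarrow> distinct (concat x) \<and> support w \<subseteq> set (concat x) \<and> (\<forall>(i, j, p)\<in>set w. i \<noteq> j)"

lemma slot_ends_simps [simp]:
  "slot_ends s [] = []" "slot_ends s (u @ v) = slot_ends s u @ slot_ends s v"
  "slot_ends s (l # w) = letter_ends s l @ slot_ends s w"
  by (simp_all add: slot_ends_def)

lemma support_simps [simp]:
  "support [] = {}" "support (u @ v) = support u \<union> support v"
  "support ((i, j, p) # w) = {i, j} \<union> support w"
  by (auto simp: support_def)

lemma placed_append [simp]: "placed x (u @ v) \<longleftrightarrow> placed x u \<and> placed x v"
  unfolding placed_def support_simps set_append ball_Un Un_subset_iff by blast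

lemma placed_Cons [simp]:
  "placed x ((i, j, p) # w) \<longleftrightarrow> i \<in> set (concat x) \<and> j \<in> set (concat x) \<and> i \<noteq> j \<and> placed x w"
  by (auto simp: placed_def)

lemma slot_ends_outside: "s \<notin> support (map snd w) \<Longrightarrow> slot_ends s w = []"
proof (induction w)
  case (Cons l w)
  then show ?case by (cases l) auto
qed simp

lemma Tail_in_slot_ends: "Tail q \<in> set (slot_ends s w) \<longleftrightarrow> (\<exists>j p. (q, s, j, p) \<in> set w)"
  by (induction w) (auto split: if_splits)

lemma Head_in_slot_ends: "Head q \<in> set (slot_ends s w) \<longleftrightarrow> (\<exists>i p. (q, i, s, p) \<in> set w \<and> i \<noteq> s)"
proof (induction w)
  case (Cons l w)
  obtain r a b p where l: "l = (r, a, b, p)" by (cases l)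
  have "Head q \<in> set (letter_ends s l) \<longleftrightarrow> r = q \<and> s = b \<and> s \<noteq> a" by (auto simp: l)
  then show ?case using Cons by (auto simp: l simp del: letter_ends.simps)
qed simp

lemma arrow_of_slot_ends: "arrow_of ` set (slot_ends s w) \<subseteq> fst ` set w"
proof (induction w)
  case (Cons l w)
  then show ?case by (cases l) auto
qed simp

lemma distinct_slot_ends: "distinct (map fst w) \<Longrightarrow> distinct (slot_ends s w)"
proof (induction w)
  case (Cons l w)
  obtain q i j p where l: "l = (q, i, j, p)" by (cases l)
  have "Tail q \<notin> set (slot_ends s w)" "Head q \<notin> set (slot_ends s w)"
    using Cons.prems l by (force simp: Tail_in_slot_ends, force simp: Head_in_slot_ends)
  then show ?case using Cons l by auto
qed simp

lemma slot_ends_disjoint: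
  assumes "distinct (map fst w)" "s \<noteq> t"
  shows "set (slot_ends s w) \<inter> set (slot_ends t w) = {}"
proof -
  have "False" if "z \<in> set (slot_ends s w)" "z \<in> set (slot_ends t w)" for z
  proof (cases z)
    case (Tail q)
    then show ?thesis using that assms by (auto simp: Tail_in_slot_ends dest: eq_key_imp_eq_value)
  next
    case (Head q)
    then show ?thesis using that assms by (auto simp: Head_in_slot_ends dest: eq_key_imp_eq_value)
  qed
  then show ?thesis by blast
qed

lemma distinct_concat_map:
  assumes "distinct xs" "\<And>x. x \<in> set xs \<Longrightarrow> distinct (f x)"
    and "\<And>x y. \<lbrakk>x \<in> set xs; y \<in> set xs; x \<noteq> y\<rbrakk> \<Longrightarrow> set (f x) \<inter> set (f y) = {}"
  shows "distinct (concat (map f xs))"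
  using assms
proof (induction xs)
  case (Cons a xs)
  have "distinct (concat (map f xs))" by (intro Cons.IH) (use Cons.prems in auto)
  moreover have "set (f a) \<inter> set (f y) = {}" if "y \<in> set xs" for y
    using that Cons.prems by (intro Cons.prems(3)) auto
  ultimately show ?case using Cons.prems(2) by auto
qed simp

lemma concat_strands_lreal: "concat (strands (lreal x w)) = concat (map (\<lambda>j. slot_ends j w) (concat x))"
  by (simp add: lreal_def concat_map_concat)

lemma endpoints_lreal: "endpoints (lreal x w) = (\<Union>j\<in>set (concat x). set (slot_ends j w))"
  unfolding endpoints_def concat_strands_lreal by auto

lemma lreal_endpoint_iff:
  assumes "placed x (map snd w)"
  shows "Tail q \<in> endpoints (lreal x w) \<longleftrightarrow> q \<in> fst ` set w"
    "Head q \<in> endpoints (lreal x w) \<longleftrightarrow> q \<in> fst ` set w"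
proof -
  have pl: "i \<in> set (concat x)" "j \<in> set (concat x)" "i \<noteq> j" if "(q, i, j, p) \<in> set w" for q i j p
    using assms imageI[OF that, of snd] by (fastforce simp: placed_def support_def simp del: set_concat)+
  show "Tail q \<in> endpoints (lreal x w) \<longleftrightarrow> q \<in> fst ` set w"
  proof
    assume "q \<in> fst ` set w"
    then obtain i j p where "(q, i, j, p) \<in> set w" by auto
    then show "Tail q \<in> endpoints (lreal x w)" using pl(1) unfolding endpoints_lreal UN_iff Tail_in_slot_ends by blast
  qed (force simp: endpoints_lreal Tail_in_slot_ends)
  show "Head q \<in> endpoints (lreal x w) \<longleftrightarrow> q \<in> fst ` set w"
  proof
    assume "q \<in> fst ` set w"
    then obtain i j p where "(q, i, j, p) \<in> set w" by auto
    then show "Head q \<in> endpoints (lreal x w)" using pl(2,3) unfolding endpoints_lreal UN_iff Head_in_slot_ends by blast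
  qed (force simp: endpoints_lreal Head_in_slot_ends)
qed

lemma arrows_lreal_subset: "arrows (lreal x w) \<subseteq> fst ` set w"
  unfolding arrows_def endpoints_lreal image_UN using arrow_of_slot_ends by (rule UN_least)

lemma lreal_gauss_diagrams:
  assumes "placed x (map snd w)" "distinct (map fst w)"
  shows "lreal x w \<in> gauss_diagrams (length x)"
proof -
  have "distinct (concat (strands (lreal x w)))"
    unfolding concat_strands_lreal
    using assms(1) by (intro distinct_concat_map distinct_slot_ends slot_ends_disjoint assms(2)) (simp add: placed_def)
  moreover have "length (strands (lreal x w)) = length x" by (simp add: lreal_def)
  moreover have "sign (lreal x w) a \<in> {1, -1}" for a
    by (auto simp: lreal_def split: option.splits)
  ultimately show ?thesis using lreal_endpoint_iff[OF assms(1)] by (auto simp: gauss_diagrams_def)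
qed

lemma sign_lreal: "\<lbrakk>distinct (map fst w); (q, i, j, p) \<in> set w\<rbrakk> \<Longrightarrow> sign (lreal x w) q = (if p then 1 else -1)"
  by (simp add: lreal_def)

lemma isotopic_lreal_same_strands:
  assumes "strands (lreal x w) = strands (lreal x' w')"
    and "distinct (map fst w)" "distinct (map fst w')"
    and "\<And>q i j p. (q, i, j, p) \<in> set w \<Longrightarrow> \<exists>i' j'. (q, i', j', p) \<in> set w'"
  shows "isotopic (lreal x w) (lreal x' w')"
  using assms(1)
proof (rule isotopic_same_strandsI)
  fix a assume "a \<in> arrows (lreal x w)"
  then obtain i j p where w: "(a, i, j, p) \<in> set w" using arrows_lreal_subset by fastforce
  then obtain i' j' where "(a, i', j', p) \<in> set w'" using assms(4) by blast
  then show "sign (lreal x w) a = sign (lreal x' w') a"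
    using sign_lreal assms(2,3) w by metis
qed

lemma obtain_relabelling:
  assumes "length xs = length ys" "distinct xs" "distinct ys"
  obtains f where "inj_on f (set xs)" "map f xs = ys"
proof -
  have "\<exists>f. inj_on f (set xs) \<and> map f xs = ys"
    using assms
  proof (induction xs ys rule: list_induct2)
    case (Cons x xs y ys)
    then obtain f where f: "inj_on f (set xs)" "map f xs = ys" by auto
    have 1: "map (f(x := y)) (x # xs) = y # ys" using f(2) Cons.prems by (auto intro: map_cong)
    have "y \<notin> f ` set xs" using f(2) Cons.prems by auto
    then have 2: "inj_on (f(x := y)) (set (x # xs))"
      using f(1) Cons.prems by (auto simp: inj_on_def)
    show ?case using 1 2 by (rule exI[of _ "f(x := y)", OF conjI[rotated]])
  qed simp
  then show thesis using that by blast
qed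

lemma isotopic_lreal_relabel:
  assumes "map snd w = map snd w'" "distinct (map fst w)" "distinct (map fst w')"
  shows "isotopic (lreal x w) (lreal x w')"
proof -
  have len: "length w = length w'" using assms(1) by (metis length_map)
  obtain f where f: "inj_on f (set (map fst w))" "map f (map fst w) = map fst w'"
    using obtain_relabelling[of "map fst w" "map fst w'"] assms len by auto
  have w': "w' = map (\<lambda>(q, l). (f q, l)) w"
  proof (rule nth_equalityI)
    fix n assume "n < length w'"
    then show "w' ! n = map (\<lambda>(q, l). (f q, l)) w ! n"
      using len arg_cong[OF f(2), of "\<lambda>l. l ! n"] arg_cong[OF assms(1), of "\<lambda>l. l ! n"]
      by (auto simp: prod_eq_iff split_beta)
  qed (simp add: len)
  have ends: "slot_ends s w' = map (map_endpoint f) (slot_ends s w)" for s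
    unfolding w' by (induction w) auto
  show ?thesis unfolding isotopic_def
  proof (intro exI[of _ f] conjI ballI)
    show "inj_on f (arrows (lreal x w))" using f(1) arrows_lreal_subset[of x w] by (auto intro: inj_on_subset)
    show "strands (lreal x w') = map (map (map_endpoint f)) (strands (lreal x w))"
      by (simp add: lreal_def ends map_concat comp_def)
    fix a assume "a \<in> arrows (lreal x w)"
    then obtain i j p where a: "(a, i, j, p) \<in> set w" using arrows_lreal_subset by fastforce
    then have "(f a, i, j, p) \<in> set w'" unfolding w' by force
    then show "sign (lreal x w') (f a) = sign (lreal x w) a"
      using sign_lreal a assms(2,3) by metis
  qed
qed

lemma map_snd_zip_upt [simp]: "map snd (zip [0..<length w] w) = w" "map fst (zip [0..<length w] w) = [0..<length w]"
  by simp_all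

lemma realise_gauss_diagrams: "placed x w \<Longrightarrow> realise x w \<in> gauss_diagrams (length x)"
  unfolding realise_def by (rule lreal_gauss_diagrams) simp_all

lemma isotopic_realise_lreal:
  "distinct (map fst w) \<Longrightarrow> isotopic (lreal x w) (realise x (map snd w))"
  unfolding realise_def by (rule isotopic_lreal_relabel) (simp_all add: map_snd_zip_upt[of "map snd w", simplified])

lemma isotopic_realiseI:
  fixes w w' :: "nat lword"
  assumes "strands (lreal x w) = strands (lreal x' w')"
    and "distinct (map fst w)" "distinct (map fst w')"
    and "\<And>q i j p. (q, i, j, p) \<in> set w \<Longrightarrow> \<exists>i' j'. (q, i', j', p) \<in> set w'"
    and "u = map snd w" "u' = map snd w'"
  shows "isotopic (realise x u) (realise x' u')"
proof -
  have "isotopic (realise x u) (lreal x w)"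
    unfolding assms(5) by (rule isotopic_sym[OF isotopic_realise_lreal[OF assms(2)]])
  also have "isotopic \<dots> (lreal x' w')" by (rule isotopic_lreal_same_strands[OF assms(1-4)])
  also have "isotopic \<dots> (realise x' u')"
    unfolding assms(6) by (rule isotopic_realise_lreal[OF assms(3)])
  finally show ?thesis .
qed

lemma strands_lreal_cong:
  assumes "\<And>j. j \<in> set (concat x) \<Longrightarrow> slot_ends j w = slot_ends j w'"
  shows "strands (lreal x w) = strands (lreal x w')"
proof -
  have "slot_ends j w = slot_ends j w'" if "s \<in> set x" "j \<in> set s" for s j
    using that by (intro assms) auto
  then show ?thesis by (simp add: lreal_def cong: map_cong)
qed

lemma word_diagram_realise:
  "strands (word_diagram m w) = strands (realise (map (\<lambda>s. [s]) [0..<m]) w)"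
  "a \<in> arrows (word_diagram m w) \<Longrightarrow> sign (word_diagram m w) a = sign (realise (map (\<lambda>s. [s]) [0..<m]) w) a"
proof -
  have "map (letter_on s w) [0..<length w] = map (letter_ends s) (zip [0..<length w] w)" for s
    by (rule nth_equalityI) (auto simp: letter_on_def split: prod.splits)
  then show "strands (word_diagram m w) = strands (realise (map (\<lambda>s. [s]) [0..<m]) w)"
    by (simp add: word_diagram_def realise_def lreal_def slot_ends_def)
  assume "a \<in> arrows (word_diagram m w)"
  then have a: "a < length w"
    by (auto simp: arrows_def endpoints_def word_diagram_def letter_on_def split: prod.splits if_splits)
  obtain i j p where l: "w ! a = (i, j, p)" by (cases "w ! a")
  then have "(a, i, j, p) \<in> set (zip [0..<length w] w)" using a by (force simp: set_zip)
  then have "sign (realise (map (\<lambda>s. [s]) [0..<m]) w) a = (if p then 1 else -1)"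
    unfolding realise_def by (intro sign_lreal) simp
  then show "sign (word_diagram m w) a = sign (realise (map (\<lambda>s. [s]) [0..<m]) w) a"
    using l by (simp add: word_diagram_def)
qed

lemma isotopic_word_diagram: "isotopic (word_diagram m w) (realise (map (\<lambda>s. [s]) [0..<m]) w)"
  by (intro isotopic_same_strandsI word_diagram_realise)

lemma placed_word_diagram: "w \<in> pv_words m \<Longrightarrow> placed (map (\<lambda>s. [s]) [0..<m]) w"
  by (auto simp: placed_def support_def pv_words_iff comp_def)

lemma word_diagram_gauss_diagrams: "w \<in> pv_words m \<Longrightarrow> word_diagram m w \<in> gauss_diagrams m"
  using isotopic_gauss_diagrams[OF isotopic_sym[OF isotopic_word_diagram] realise_gauss_diagrams[OF placed_word_diagram]]
  by simp

lemma isotopic_delete_lreal: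
  assumes "distinct (map fst w)"
  shows "isotopic (delete_arrows A (lreal x w)) (lreal x (filter (\<lambda>(q, l). q \<notin> A) w))"
proof (rule isotopic_same_strandsI)
  have "filter (\<lambda>z. arrow_of z \<notin> A) (slot_ends s w) = slot_ends s (filter (\<lambda>(q, l). q \<notin> A) w)" for s
    by (induction w) auto
  then show "strands (delete_arrows A (lreal x w)) = strands (lreal x (filter (\<lambda>(q, l). q \<notin> A) w))"
    by (simp add: lreal_def strands_delete_arrows filter_concat comp_def)
  fix a assume "a \<in> arrows (delete_arrows A (lreal x w))"
  then have "a \<in> arrows (lreal x w)" "a \<notin> A" by auto
  then obtain i j p where a: "(a, i, j, p) \<in> set w" using arrows_lreal_subset by fastforce
  then have "(a, i, j, p) \<in> set (filter (\<lambda>(q, l). q \<notin> A) w)" using \<open>a \<notin> A\<close> by simp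
  moreover have "distinct (map fst (filter (\<lambda>(q, l). q \<notin> A) w))" using assms by (rule distinct_map_filter)
  ultimately show "sign (delete_arrows A (lreal x w)) a = sign (lreal x (filter (\<lambda>(q, l). q \<notin> A) w)) a"
    using sign_lreal a assms by (metis sign_delete_arrows)
qed

text \<open>Cancelling two inverse letters is a second Reidemeister move.\<close>

lemma RII_realise:
  assumes "placed x (u @ [(i, j, p), (i, j, \<not> p)] @ v)"
  shows "generated_equiv (length x) RII (realise x (u @ [(i, j, p), (i, j, \<not> p)] @ v)) (realise x (u @ v))"
proof -
  define w where "w = u @ [(i, j, p), (i, j, \<not> p)] @ v"
  define a where "a = length u"
  define lu lv where "lu = zip [0..<a] u" and "lv = zip [a + 2..<length w] v"
  have lens: "length w = a + 2 + length v" by (simp add: w_def a_def)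
  have upt: "[0..<length w] = [0..<a] @ [a, Suc a] @ [a + 2..<length w]"
  proof -
    have "[0..<a + 2] = [0..<a] @ [a, Suc a]" by (simp add: numeral_2_eq_2)
    then show ?thesis unfolding lens using upt_add_eq_append[of 0 "a + 2" "length v"] by simp
  qed
  have lw: "zip [0..<length w] w = lu @ [(a, i, j, p), (Suc a, i, j, \<not> p)] @ lv"
    unfolding upt lu_def lv_def by (simp add: w_def a_def zip_append1)
  have ij: "i \<noteq> j" "i \<in> set (concat x)" "j \<in> set (concat x)" and dx: "distinct (concat x)"
    using assms by (auto simp: placed_def)
  have fl: "filter (\<lambda>(q, l). q \<notin> {a, Suc a}) (zip [0..<length w] w) = lu @ lv"
  proof -
    have "filter (\<lambda>(q, l). q \<notin> {a, Suc a}) lu = lu" "filter (\<lambda>(q, l). q \<notin> {a, Suc a}) lv = lv"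
      unfolding filter_id_conv lu_def lv_def by (auto dest!: set_zip_leftD)
    then show ?thesis unfolding lw by simp
  qed
  have cons: "consecutive (realise x w) y z" if s: "s \<in> set (concat x)"
    and yz: "slot_ends s [(a, i, j, p), (Suc a, i, j, \<not> p)] = [y, z]" for s y z
  proof -
    obtain t where t: "t \<in> set x" "s \<in> set t" using s by auto
    obtain t1 t2 where "t = t1 @ s # t2" using t(2) by (meson split_list)
    then have "concat (map (\<lambda>j. slot_ends j (zip [0..<length w] w)) t) =
        (concat (map (\<lambda>j. slot_ends j (zip [0..<length w] w)) t1) @ slot_ends s lu) @ [y, z] @
        (slot_ends s lv @ concat (map (\<lambda>j. slot_ends j (zip [0..<length w] w)) t2))" (is "?l = ?r")
      using yz unfolding lw by simp
    moreover have "?l \<in> set (strands (realise x w))" using t(1) by (simp add: realise_def lreal_def)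
    ultimately show ?thesis unfolding consecutive_def by metis
  qed
  have "consecutive (realise x w) (Tail a) (Tail (Suc a))" "consecutive (realise x w) (Head a) (Head (Suc a))"
    using cons[of i] cons[of j] ij by simp_all
  moreover have in_w: "(a, i, j, p) \<in> set (zip [0..<length w] w)" "(Suc a, i, j, \<not> p) \<in> set (zip [0..<length w] w)"
    unfolding lw by simp_all
  moreover have arr: "a \<in> arrows (realise x w)" "Suc a \<in> arrows (realise x w)"
    using lreal_endpoint_iff(1)[of x "zip [0..<length w] w"] in_w assms
    unfolding realise_def arrows_def w_def[symmetric] by (force simp: image_iff)+
  ultimately have RII: "RII (realise x w) (delete_arrows {a, Suc a} (realise x w))"
    unfolding RII_def adjacent_def
    using sign_lreal[of "zip [0..<length w] w"] by (intro bexI[of _ a] bexI[of _ "Suc a"]) (auto simp: realise_def)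
  have gd: "realise x w \<in> gauss_diagrams (length x)"
    using realise_gauss_diagrams assms by (simp add: w_def)
  have "isotopic (delete_arrows {a, Suc a} (realise x w)) (lreal x (lu @ lv))"
    unfolding realise_def fl[symmetric] by (rule isotopic_delete_lreal) simp
  also have "isotopic (lreal x (lu @ lv)) (realise x (u @ v))"
  proof -
    have "length [a + 2..<length w] = length v" unfolding length_upt lens by arith
    then have "map snd lv = v" "map fst lv = [a + 2..<length w]"
      unfolding lv_def by (rule map_snd_zip, rule map_fst_zip)
    moreover have "map snd lu = u" "map fst lu = [0..<a]" by (simp_all add: lu_def a_def)
    ultimately have "map snd (lu @ lv) = u @ v" "distinct (map fst (lu @ lv))" by auto
    then show ?thesis using isotopic_realise_lreal[of "lu @ lv" x] by simp
  qed
  finally have iso: "isotopic (delete_arrows {a, Suc a} (realise x w)) (realise x (u @ v))" .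
  have gd: "realise x w \<in> gauss_diagrams (length x)"
    using realise_gauss_diagrams assms by (simp add: w_def)
  have "generated_equiv (length x) RII (realise x w) (delete_arrows {a, Suc a} (realise x w))"
    using RII gd RII_gauss_diagrams by (intro generated_equivI) auto
  also have "generated_equiv (length x) RII \<dots> (realise x (u @ v))"
    using iso delete_arrows_gauss_diagrams[OF gd] isotopic_gauss_diagrams[OF iso] by (intro generated_equivI) auto
  finally show ?thesis by (simp add: w_def)
qed

inductive free_trivial :: "pv_word \<Rightarrow> bool" where
  Nil: "free_trivial []"
| insert: "free_trivial (u @ v) \<Longrightarrow> free_trivial (u @ [(i, j, p), (i, j, \<not> p)] @ v)"

lemma free_trivial_insert_word:
  assumes "free_trivial t" "free_trivial (u @ v)"
  shows "free_trivial (u @ t @ v)"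
  using assms
proof (induction t rule: free_trivial.induct)
  case (insert a b i j p)
  then show ?case using free_trivial.insert[of "u @ a" "b @ v" i j p] by simp
qed simp

lemma free_trivial_append: "\<lbrakk>free_trivial u; free_trivial v\<rbrakk> \<Longrightarrow> free_trivial (u @ v)"
  using free_trivial_insert_word[of u "[]" v] by simp

lemma inv_letter_inv_letter [simp]: "inv_letter (inv_letter l) = l"
  by (cases l) simp

lemma inv_word_inv_word [simp]: "inv_word (inv_word w) = w"
  by (simp add: inv_word_def rev_map comp_def)

lemma free_trivial_inv: "free_trivial (w @ inv_word w)" "free_trivial (inv_word w @ w)"
proof -
  have *: "free_trivial (w @ inv_word w)" for w
  proof (induction w)
    case (Cons l w)
    obtain i j p where l: "l = (i, j, p)" by (cases l)
    have "free_trivial [l, inv_letter l]"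
      using free_trivial.insert[of "[]" "[]" i j p] free_trivial.Nil l by simp
    then show ?case using free_trivial_insert_word[OF Cons, of "[l]" "[inv_letter l]"] by simp
  qed (simp add: free_trivial.Nil)
  show "free_trivial (w @ inv_word w)" by (rule *)
  show "free_trivial (inv_word w @ w)" using *[of "inv_word w"] by simp
qed

lemma free_trivial_inv_word: "free_trivial w \<Longrightarrow> free_trivial (inv_word w)"
proof (induction rule: free_trivial.induct)
  case (insert u v i j p)
  then show ?case using free_trivial.insert[of "inv_word v" "inv_word u" i j p] by simp
qed (simp add: free_trivial.Nil)

lemma realise_free_trivial:
  assumes "free_trivial t" "placed x (u @ t @ v)"
  shows "generated_equiv (length x) RII (realise x (u @ t @ v)) (realise x (u @ v))"
  using assms
proof (induction t rule: free_trivial.induct)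
  case (insert a b i j p)
  have "generated_equiv (length x) RII (realise x (u @ (a @ [(i, j, p), (i, j, \<not> p)] @ b) @ v)) (realise x (u @ (a @ b) @ v))"
    using RII_realise[of x "u @ a" i j p "b @ v"] insert.prems by simp
  also have "generated_equiv (length x) RII \<dots> (realise x (u @ v))"
    using insert by simp
  finally show ?case .
qed simp

lemma isotopic_realise_Nil: "isotopic (realise x []) (trivial_diagram (length x) :: nat gauss_diagram)"
  by (rule isotopic_same_strandsI)
    (auto simp: realise_def lreal_def trivial_diagram_def arrows_def endpoints_def map_replicate_const comp_def
      simp flip: map_replicate_const)

section \<open>Deep words give n-trivial diagrams\<close>

text \<open>
  The colours are the classes of letters that witness the triviality of the diagram of a word.
\<close>

definition coloured :: "nat \<Rightarrow> nat \<Rightarrow> (nat \<times> nat \<times> nat \<times> bool) list \<Rightarrow> bool" where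
  "coloured m n w \<longleftrightarrow> map snd w \<in> pv_words m \<and> fst ` set w = {..<n} \<and>
     (\<forall>S. S \<inter> {..<n} \<noteq> {} \<longrightarrow> free_trivial (map snd (filter (\<lambda>(c, l). c \<notin> S) w)))"

lemma pv_class_free_trivial:
  assumes "free_trivial t" "t \<in> pv_words m"
  shows "pv_class m t = \<one>\<^bsub>PV m\<^esub>"
  using assms
proof (induction t rule: free_trivial.induct)
  case (insert u v i j p)
  then show ?case using pv_class_cancel[of u m v i j p] by simp
qed (simp add: pv_class_Nil)

lemma coloured_append:
  assumes "coloured m n u" "coloured m n v"
  shows "coloured m n (u @ v)"
  using assms by (simp add: coloured_def image_Un free_trivial_append)

definition inv_coloured :: "(nat \<times> nat \<times> nat \<times> bool) list \<Rightarrow> (nat \<times> nat \<times> nat \<times> bool) list" where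
  "inv_coloured w = rev (map (map_prod id inv_letter) w)"

lemma map_snd_inv_coloured: "map snd (inv_coloured w) = inv_word (map snd w)"
  by (simp add: inv_coloured_def inv_word_def rev_map comp_def)

lemma fst_inv_coloured: "fst ` set (inv_coloured w) = fst ` set w"
  by (force simp: inv_coloured_def)

lemma filter_inv_coloured:
  "filter (\<lambda>(c, l). c \<notin> S) (inv_coloured w) = inv_coloured (filter (\<lambda>(c, l). c \<notin> S) w)"
  by (simp add: inv_coloured_def filter_map comp_def split_def flip: rev_filter)

lemma coloured_inv_coloured: "coloured m n w \<Longrightarrow> coloured m n (inv_coloured w)"
  by (simp add: coloured_def map_snd_inv_coloured fst_inv_coloured filter_inv_coloured free_trivial_inv_word)

lemma map_snd_Pair [simp]: "map (snd \<circ> Pair n) v = v"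
  by (simp add: comp_def)

lemma coloured_commutator:
  assumes u: "coloured m n u" and v: "v \<in> pv_words m" "v \<noteq> []"
  shows "coloured m (Suc n) (u @ map (Pair n) v @ inv_coloured u @ inv_coloured (map (Pair n) v))" (is "coloured _ _ ?w")
proof -
  have snd_v: "map snd (map (Pair n) v) = v" by (simp add: comp_def)
  have fst_v: "fst ` set (map (Pair n) v) = {n}" using v(2) by (cases v) auto
  have cols: "fst ` set u = {..<n}" using u by (simp add: coloured_def)
  have "free_trivial (map snd (filter (\<lambda>(c, l). c \<notin> S) ?w))" if S: "S \<inter> {..<Suc n} \<noteq> {}" for S
  proof (cases "n \<in> S")
    case True
    then have "filter (\<lambda>(c, l). c \<notin> S) (map (Pair n) v) = []" by (simp add: filter_empty_conv)
    then show ?thesis by (simp add: filter_inv_coloured map_snd_inv_coloured free_trivial_inv inv_coloured_def[of "[]"])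
  next
    case False
    then have "S \<inter> {..<n} \<noteq> {}" using S by (auto simp: lessThan_Suc)
    then have ft: "free_trivial (map snd (filter (\<lambda>(c, l). c \<notin> S) u))" using u by (simp add: coloured_def)
    have fv: "filter (\<lambda>(c, l). c \<notin> S) (map (Pair n) v) = map (Pair n) v"
      using False by (simp add: filter_id_conv)
    have "free_trivial (v @ inv_word (map snd (filter (\<lambda>(c, l). c \<notin> S) u)) @ inv_word v)"
      using free_trivial_insert_word[OF free_trivial_inv_word[OF ft] free_trivial_inv(1)] by simp
    then show ?thesis
      using free_trivial_append[OF ft] by (simp add: filter_inv_coloured map_snd_inv_coloured fv snd_v)
  qed
  moreover have "fst ` set ?w = {..<Suc n}"
    by (simp only: set_append image_Un fst_inv_coloured fst_v cols) (auto simp: lessThan_Suc)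
  ultimately show ?thesis
    using u v by (simp add: coloured_def map_snd_inv_coloured comp_def)
qed

text \<open>Every colour has to occur; pairs of inverse letters achieve this without changing the class.\<close>

lemma coloured_one:
  assumes "2 \<le> m"
  obtains w where "coloured m n w" "pv_class m (map snd w) = \<one>\<^bsub>PV m\<^esub>"
proof -
  define w :: "nat \<Rightarrow> (nat \<times> nat \<times> nat \<times> bool) list" where
    "w n = concat (map (\<lambda>c. [(c, 0, 1, True), (c, 0, 1, False)]) [0..<n])" for n
  have ft: "free_trivial (map snd (filter (\<lambda>(c, l). c \<notin> S) (w n)))" for S
  proof (induction n)
    case (Suc n)
    have "free_trivial [(0, 1, True), (0, 1, False)]"
      using free_trivial.insert[of "[]" "[]" 0 1 True] free_trivial.Nil by simp
    then show ?case using Suc free_trivial_append by (simp add: w_def)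
  qed (simp add: w_def free_trivial.Nil)
  have "coloured m n (w n)"
    using ft assms by (auto simp: coloured_def w_def pv_words_iff image_UN)
  moreover have "free_trivial (map snd (w n))" using ft[of "{}"] by (simp add: split_def)
  then have "pv_class m (map snd (w n)) = \<one>\<^bsub>PV m\<^esub>"
    using calculation by (intro pv_class_free_trivial) (auto simp: coloured_def)
  ultimately show thesis using that by blast
qed

text \<open>
  The colours of a product of iterated commutators: each entry of the commutators has its own
  colour, and a commutator collapses freely when one of its entries is deleted.
\<close>

lemma lower_central_coloured:
  assumes "2 \<le> m" "h \<in> lower_central (PV m) (Suc n)"
  obtains w where "coloured m (Suc n) w" "pv_class m (map snd w) = h"
proof -
  interpret group "PV m" by (rule group_PV)
  have "\<exists>w. coloured m (Suc n) w \<and> pv_class m (map snd w) = h"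
    using assms(2)
  proof (induction n arbitrary: h)
    case 0
    then have "h \<in> carrier (PV m)" by simp
    then obtain w where w: "w \<in> pv_words m" "h = pv_class m w" by (rule PV_carrierE)
    define v where "v = w @ [(0, 1, True), (0, 1, False)]"
    have "coloured m (Suc 0) (map (Pair 0) v)"
      using w(1) assms(1) by (auto simp: coloured_def v_def comp_def filter_map free_trivial.Nil)
    moreover have "pv_class m v = h" using pv_class_cancel[of w m "[]" 0 1 True] w assms(1) by (simp add: v_def)
    ultimately show ?case by (auto simp: comp_def intro!: exI[of _ "map (Pair 0) v"])
  next
    case (Suc n)
    let ?P = "\<lambda>h. \<exists>w. coloured m (Suc (Suc n)) w \<and> pv_class m (map snd w) = h"
    have comm: "?P (commutator x y)" if x: "x \<in> lower_central (PV m) (Suc n)" and y: "y \<in> carrier (PV m)" for x y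
    proof -
      obtain u where u: "coloured m (Suc n) u" "pv_class m (map snd u) = x" using Suc.IH[OF x] by blast
      obtain v0 where v0: "v0 \<in> pv_words m" "y = pv_class m v0" using y by (rule PV_carrierE)
      define v where "v = v0 @ [(0, 1, True), (0, 1, False)]"
      have v: "v \<in> pv_words m" "v \<noteq> []" "y = pv_class m v"
        using v0 assms(1) pv_class_cancel[of v0 m "[]" 0 1 True] by (simp_all add: v_def)
      have uw: "map snd u \<in> pv_words m" using u(1) by (simp add: coloured_def)
      have "pv_class m (map snd (u @ map (Pair (Suc n)) v @ inv_coloured u @ inv_coloured (map (Pair (Suc n)) v))) =
          commutator x y"
        using uw v by (simp add: map_snd_inv_coloured comp_def pv_class_inv_word pv_class_append v(3) flip: u(2))
      then show ?thesis using coloured_commutator[OF u(1) v(1,2)] by blast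
    qed
    have inv_P: "?P (inv\<^bsub>PV m\<^esub> h)" if Ph: "?P h" for h
    proof -
      obtain w where w: "coloured m (Suc (Suc n)) w" "pv_class m (map snd w) = h" using Ph by blast
      then have "pv_class m (map snd (inv_coloured w)) = inv\<^bsub>PV m\<^esub> h"
        by (auto simp: map_snd_inv_coloured pv_class_inv_word coloured_def)
      then show ?thesis using coloured_inv_coloured[OF w(1)] by blast
    qed
    from Suc.prems show ?case unfolding lower_central.simps(3)
    proof (induction h rule: generate.induct)
      case one
      then show ?case using coloured_one[OF assms(1)] by metis
    next
      case (incl h)
      then show ?case using comm by auto
    next
      case (inv h)
      then have "?P h" using comm by auto
      then show ?case by (rule inv_P)
    next
      case (eng h1 h2)
      then obtain w1 w2 where w: "coloured m (Suc (Suc n)) w1" "pv_class m (map snd w1) = h1"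
        "coloured m (Suc (Suc n)) w2" "pv_class m (map snd w2) = h2" by blast
      then have "pv_class m (map snd (w1 @ w2)) = h1 \<otimes>\<^bsub>PV m\<^esub> h2"
        by (auto simp: pv_class_append coloured_def)
      then show ?case using coloured_append[OF w(1,3)] by blast
    qed
  qed
  then show thesis using that by blast
qed

lemma map_snd_filter_zip:
  "map snd (filter (\<lambda>(q, l). fst (w ! q) \<notin> S) (zip [0..<length w] (map snd w))) = map snd (filter (\<lambda>(c, l). c \<notin> S) w)"
proof (induction w rule: rev_induct)
  case (snoc z w)
  have "filter (\<lambda>(q, l). fst ((w @ [z]) ! q) \<notin> S) (zip [0..<length w] (map snd w)) =
      filter (\<lambda>(q, l). fst (w ! q) \<notin> S) (zip [0..<length w] (map snd w))"
    by (rule filter_cong) (auto simp: nth_append dest: set_zip_leftD)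
  then show ?case using snoc by (cases z) (simp add: zip_append1)
qed simp

lemma n_trivial_coloured:
  assumes "coloured m (Suc n) w"
  shows "n_trivial m n (word_diagram m (map snd w))"
proof -
  let ?D = "word_diagram m (map snd w)"
  define x where "x = map (\<lambda>s. [s]) [0..<m]"
  let ?z = "zip [0..<length w] (map snd w)"
  have words: "map snd w \<in> pv_words m" and cols: "fst ` set w = {..<Suc n}"
    using assms by (auto simp: coloured_def)
  have real: "realise x (map snd w) = lreal x ?z" by (simp add: realise_def)
  have placed: "placed x v" if "v \<in> pv_words m" for v using that placed_word_diagram by (simp add: x_def)
  define A where "A i = {q. q < length w \<and> fst (w ! q) = i}" for i
  have strands: "strands ?D = strands (realise x (map snd w))"
    and sgn: "\<And>a. a \<in> arrows ?D \<Longrightarrow> sign ?D a = sign (realise x (map snd w)) a"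
    unfolding x_def by (rule word_diagram_realise)+
  have arr: "arrows ?D = {..<length w}"
  proof -
    have "arrows ?D = arrows (realise x (map snd w))" using strands by (simp add: arrows_def endpoints_def)
    also have "\<dots> = {..<length w}"
    proof
      have fst_z: "fst ` set ?z = {..<length w}"
        by (metis atLeast_upt length_map map_snd_zip_upt(2) set_map)
      then show "arrows (realise x (map snd w)) \<subseteq> {..<length w}"
        using arrows_lreal_subset[of x ?z] by (simp add: real)
      have "Tail q \<in> endpoints (lreal x ?z)" if "q < length w" for q
        using lreal_endpoint_iff(1)[of x ?z q] placed[OF words] that fst_z by simp
      then show "{..<length w} \<subseteq> arrows (realise x (map snd w))"
        by (force simp: real arrows_def image_iff)
    qed
    finally show ?thesis .
  qed
  have gd: "?D \<in> gauss_diagrams m" using words by (rule word_diagram_gauss_diagrams)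
  have "generated_equiv m RII (delete_arrows (\<Union>(A ` S)) ?D) (trivial_diagram m)"
    if S: "S \<noteq> {}" "S \<subseteq> {..n}" for S
  proof -
    let ?B = "\<Union>(A ` S)" and ?v = "map snd (filter (\<lambda>(c, l). c \<notin> S) w)"
    have ft: "free_trivial ?v" using assms S unfolding coloured_def by (auto simp: lessThan_Suc_atMost)
    have vw: "?v \<in> pv_words m" using words by (force simp: pv_words_iff)
    have "filter (\<lambda>(q, l). q \<notin> ?B) ?z = filter (\<lambda>(q, l). fst (w ! q) \<notin> S) ?z"
      by (rule filter_cong) (auto simp: A_def dest: set_zip_leftD)
    then have snd_f: "map snd (filter (\<lambda>(q, l). q \<notin> ?B) ?z) = ?v" using map_snd_filter_zip[of w S] by simp
    have "isotopic (delete_arrows ?B ?D) (delete_arrows ?B (realise x (map snd w)))"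
      using strands sgn by (intro isotopic_same_strandsI) (auto simp: strands_delete_arrows)
    also have "isotopic \<dots> (lreal x (filter (\<lambda>(q, l). q \<notin> ?B) ?z))"
      unfolding real by (rule isotopic_delete_lreal) simp
    also have "isotopic \<dots> (realise x ?v)"
      unfolding snd_f[symmetric] by (rule isotopic_realise_lreal) (simp add: distinct_map_filter)
    finally have iso: "isotopic (delete_arrows ?B ?D) (realise x ?v)" .
    have len: "length x = m" by (simp add: x_def)
    have "generated_equiv m RII (delete_arrows ?B ?D) (realise x ?v)"
      using iso gd delete_arrows_gauss_diagrams realise_gauss_diagrams[OF placed[OF vw]] len
      by (intro generated_equivI) auto
    also have "generated_equiv m RII \<dots> (realise x [])"
      using realise_free_trivial[OF ft, of x "[]" "[]"] placed[OF vw] len by simp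
    also have "generated_equiv m RII \<dots> (trivial_diagram m)"
      using generated_equivI[OF realise_gauss_diagrams isotopic_gauss_diagrams[OF isotopic_realise_Nil realise_gauss_diagrams]]
        isotopic_realise_Nil[of x] placed[of "[]"] len by auto
    finally show ?thesis .
  qed
  moreover have "A i \<noteq> {} \<and> A i \<subseteq> arrows ?D" if "i \<le> n" for i
  proof -
    have "i \<in> fst ` set w" using cols that by auto
    then have "\<exists>q<length w. fst (w ! q) = i" by (metis imageE in_set_conv_nth)
    then show ?thesis unfolding arr by (auto simp: A_def)
  qed
  moreover have "disjoint_family_on A {..n}" by (auto simp: disjoint_family_on_def A_def)
  ultimately show ?thesis unfolding n_trivial_def by (intro exI[of _ A]) auto
qed

section \<open>The third Reidemeister move for all orientations\<close>

abbreviation RII_RIII :: "nat \<Rightarrow> nat gauss_diagram \<Rightarrow> nat gauss_diagram \<Rightarrow> bool" where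
  "RII_RIII k \<equiv> generated_equiv k (\<lambda>D E. RII D E \<or> RIII D E)"

lemma consecutiveI:
  assumes "\<exists>s\<in>set (strands D). (x, y) \<in> set (zip s (tl s))"
  shows "consecutive D x y"
proof -
  obtain s where s: "s \<in> set (strands D)" "(x, y) \<in> set (zip s (tl s))" using assms by blast
  have "\<exists>u v. s = u @ [x, y] @ v" using s(2)
  proof (induction s)
    case (Cons a s)
    show ?case
    proof (cases "a = x \<and> s \<noteq> [] \<and> hd s = y")
      case True
      then have "a # s = [] @ [x, y] @ tl s" by (cases s) auto
      then show ?thesis by blast
    next
      case False
      then have "(x, y) \<in> set (zip s (tl s))" using Cons.prems by (cases s) auto
      then obtain u v where "s = u @ [x, y] @ v" using Cons.IH by blast
      then have "a # s = (a # u) @ [x, y] @ v" by simp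
      then show ?thesis by blast
    qed
  qed simp
  then show ?thesis using s(1) by (auto simp: consecutive_def)
qed

lemma adjacentI:
  assumes "\<exists>s\<in>set (strands D). (x, y) \<in> set (zip s (tl s)) \<or> (y, x) \<in> set (zip s (tl s))"
  shows "adjacent D x y"
proof -
  have "(\<exists>s\<in>set (strands D). (x, y) \<in> set (zip s (tl s))) \<or> (\<exists>s\<in>set (strands D). (y, x) \<in> set (zip s (tl s)))"
    using assms by blast
  then show ?thesis unfolding adjacent_def using consecutiveI by metis
qed

text \<open>
  Three strands crossed by three arrows: \<open>0\<close> goes from the first strand to the second, \<open>1\<close> from the
  first to the third, \<open>2\<close> from the second to the third. The Booleans choose the orders of the
  endpoints on the strands.
\<close>

definition arrow_triangle :: "bool \<Rightarrow> bool \<Rightarrow> bool \<Rightarrow> int \<Rightarrow> int \<Rightarrow> int \<Rightarrow> nat gauss_diagram" where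
  "arrow_triangle o1 o2 o3 sa sb sc = Gauss_Diagram
     [if o1 then [Tail 0, Tail 1] else [Tail 1, Tail 0],
      if o2 then [Head 0, Tail 2] else [Tail 2, Head 0],
      if o3 then [Head 1, Head 2] else [Head 2, Head 1]]
     (\<lambda>q. [sa, sb, sc] ! q)"

lemma RIII_I:
  assumes "a \<noteq> b" "a \<noteq> c" "b \<noteq> c" "sign D a = sign D b" "sign D b = sign D c" "{a, b, c} \<subseteq> arrows D"
    "consecutive D (Tail a) (Tail b)" "consecutive D (Head a) (Tail c)" "consecutive D (Head b) (Head c)"
    "strands E = map (map (swap3 a b c)) (strands D)" "sign E = sign D"
  shows "RIII D E"
  using assms unfolding RIII_def swap3_def[symmetric]
  by (intro bexI[of _ a] bexI[of _ b] bexI[of _ c]) (auto intro: gauss_diagram.expand)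

lemma RII_delete:
  fixes D E :: "nat gauss_diagram"
  assumes "D \<in> gauss_diagrams k" "a \<noteq> b" "sign D a = - sign D b" "{a, b} \<subseteq> arrows D"
    "adjacent D (Tail a) (Tail b)" "adjacent D (Head a) (Head b)"
    "isotopic (delete_arrows {a, b} D) E"
  shows "RII_RIII k D E"
proof -
  have "RII D (delete_arrows {a, b} D)"
    using assms unfolding RII_def by (intro bexI[of _ a] bexI[of _ b]) auto
  then have "RII_RIII k D (delete_arrows {a, b} D)"
    using assms(1) delete_arrows_gauss_diagrams by (intro generated_equivI) auto
  also have "RII_RIII k \<dots> E"
    using assms(1,7) delete_arrows_gauss_diagrams isotopic_gauss_diagrams by (intro generated_equivI) blast+
  finally show ?thesis .
qed

lemma isotopicI:
  assumes "strands E = map (map (map_endpoint f)) (strands D)" "inj_on f (arrows D)"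
    "\<And>a. a \<in> arrows D \<Longrightarrow> sign E (f a) = sign D a"
  shows "isotopic D E"
  using assms unfolding isotopic_def by blast

lemma triangle_equal:
  assumes "s = 1 \<or> s = (-1 :: int)"
  shows "RII_RIII 3 (arrow_triangle True True True s s s) (arrow_triangle False False False s s s)"
proof -
  have "RIII (arrow_triangle True True True s s s) (arrow_triangle False False False s s s)"
    by (rule RIII_I[of 0 1 2])
      (auto simp: arrow_triangle_def arrows_def endpoints_def swap3_def transpose_def intro!: consecutiveI)
  moreover have "arrow_triangle True True True s s s \<in> gauss_diagrams 3"
    using assms by (auto simp: arrow_triangle_def gauss_diagrams_def arrows_def endpoints_def)
  ultimately show ?thesis using RIII_gauss_diagrams generated_equivI by metis
qed

text \<open>
  Flipping the sign of one arrow \<open>a\<close> of a triangle: insert a pair \<open>a'\<close>, \<open>a''\<close> (here \<open>3\<close> and \<open>4\<close>) next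
  to \<open>a\<close>, move the triangle that contains \<open>a'\<close> instead of \<open>a\<close>, and cancel \<open>a'\<close> with \<open>a\<close> (here \<open>r\<close>).
\<close>

lemma triangle_flip:
  fixes D E X X' :: "nat gauss_diagram"
  assumes D: "D \<in> gauss_diagrams 3"
    and pair: "3 \<noteq> r" "sign D 3 = - sign D 4" "sign D r = - sign D 3" "{r, 3, 4} \<subseteq> arrows D"
      "adjacent D (Tail 3) (Tail 4)" "adjacent D (Head 3) (Head 4)"
      "isotopic (delete_arrows {3, 4} D) X"
    and E: "RIII D E" "sign E = sign D" "{r, 3} \<subseteq> arrows E" "adjacent E (Tail r) (Tail 3)" "adjacent E (Head r) (Head 3)"
      "isotopic (delete_arrows {r, 3} E) X'"
  shows "RII_RIII 3 X X'"
proof -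
  have gdE: "E \<in> gauss_diagrams 3" using E(1) D by (rule RIII_gauss_diagrams)
  have "RII_RIII 3 D X" using pair by (intro RII_delete[OF D, of 3 4]) auto
  moreover have "RII_RIII 3 D E" using D gdE E(1) by (intro generated_equivI) auto
  moreover have "RII_RIII 3 E X'" using pair E by (intro RII_delete[OF gdE, of r 3]) auto
  ultimately show ?thesis using generated_equiv_sym generated_equiv_trans by blast
qed

lemmas triangle_simps = arrow_triangle_def arrows_def endpoints_def swap3_def transpose_def delete_arrows_def gauss_diagrams_def

lemma triangle_flip_1:
  assumes s: "s = 1 \<or> s = (-1 :: int)"
  shows "RII_RIII 3 (arrow_triangle False False True (-s) s s) (arrow_triangle True True False (-s) s s)"
proof -
  define D where "D = Gauss_Diagram [[Tail 4, Tail 3, Tail 1, Tail 0], [Head 4, Head 3, Tail 2, Head 0], [Head 1, Head 2 :: nat endpoint]]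
    ((!) [-s, s, s, s, -s])"
  define E where "E = Gauss_Diagram [[Tail 4, Tail 1, Tail 3, Tail 0], [Head 4, Tail 2, Head 3, Head 0], [Head 2, Head 1 :: nat endpoint]]
    ((!) [-s, s, s, s, -s])"
  show ?thesis
  proof (rule triangle_flip[of D 0 _ E])
    show "RIII D E"
      by (rule RIII_I[of 3 1 2]) (auto simp: D_def E_def triangle_simps intro!: consecutiveI)
    show "isotopic (delete_arrows {3, 4} D) (arrow_triangle False False True (-s) s s)"
      by (rule isotopicI[of _ id]) (auto simp: D_def triangle_simps)
    show "isotopic (delete_arrows {0, 3} E) (arrow_triangle True True False (-s) s s)"
      by (rule isotopicI[of _ "\<lambda>q. if q = 4 then 0 else q"]) (auto simp: E_def triangle_simps)
  qed (use s in \<open>auto simp: D_def E_def triangle_simps intro!: adjacentI\<close>)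
qed

lemma triangle_flip_2:
  assumes s: "s = 1 \<or> s = (-1 :: int)"
  shows "RII_RIII 3 (arrow_triangle False True False s (-s) s) (arrow_triangle True False True s (-s) s)"
proof -
  define D where "D = Gauss_Diagram [[Tail 1, Tail 0, Tail 3, Tail 4], [Head 0, Tail 2], [Head 4, Head 3, Head 2, Head 1 :: nat endpoint]]
    ((!) [s, -s, s, s, -s])"
  define E where "E = Gauss_Diagram [[Tail 1, Tail 3, Tail 0, Tail 4], [Tail 2, Head 0], [Head 4, Head 2, Head 3, Head 1 :: nat endpoint]]
    ((!) [s, -s, s, s, -s])"
  show ?thesis
  proof (rule triangle_flip[of D 1 _ E])
    show "RIII D E"
      by (rule RIII_I[of 0 3 2]) (auto simp: D_def E_def triangle_simps intro!: consecutiveI)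
    show "isotopic (delete_arrows {3, 4} D) (arrow_triangle False True False s (-s) s)"
      by (rule isotopicI[of _ id]) (auto simp: D_def triangle_simps)
    show "isotopic (delete_arrows {1, 3} E) (arrow_triangle True False True s (-s) s)"
      by (rule isotopicI[of _ "\<lambda>q. if q = 4 then 1 else q"]) (auto simp: E_def triangle_simps)
  qed (use s in \<open>auto simp: D_def E_def triangle_simps intro!: adjacentI\<close>)
qed

lemma triangle_flip_3:
  assumes s: "s = 1 \<or> s = (-1 :: int)"
  shows "RII_RIII 3 (arrow_triangle True False False s s (-s)) (arrow_triangle False True True s s (-s))"
proof -
  define D where "D = Gauss_Diagram [[Tail 0, Tail 1], [Tail 2, Head 0, Tail 3, Tail 4], [Head 2, Head 1, Head 3, Head 4 :: nat endpoint]]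
    ((!) [s, s, -s, s, -s])"
  define E where "E = Gauss_Diagram [[Tail 1, Tail 0], [Tail 2, Tail 3, Head 0, Tail 4], [Head 2, Head 3, Head 1, Head 4 :: nat endpoint]]
    ((!) [s, s, -s, s, -s])"
  show ?thesis
  proof (rule triangle_flip[of D 2 _ E])
    show "RIII D E"
      by (rule RIII_I[of 0 1 3]) (auto simp: D_def E_def triangle_simps intro!: consecutiveI)
    show "isotopic (delete_arrows {3, 4} D) (arrow_triangle True False False s s (-s))"
      by (rule isotopicI[of _ id]) (auto simp: D_def triangle_simps)
    show "isotopic (delete_arrows {2, 3} E) (arrow_triangle False True True s s (-s))"
      by (rule isotopicI[of _ "\<lambda>q. if q = 4 then 2 else q"]) (auto simp: E_def triangle_simps)
  qed (use s in \<open>auto simp: D_def E_def triangle_simps intro!: adjacentI\<close>)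
qed

text \<open>All sign patterns; the orders on the three strands are forced by the signs.\<close>

lemma triangle_all:
  assumes "sa = 1 \<or> sa = (-1 :: int)" "sb = 1 \<or> sb = (-1 :: int)" "sc = 1 \<or> sc = (-1 :: int)"
    and "b \<longleftrightarrow> sa = sb" "c \<longleftrightarrow> sa = sc" "d \<longleftrightarrow> sb = sc"
  shows "RII_RIII 3 (arrow_triangle b c d sa sb sc) (arrow_triangle (\<not> b) (\<not> c) (\<not> d) sa sb sc)"
  using triangle_equal[of sa] triangle_flip_1[of sb] triangle_flip_2[of sa] triangle_flip_3[of sa] assms
  by auto

section \<open>Words of the same class\<close>

abbreviation columns :: "nat \<Rightarrow> nat list list" where
  "columns m \<equiv> map (\<lambda>s. [s]) [0..<m]"

lemma strands_lreal_columns: "strands (lreal (columns m) w) = map (\<lambda>s. slot_ends s w) [0..<m]"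
  by (simp add: lreal_def)

lemma strands_reverse_columns:
  "strands (reverse_strands J (lreal (columns m) w)) =
    map (\<lambda>s. if s \<in> J then rev (slot_ends s w) else slot_ends s w) [0..<m]"
  by (simp add: reverse_strands_def strands_lreal_columns)

lemma on_strands_columns:
  "on_strands J (lreal (columns m) w) x \<longleftrightarrow> (\<exists>j\<in>J. j < m \<and> x \<in> set (slot_ends j w))"
  by (auto simp: on_strands_def strands_lreal_columns)

lemma sign_reverse_columns:
  assumes "distinct (map fst w)" "(q, i, j, p) \<in> set w" "i < m" "j < m" "i \<noteq> j"
  shows "sign (reverse_strands J (lreal (columns m) w)) q = (if p \<longleftrightarrow> (i \<in> J \<longleftrightarrow> j \<in> J) then 1 else -1)"
proof -
  have uniq: "i' = i \<and> j' = j" if "(q, i', j', p') \<in> set w" for i' j' p'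
    using eq_key_imp_eq_value[OF assms(1,2) that] by simp
  have "Tail q \<in> set (slot_ends s w) \<longleftrightarrow> s = i" "Head q \<in> set (slot_ends s w) \<longleftrightarrow> s = j" for s
    unfolding Tail_in_slot_ends Head_in_slot_ends using uniq assms(2,5) by blast+
  then have "on_strands J (lreal (columns m) w) (Tail q) \<longleftrightarrow> i \<in> J" "on_strands J (lreal (columns m) w) (Head q) \<longleftrightarrow> j \<in> J"
    using assms(3,4) by (auto simp: on_strands_columns)
  then show ?thesis using sign_lreal[OF assms(1,2)] by (simp add: sign_reverse_strands)
qed

lemma isotopic_word_diagram_lreal:
  assumes "distinct (map fst w)" "map snd w = u"
  shows "isotopic (word_diagram m u) (lreal (columns m) w)"
  using isotopic_trans[OF isotopic_word_diagram isotopic_sym[OF isotopic_realise_lreal[OF assms(1)]]] assms(2) by simp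

lemma triple_reverse:
  assumes "w = [(0, 1, True), (0, 2, True), (1, 2, True)]" "w' = [(1, 2, True), (0, 2, True), (0, 1, True)]"
  shows "RII_RIII 3 (reverse_strands J (word_diagram 3 w)) (reverse_strands J (word_diagram 3 w'))"
proof -
  define sg where "sg i j = (if i \<in> J \<longleftrightarrow> j \<in> J then 1 else -1 :: int)" for i j
  let ?T = "\<lambda>b c d. arrow_triangle b c d (sg 0 1) (sg 0 2) (sg 1 2)"
  define l where "l = [(0 :: nat, 0 :: nat, 1 :: nat, True), (1, 0, 2, True), (2, 1, 2, True)]"
  define l' where "l' = [(2 :: nat, 1 :: nat, 2 :: nat, True), (1, 0, 2, True), (0, 0, 1, True)]"
  have upt: "[0..<3] = [0, 1, 2 :: nat]" by (simp add: upt_rec)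
  have 1: "isotopic (reverse_strands J (lreal (columns 3) l)) (?T (0 \<notin> J) (1 \<notin> J) (2 \<notin> J))"
  proof (rule isotopic_same_strandsI)
    show "strands (reverse_strands J (lreal (columns 3) l)) = strands (?T (0 \<notin> J) (1 \<notin> J) (2 \<notin> J))"
      unfolding strands_reverse_columns unfolding upt by (simp add: l_def arrow_triangle_def)
    fix a assume "a \<in> arrows (reverse_strands J (lreal (columns 3) l))"
    then have "a \<in> fst ` set l" using arrows_lreal_subset[of "columns 3" l] by auto
    then show "sign (reverse_strands J (lreal (columns 3) l)) a = sign (?T (0 \<notin> J) (1 \<notin> J) (2 \<notin> J)) a"
      using sign_reverse_columns[of l 0 0 1 True 3 J] sign_reverse_columns[of l 1 0 2 True 3 J]
        sign_reverse_columns[of l 2 1 2 True 3 J]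
      by (auto simp: l_def arrow_triangle_def sg_def)
  qed
  have 2: "isotopic (reverse_strands J (lreal (columns 3) l')) (?T (0 \<in> J) (1 \<in> J) (2 \<in> J))"
  proof (rule isotopic_same_strandsI)
    show "strands (reverse_strands J (lreal (columns 3) l')) = strands (?T (0 \<in> J) (1 \<in> J) (2 \<in> J))"
      unfolding strands_reverse_columns unfolding upt by (simp add: l'_def arrow_triangle_def)
    fix a assume "a \<in> arrows (reverse_strands J (lreal (columns 3) l'))"
    then have "a \<in> fst ` set l'" using arrows_lreal_subset[of "columns 3" l'] by auto
    then show "sign (reverse_strands J (lreal (columns 3) l')) a = sign (?T (0 \<in> J) (1 \<in> J) (2 \<in> J)) a"
      using sign_reverse_columns[of l' 0 0 1 True 3 J] sign_reverse_columns[of l' 1 0 2 True 3 J]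
        sign_reverse_columns[of l' 2 1 2 True 3 J]
      by (auto simp: l'_def arrow_triangle_def sg_def)
  qed
  \<comment> \<open>The orders forced by the signs are those of \<open>w\<close> or those of \<open>w'\<close>, depending on the parity of the
    number of reversed strands.\<close>
  have 3: "RII_RIII 3 (?T (0 \<notin> J) (1 \<notin> J) (2 \<notin> J)) (?T (0 \<in> J) (1 \<in> J) (2 \<in> J))"
  proof -
    have s: "sg i j = 1 \<or> sg i j = -1" for i j by (simp add: sg_def)
    have eqs: "sg 0 1 = sg 0 2 \<longleftrightarrow> (1 \<in> J \<longleftrightarrow> 2 \<in> J)" "sg 0 1 = sg 1 2 \<longleftrightarrow> (0 \<in> J \<longleftrightarrow> 2 \<in> J)"
      "sg 0 2 = sg 1 2 \<longleftrightarrow> (0 \<in> J \<longleftrightarrow> 1 \<in> J)" by (simp_all add: sg_def)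
    show ?thesis
    proof (cases "(0 \<in> J) = ((1 \<in> J) = (2 \<in> J))")
      case True
      then have "(0 \<in> J) = (sg 0 1 = sg 0 2)" "(1 \<in> J) = (sg 0 1 = sg 1 2)" "(2 \<in> J) = (sg 0 2 = sg 1 2)"
        unfolding eqs by argo+
      then show ?thesis by (rule generated_equiv_sym[OF triangle_all[OF s s s]])
    next
      case False
      then have "(0 \<notin> J) = (sg 0 1 = sg 0 2)" "(1 \<notin> J) = (sg 0 1 = sg 1 2)" "(2 \<notin> J) = (sg 0 2 = sg 1 2)"
        unfolding eqs by argo+
      then have "RII_RIII 3 (?T (0 \<notin> J) (1 \<notin> J) (2 \<notin> J)) (?T (\<not> 0 \<notin> J) (\<not> 1 \<notin> J) (\<not> 2 \<notin> J))"
        by (rule triangle_all[OF s s s])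
      then show ?thesis by (simp only: not_not)
    qed
  qed
  have w: "w \<in> pv_words 3" "w' \<in> pv_words 3" using assms by simp_all
  have gd: "reverse_strands J (word_diagram 3 w) \<in> gauss_diagrams 3" "reverse_strands J (word_diagram 3 w') \<in> gauss_diagrams 3"
    using w by (simp_all add: reverse_strands_gauss_diagrams word_diagram_gauss_diagrams)
  have i1: "isotopic (reverse_strands J (word_diagram 3 w)) (?T (0 \<notin> J) (1 \<notin> J) (2 \<notin> J))"
    using isotopic_trans[OF isotopic_reverse_strands[OF isotopic_word_diagram_lreal word_diagram_gauss_diagrams] 1]
      w(1) assms(1) by (simp add: l_def)
  have i2: "isotopic (reverse_strands J (word_diagram 3 w')) (?T (0 \<in> J) (1 \<in> J) (2 \<in> J))"
    using isotopic_trans[OF isotopic_reverse_strands[OF isotopic_word_diagram_lreal word_diagram_gauss_diagrams] 2]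
      w(2) assms(2) by (simp add: l'_def)
  have "RII_RIII 3 (reverse_strands J (word_diagram 3 w)) (?T (0 \<notin> J) (1 \<notin> J) (2 \<notin> J))"
    using generated_equivI[OF gd(1) isotopic_gauss_diagrams[OF i1 gd(1)]] i1 by blast
  also note 3
  also have "RII_RIII 3 (?T (0 \<in> J) (1 \<in> J) (2 \<in> J)) (reverse_strands J (word_diagram 3 w'))"
    using generated_equiv_sym[OF generated_equivI[OF gd(2) isotopic_gauss_diagrams[OF i2 gd(2)]]] i2 by blast
  finally show ?thesis .
qed

lemma slot_ends_relabel:
  assumes "inj_on \<sigma> A" "r \<in> A" "\<And>q a b p. (q, a, b, p) \<in> set w \<Longrightarrow> a \<in> A \<and> b \<in> A"
  shows "slot_ends (\<sigma> r) (map (map_prod f (map_letter \<sigma>)) w) = map (map_endpoint f) (slot_ends r w)"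
  using assms(3)
proof (induction w)
  case (Cons z w)
  obtain q a b p where z: "z = (q, a, b, p)" by (cases z)
  have "a \<in> A" "b \<in> A" using Cons.prems[of q a b p] z by auto
  then have "\<sigma> r = \<sigma> a \<longleftrightarrow> r = a" "\<sigma> r = \<sigma> b \<longleftrightarrow> r = b" using assms(1,2) by (auto dest: inj_onD)
  then show ?case using Cons z by auto
qed simp

lemma slot_ends_relabel_outside:
  assumes "s \<notin> \<sigma> ` A" "\<And>q a b p. (q, a, b, p) \<in> set w \<Longrightarrow> a \<in> A \<and> b \<in> A"
  shows "slot_ends s (map (map_prod f (map_letter \<sigma>)) w) = []"
  using assms(2)
proof (induction w)
  case (Cons z w)
  obtain q a b p where z: "z = (q, a, b, p)" by (cases z)
  have "a \<in> A" "b \<in> A" using Cons.prems[of q a b p] z by auto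
  then have "s \<noteq> \<sigma> a" "s \<noteq> \<sigma> b" using assms(1) by auto
  then show ?case using Cons z by auto
qed simp

text \<open>
  A subword on three strands of a larger word is attached to the rest: the slots sit on the strands
  where the two remaining parts of the word meet.
\<close>

lemma reverse_word_attach:
  assumes uv: "u \<in> pv_words m" "v \<in> pv_words m" and idx: "i < m" "j < m" "l < m" "distinct [i, j, l]"
    and K: "K = {r. r < 3 \<and> [i, j, l] ! r \<in> J}"
  obtains D e where "D \<in> gauss_diagrams m" "embedding 3 D e" "unreversed e"
    "\<And>t. t \<in> pv_words 3 \<Longrightarrow> isotopic (reverse_strands J (word_diagram m (u @ map (map_letter ((!) [i, j, l])) t @ v)))
       (attach_nat D (reverse_strands K (word_diagram 3 t)) e)"
proof -
  define n where "n = length u"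
  define lu lv where "lu = zip [0..<n] u" and "lv = zip [n..<n + length v] v"
  have fst_uv: "map fst lu = [0..<n]" "map fst lv = [n..<n + length v]" and snd_uv: "map snd lu = u" "map snd lv = v"
    by (simp_all add: lu_def lv_def n_def)
  have d_uv: "distinct (map fst (lu @ lv))" using fst_uv by auto
  have letters: "a < m \<and> b < m \<and> a \<noteq> b" if "(q, a, b, p) \<in> set (lu @ lv)" for q a b p
    using uv that by (auto simp: lu_def lv_def pv_words_iff dest!: set_zip_rightD)
  define \<sigma> where "\<sigma> = (!) [i, j, l]"
  have sig: "\<sigma> 0 = i" "\<sigma> 1 = j" "\<sigma> 2 = l" by (simp_all add: \<sigma>_def)
  have three: "{..<3} = {0, 1, 2 :: nat}" by auto
  have inj: "inj_on \<sigma> {..<3}" unfolding three using idx(4) by (auto simp: inj_on_def \<sigma>_def)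
  have sig_less: "\<sigma> r < m" if "r < 3" for r
  proof -
    have "r = 0 \<or> r = 1 \<or> r = 2" using that by arith
    then show ?thesis using idx sig by metis
  qed
  define D where "D = reverse_strands J (lreal (columns m) (lu @ lv))"
  define slot :: "nat \<Rightarrow> nat item list" where
    "slot s = (if s = i then [Slot 0 False] else if s = j then [Slot 1 False] else if s = l then [Slot 2 False] else [])" for s
  define e where "e = map (\<lambda>s. if s \<in> J then map Old (rev (slot_ends s lv)) @ slot s @ map Old (rev (slot_ends s lu))
      else map Old (slot_ends s lu) @ slot s @ map Old (slot_ends s lv)) [0..<m]"
  have D: "D \<in> gauss_diagrams m"
    using lreal_gauss_diagrams[of "columns m" "lu @ lv"] d_uv placed_word_diagram[of "u @ v" m] uv
    unfolding D_def by (intro reverse_strands_gauss_diagrams) (simp add: snd_uv)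
  have strands_D: "strands D = map (\<lambda>s. if s \<in> J then rev (slot_ends s (lu @ lv)) else slot_ends s (lu @ lv)) [0..<m]"
    unfolding D_def by (rule strands_reverse_columns)
  have unrev: "unreversed e" by (auto simp: unreversed_def e_def slot_def)
  have old: "concat (map old_part (map Old xs)) = xs" "concat (map old_part (slot s)) = []"
    "concat (map slot_part (map Old xs)) = []" for xs :: "nat endpoint list" and s
    by (induction xs) (auto simp: slot_def)
  have emb: "embedding 3 D e" unfolding embedding_def
  proof (intro conjI)
    show "map (\<lambda>s. concat (map old_part s)) e = strands D"
      unfolding strands_D e_def map_map comp_def by (intro map_cong[OF refl]) (simp add: old del: map_map)
    have slots: "concat (map slot_part (concat e)) = concat (map (\<lambda>s. concat (map slot_part (slot s))) [0..<m])"
      unfolding concat_map_concat[symmetric] e_def map_map comp_def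
      by (rule arg_cong[of _ _ concat], rule map_cong[OF refl]) (simp add: old del: map_map)
    show "distinct (concat (map slot_part (concat e)))" unfolding slots
      by (rule distinct_concat_map) (auto simp: slot_def)
    show "set (concat (map slot_part (concat e))) = {..<3}" unfolding slots three
    proof
      show "set (concat (map (\<lambda>s. concat (map slot_part (slot s))) [0..<m])) \<subseteq> {0, 1, 2}"
        by (auto simp: slot_def split: if_splits)
      have "set (concat (map slot_part (slot s))) \<subseteq> set (concat (map (\<lambda>s. concat (map slot_part (slot s))) [0..<m]))"
        if "s < m" for s using that by auto
      from this[OF idx(1)] this[OF idx(2)] this[OF idx(3)]
      show "{0, 1, 2} \<subseteq> set (concat (map (\<lambda>s. concat (map slot_part (slot s))) [0..<m]))"
        using idx(4) by (simp add: slot_def del: set_concat)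
    qed
  qed
  have "isotopic (reverse_strands J (word_diagram m (u @ map (map_letter \<sigma>) t @ v)))
       (attach_nat D (reverse_strands K (word_diagram 3 t)) e)" if t: "t \<in> pv_words 3" for t
  proof -
    define lt where "lt = zip [0..<length t] t"
    have lt: "map fst lt = [0..<length t]" "map snd lt = t" by (simp_all add: lt_def)
    have t_letters: "a < 3 \<and> b < 3 \<and> a \<noteq> b" if "(q, a, b, p) \<in> set lt" for q a b p
      using t that by (auto simp: lt_def pv_words_iff dest!: set_zip_rightD)
    define E where "E = reverse_strands K (lreal (columns 3) lt)"
    define lt' :: "(nat + nat) lword" where "lt' = map (map_prod Inr (map_letter \<sigma>)) lt"
    define W :: "(nat + nat) lword" where
      "W = map (map_prod Inl id) lu @ lt' @ map (map_prod Inl id) lv"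
    have dW: "distinct (map fst W)"
    proof -
      have "map fst W = map Inl [0..<n] @ map Inr [0..<length t] @ map Inl [n..<n + length v]"
        unfolding fst_uv[symmetric] lt(1)[symmetric] by (simp add: W_def lt'_def comp_def)
      then show ?thesis by (auto simp: distinct_map)
    qed
    have snd_W: "map snd W = u @ map (map_letter \<sigma>) t @ v"
      unfolding snd_uv[symmetric] lt(2)[symmetric] by (simp add: W_def lt'_def comp_def)
    have words: "u @ map (map_letter \<sigma>) t @ v \<in> pv_words m"
    proof -
      have "map (map_letter \<sigma>) t \<in> pv_words m"
        using t sig_less inj by (fastforce simp: pv_words_iff dest: inj_onD)
      then show ?thesis using uv by simp
    qed
    have inl: "slot_ends s (map (map_prod Inl id) w) = map (map_endpoint Inl) (slot_ends s w)" for s and w :: "nat lword"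
      by (induction w) auto
    have "isotopic (reverse_strands J (word_diagram m (u @ map (map_letter \<sigma>) t @ v))) (reverse_strands J (lreal (columns m) W))"
      using isotopic_reverse_strands[OF isotopic_word_diagram_lreal[OF dW snd_W] word_diagram_gauss_diagrams[OF words]] .
    also have "isotopic \<dots> (attach D E e)"
    proof (rule isotopic_same_strandsI)
      have strands_E: "strands E ! r = (if r \<in> K then rev (slot_ends r lt) else slot_ends r lt)" if "r < 3" for r
        using that by (simp add: E_def strands_reverse_columns del: upt_rec_numeral)
      have mid: "(if s \<in> J then rev (slot_ends s lt') else slot_ends s lt') = concat (map (fill E) (slot s))" for s
      proof (cases "s \<in> \<sigma> ` {..<3}")
        case True
        then obtain r where r: "r < 3" "s = \<sigma> r" by auto
        have "r = 0 \<or> r = 1 \<or> r = 2" using r(1) by arith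
        then have "slot s = [Slot r False]"
          using r(2) idx(4) sig by (elim disjE) (simp_all add: slot_def)
        moreover have "r \<in> K \<longleftrightarrow> s \<in> J" using r by (simp add: K \<sigma>_def)
        moreover have "slot_ends s lt' = map (map_endpoint Inr) (slot_ends r lt)"
          unfolding r(2) lt'_def using r(1) t_letters by (intro slot_ends_relabel[OF inj]) auto
        ultimately show ?thesis using strands_E[OF r(1)] by (simp add: rev_map)
      next
        case False
        then have "slot s = []" using sig by (auto simp: slot_def three)
        then show ?thesis using slot_ends_relabel_outside[OF False, of lt Inr] t_letters by (simp add: lt'_def)
      qed
      show "strands (reverse_strands J (lreal (columns m) W)) = strands (attach D E e)"
        unfolding strands_reverse_columns unreversed_attach[OF unrev] gauss_diagram.sel unfolding e_def map_map
      proof (rule map_cong[OF refl])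
        fix s
        have "concat (map (fill E) (map Old xs)) = map (map_endpoint Inl) xs" for xs :: "nat endpoint list"
          by (induction xs) auto
        then show "(if s \<in> J then rev (slot_ends s W) else slot_ends s W) = ((\<lambda>s. concat (map (fill E) s)) \<circ>
            (\<lambda>s. if s \<in> J then map Old (rev (slot_ends s lv)) @ slot s @ map Old (rev (slot_ends s lu))
              else map Old (slot_ends s lu) @ slot s @ map Old (slot_ends s lv))) s"
          using mid[of s] by (auto simp: W_def inl rev_map simp del: map_map split: if_splits)
      qed
      fix a assume "a \<in> arrows (reverse_strands J (lreal (columns m) W))"
      then have "a \<in> fst ` set W" using arrows_lreal_subset[of "columns m" W] by auto
      then obtain z where z: "z \<in> set W" "a = fst z" by blast
      have set_W: "set W = map_prod Inl id ` set (lu @ lv) \<union> map_prod Inr (map_letter \<sigma>) ` set lt"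
        unfolding W_def lt'_def set_append set_map image_Un by blast
      show "sign (reverse_strands J (lreal (columns m) W)) a = sign (attach D E e) a"
      proof (cases "z \<in> map_prod Inl id ` set (lu @ lv)")
        case True
        then obtain y' where y': "z = map_prod Inl id y'" "y' \<in> set (lu @ lv)" by (rule imageE)
        obtain q x y p where q: "y' = (q, x, y, p)" by (cases y')
        have z': "z = (Inl q, x, y, p)" using y'(1) q by simp
        have 1: "(q, x, y, p) \<in> set (lu @ lv)" "a = Inl q" "(a, x, y, p) \<in> set W"
          using y'(2) z unfolding q z' fst_conv by blast+
        then show ?thesis
          using letters[OF 1(1)] sign_reverse_columns[OF dW 1(3), of m J] sign_reverse_columns[OF d_uv 1(1), of m J]
          by (simp add: D_def)
      next
        case False
        then have "z \<in> map_prod Inr (map_letter \<sigma>) ` set lt" using z(1) unfolding set_W by simp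
        then obtain y' where y': "z = map_prod Inr (map_letter \<sigma>) y'" "y' \<in> set lt" by (rule imageE)
        obtain q x y p where q: "y' = (q, x, y, p)" by (cases y')
        have z': "z = (Inr q, \<sigma> x, \<sigma> y, p)" using y'(1) q by simp
        have 2: "(q, x, y, p) \<in> set lt" "a = Inr q" "(a, \<sigma> x, \<sigma> y, p) \<in> set W"
          using y'(2) z unfolding q z' fst_conv by blast+
        have xy: "x < 3" "y < 3" "x \<noteq> y" using t_letters[OF 2(1)] by auto
        then have "\<sigma> x \<noteq> \<sigma> y" using inj by (auto dest: inj_onD)
        moreover have "x \<in> K \<longleftrightarrow> \<sigma> x \<in> J" "y \<in> K \<longleftrightarrow> \<sigma> y \<in> J" using xy by (simp_all add: K \<sigma>_def)
        moreover have "distinct (map fst lt)" using lt by simp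
        ultimately show ?thesis
          using sign_reverse_columns[OF dW 2(3), of m J] sign_reverse_columns[OF _ 2(1), of 3 K] xy sig_less 2(2) unrev
          by (simp add: E_def)
      qed
    qed
    also have "isotopic \<dots> (attach D (reverse_strands K (word_diagram 3 t)) e)"
    proof -
      have iso: "isotopic E (reverse_strands K (word_diagram 3 t))"
        using isotopic_sym[OF isotopic_reverse_strands[OF isotopic_word_diagram_lreal[of lt t 3] word_diagram_gauss_diagrams[OF t]]]
          lt by (simp add: E_def)
      have "E \<in> gauss_diagrams 3"
        using isotopic_gauss_diagrams[OF isotopic_sym[OF iso] reverse_strands_gauss_diagrams[OF word_diagram_gauss_diagrams[OF t]]] .
      then show ?thesis by (rule isotopic_attach_right[OF emb unrev D iso])
    qed
    also have "isotopic \<dots> (attach_nat D (reverse_strands K (word_diagram 3 t)) e)" by (rule isotopic_attach_nat)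
    finally show ?thesis .
  qed
  then show thesis using that[OF D emb unrev] unfolding \<sigma>_def by blast
qed

text \<open>The sign and the order conventions for reversed strands are compatible with the relations.\<close>

lemma pv_step_reverse:
  assumes "pv_step m u v"
  shows "RII_RIII m (reverse_strands J (word_diagram m u)) (reverse_strands J (word_diagram m v))"
  using assms
proof cases
  case (cancel x y i j p)
  have w: "u \<in> pv_words m" "v \<in> pv_words m" using cancel by simp_all
  have len: "length (columns m) = m" by simp
  have "generated_equiv m RII (word_diagram m u) (realise (columns m) u)"
    using isotopic_word_diagram word_diagram_gauss_diagrams[OF w(1)] realise_gauss_diagrams[OF placed_word_diagram[OF w(1)]]
    by (intro generated_equivI) simp_all
  also have "generated_equiv m RII \<dots> (realise (columns m) v)"
    using RII_realise[of "columns m" x i j p y] placed_word_diagram[OF w(1)] cancel by simp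
  also have "generated_equiv m RII \<dots> (word_diagram m v)"
    using isotopic_sym[OF isotopic_word_diagram] word_diagram_gauss_diagrams[OF w(2)] realise_gauss_diagrams[OF placed_word_diagram[OF w(2)]]
    by (intro generated_equivI) simp_all
  finally have "generated_equiv m RII (reverse_strands J (word_diagram m u)) (reverse_strands J (word_diagram m v))"
    by (rule generated_equiv_RII_reverse_strands)
  then show ?thesis by (rule generated_equiv_mono) (auto intro: generated_equivI)
next
  case (commute x y i j l p)
  have w: "u \<in> pv_words m" "v \<in> pv_words m" using commute by simp_all
  obtain n where n: "length x + 1 < n" by blast
  define lx ly where "lx = zip [0..<length x] x" and "ly = zip [n..<n + length y] y"
  have fsts: "map fst lx = [0..<length x]" "map fst ly = [n..<n + length y]"
    and snds: "map snd lx = x" "map snd ly = y"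
    by (simp_all add: lx_def ly_def)
  have "isotopic (realise (columns m) u) (realise (columns m) v)"
  proof (rule isotopic_realiseI)
    show "strands (lreal (columns m) (lx @ [(length x, i, j, True), (length x + 1, l, p, True)] @ ly)) =
      strands (lreal (columns m) (lx @ [(length x + 1, l, p, True), (length x, i, j, True)] @ ly))"
      using commute by (intro strands_lreal_cong) auto
  qed (use fsts snds commute n in auto)
  then have "isotopic (word_diagram m u) (word_diagram m v)"
    using isotopic_trans[OF isotopic_word_diagram isotopic_trans[OF _ isotopic_sym[OF isotopic_word_diagram]]] by blast
  from isotopic_reverse_strands[OF this word_diagram_gauss_diagrams[OF w(1)], of J] show ?thesis
    using w by (intro generated_equivI) (simp_all add: reverse_strands_gauss_diagrams word_diagram_gauss_diagrams)
next
  case (triple x y i j l)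
  have w: "u \<in> pv_words m" "v \<in> pv_words m" using triple by simp_all
  define t t' :: pv_word where "t = [(0, 1, True), (0, 2, True), (1, 2, True)]" and "t' = [(1, 2, True), (0, 2, True), (0, 1, True)]"
  have u: "u = x @ map (map_letter ((!) [i, j, l])) t @ y" and v: "v = x @ map (map_letter ((!) [i, j, l])) t' @ y"
    using triple by (simp_all add: t_def t'_def)
  define K where "K = {r. r < 3 \<and> [i, j, l] ! r \<in> J}"
  obtain D e where D: "D \<in> gauss_diagrams m" "embedding 3 D e" "unreversed e"
    and iso: "\<And>t. t \<in> pv_words 3 \<Longrightarrow> isotopic (reverse_strands J (word_diagram m (x @ map (map_letter ((!) [i, j, l])) t @ y)))
       (attach_nat D (reverse_strands K (word_diagram 3 t)) e)"
    using reverse_word_attach[OF triple(3-8) K_def] by blast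
  have t: "t \<in> pv_words 3" "t' \<in> pv_words 3" by (simp_all add: t_def t'_def)
  have gd: "reverse_strands J (word_diagram m u) \<in> gauss_diagrams m" "reverse_strands J (word_diagram m v) \<in> gauss_diagrams m"
    using w by (simp_all add: reverse_strands_gauss_diagrams word_diagram_gauss_diagrams)
  have i: "isotopic (reverse_strands J (word_diagram m u)) (attach_nat D (reverse_strands K (word_diagram 3 t)) e)"
    "isotopic (reverse_strands J (word_diagram m v)) (attach_nat D (reverse_strands K (word_diagram 3 t')) e)"
    using iso t unfolding u v by blast+
  have "RII_RIII m (reverse_strands J (word_diagram m u)) (attach_nat D (reverse_strands K (word_diagram 3 t)) e)"
    using generated_equivI[OF gd(1) isotopic_gauss_diagrams[OF i(1) gd(1)]] i(1) by blast
  also have "RII_RIII m \<dots> (attach_nat D (reverse_strands K (word_diagram 3 t')) e)"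
    using triple_reverse[OF t_def t'_def]
    by (rule generated_equiv_attach[OF D(2,3,1)]) (auto intro: RII_attach_nat[OF D(2,3,1)] RIII_attach_nat[OF D(2,3,1)])
  also have "RII_RIII m \<dots> (reverse_strands J (word_diagram m v))"
    using generated_equiv_sym[OF generated_equivI[OF gd(2) isotopic_gauss_diagrams[OF i(2) gd(2)]]] i(2) by blast
  finally show ?thesis .
qed

lemma pv_rel_reverse:
  assumes "(u, v) \<in> pv_rel m"
  shows "RII_RIII m (reverse_strands J (word_diagram m u)) (reverse_strands J (word_diagram m v))"
proof -
  have "equivclp (pv_step m) u v" using assms by (simp add: pv_rel_def)
  then show ?thesis
  proof (induction rule: equivclp_induct)
    case (step y z)
    have "RII_RIII m (reverse_strands J (word_diagram m y)) (reverse_strands J (word_diagram m z))"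
      using step.hyps(2)
    proof
      assume "pv_step m z y"
      then show ?thesis by (rule generated_equiv_sym[OF pv_step_reverse])
    qed (rule pv_step_reverse)
    with step.IH show ?case by (rule generated_equiv_trans)
  qed simp
qed

lemma attach_pv_rel:
  assumes "(u, v) \<in> pv_rel m" "embedding m D e" "D \<in> gauss_diagrams k"
  shows "RII_RIII k (attach_nat D (word_diagram m u) e) (attach_nat D (word_diagram m v) e)"
proof -
  let ?J = "{j. Slot j True \<in> set (concat e)}"
  have "RII_RIII k (attach_nat D (reverse_strands ?J (word_diagram m u)) (map_unreversed e))
      (attach_nat D (reverse_strands ?J (word_diagram m v)) (map_unreversed e))"
    using pv_rel_reverse[OF assms(1)]
    by (rule generated_equiv_attach[OF embedding_map_unreversed[OF assms(2)] unreversed_map_unreversed assms(3)])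
      (auto intro: RII_attach_nat[OF embedding_map_unreversed[OF assms(2)] unreversed_map_unreversed assms(3)]
        RIII_attach_nat[OF embedding_map_unreversed[OF assms(2)] unreversed_map_unreversed assms(3)])
  then show ?thesis
    unfolding attach_nat_def attach_reverse_strands[OF assms(2) word_diagram_strands, symmetric] .
qed

section \<open>From deep words to variations\<close>

text \<open>
  The class used by the move is not trivial, so there are at least two strands and the chosen word can
  be exchanged for a coloured one.
\<close>

lemma L_move_n_equivalent:
  assumes "L_move (Suc n) D D'" "D \<in> gauss_diagrams k" "D' \<in> gauss_diagrams k"
  shows "n_equivalent k n D D'"
proof -
  obtain m h w e where h: "m \<ge> 1" "h \<in> lower_central (PV m) (Suc n)" "h \<notin> lower_central (PV m) (Suc (Suc n))" "w \<in> h"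
    "embedding m D e" "isotopic (attach D (word_diagram m w) e) D'"
    using assms(1) unfolding L_move_def by blast
  interpret group "PV m" by (rule group_PV)
  have hw: "w \<in> pv_words m" "h = pv_class m w"
    using pv_class_of_member[OF lower_central_carrier[OF h(2)] h(4)] by blast+
  have "h \<noteq> \<one>\<^bsub>PV m\<^esub>" using h(3) subgroup.one_closed[OF lower_central_subgroup] by blast
  then have "w \<noteq> []" using hw(2) pv_class_Nil[of m] by auto
  then have m2: "2 \<le> m" using hw(1) by (cases w) auto
  obtain c where c: "coloured m (Suc n) c" "pv_class m (map snd c) = h"
    using lower_central_coloured[OF m2 h(2)] .
  let ?v = "map snd c"
  have v: "?v \<in> pv_words m" using c(1) by (simp add: coloured_def)
  have rel: "(?v, w) \<in> pv_rel m" using h(4) by (simp flip: c(2) add: pv_class_def)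
  have gd: "attach_nat D (word_diagram m ?v) e \<in> gauss_diagrams k" "attach_nat D (word_diagram m w) e \<in> gauss_diagrams k"
    using attach_nat_gauss_diagrams[OF h(5) assms(2)] word_diagram_gauss_diagrams v hw(1) by blast+
  have "variation (n + 1) D (attach_nat D (word_diagram m ?v) e)"
    unfolding variation_def add_diff_cancel_right'
    using word_diagram_gauss_diagrams[OF v] n_trivial_coloured[OF c(1)] h(5) isotopic_attach_nat
    by (intro exI[of _ m] exI[of _ "word_diagram m ?v"] exI[of _ e]) simp
  then have "n_equivalent k n D (attach_nat D (word_diagram m ?v) e)"
    unfolding n_equivalent_def using gd assms(2) by (intro generated_equivI) simp_all
  moreover have "n_equivalent k n (attach_nat D (word_diagram m ?v) e) (attach_nat D (word_diagram m w) e)"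
    unfolding n_equivalent_def using attach_pv_rel[OF rel h(5) assms(2)]
    by (rule generated_equiv_mono) (auto intro: generated_equivI simp: reidemeister_def)
  moreover have "isotopic (attach_nat D (word_diagram m w) e) D'"
    using isotopic_trans[OF isotopic_sym[OF isotopic_attach_nat] h(6)] .
  then have "n_equivalent k n (attach_nat D (word_diagram m w) e) D'"
    unfolding n_equivalent_def using gd assms(3) by (intro generated_equivI) simp_all
  ultimately show ?thesis unfolding n_equivalent_def using generated_equiv_trans by blast
qed

section \<open>Inserting deep words\<close>

abbreviation L_RII :: "nat \<Rightarrow> nat \<Rightarrow> nat gauss_diagram \<Rightarrow> nat gauss_diagram \<Rightarrow> bool" where
  "L_RII n k \<equiv> generated_equiv k (\<lambda>D E. L_move n D E \<or> RII D E)"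

lemma RII_imp_L_RII:
  assumes "generated_equiv k RII D E"
  shows "L_RII n k D E"
  using assms by (rule generated_equiv_mono) (auto intro: generated_equivI)

lemma L_RII_attach:
  assumes "embedding m D e" "unreversed e" "D \<in> gauss_diagrams k" "L_RII n m E E'"
  shows "L_RII n k (attach_nat D E e) (attach_nat D E' e)"
  using assms(4)
  by (rule generated_equiv_attach[OF assms(1-3)])
    (auto intro: RII_attach_nat[OF assms(1-3)] L_move_attach[OF assms(1-3)] word_diagram_gauss_diagrams)

lemma obtain_labels:
  fixes u v :: pv_word
  obtains lu lv :: "nat lword" where "map snd lu = u" "map snd lv = v" "distinct (map fst (lu @ lv))"
proof
  let ?n = "length u"
  show "map snd (zip [0..<?n] u) = u" by simp
  show "map snd (zip [?n..<?n + length v] v) = v" by simp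
  have "map fst (zip [?n..<?n + length v] v) = [?n..<?n + length v]" by simp
  then show "distinct (map fst (zip [0..<?n] u @ zip [?n..<?n + length v] v))" by auto
qed

lemma isotopic_realise_subst:
  fixes w w' :: "nat lword"
  assumes "\<And>j. j \<in> set (concat x) \<Longrightarrow> concat (map (\<lambda>i. slot_ends i w') (f j)) = slot_ends j w"
    and "distinct (map fst w)" "distinct (map fst w')"
    and "\<And>q i j p. (q, i, j, p) \<in> set w \<Longrightarrow> \<exists>i' j'. (q, i', j', p) \<in> set w'"
    and "u = map snd w" "u' = map snd w'" "x' = map (\<lambda>s. concat (map f s)) x"
  shows "isotopic (realise x u) (realise x' u')"
proof (rule isotopic_realiseI[OF _ assms(2-6)])
  have "concat (map (\<lambda>i. slot_ends i w') (f j)) = slot_ends j w" if "s \<in> set x" "j \<in> set s" for s j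
    using that by (intro assms(1)) auto
  then show "strands (lreal x w) = strands (lreal x' w')"
    unfolding assms(7) lreal_def by (simp add: comp_def concat_map_concat[symmetric] cong: map_cong)
qed

lemma map_eq_appendE:
  assumes "map f w = u @ v"
  obtains w1 w2 where "w = w1 @ w2" "map f w1 = u" "map f w2 = v"
proof
  show "w = take (length u) w @ drop (length u) w" by simp
  show "map f (take (length u) w) = u" "map f (drop (length u) w) = v"
    unfolding take_map[symmetric] drop_map[symmetric] assms by simp_all
qed

text \<open>
  Words with disjoint supports may be exchanged: no slot sees letters of both.
\<close>

lemma isotopic_realise_swap_blocks:
  assumes "support u \<inter> support v = {}"
  shows "isotopic (realise x (a @ u @ v @ b)) (realise x (a @ v @ u @ b))"
proof -
  obtain la l1 :: "nat lword" where 1: "map snd la = a" "map snd l1 = u @ v @ b" "distinct (map fst (la @ l1))"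
    using obtain_labels[of a "u @ v @ b"] .
  obtain lu l2 where 2: "l1 = lu @ l2" "map snd lu = u" "map snd l2 = v @ b"
    using map_eq_appendE[OF 1(2)] .
  obtain lv lb where 3: "l2 = lv @ lb" "map snd lv = v" "map snd lb = b"
    using map_eq_appendE[OF 2(3)] .
  show ?thesis
  proof (rule isotopic_realiseI)
    show "strands (lreal x (la @ lu @ lv @ lb)) = strands (lreal x (la @ lv @ lu @ lb))"
    proof (rule strands_lreal_cong)
      fix j
      have "slot_ends j lu = [] \<or> slot_ends j lv = []"
        using assms slot_ends_outside[of j lu] slot_ends_outside[of j lv] 2 3 by blast
      then show "slot_ends j (la @ lu @ lv @ lb) = slot_ends j (la @ lv @ lu @ lb)" by auto
    qed
  qed (use 1 2 3 in auto)
qed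

lemma support_map_letter: "support (map (map_letter \<sigma>) w) = \<sigma> ` support w"
  by (induction w) (auto simp: support_def)

lemma map_letter_cong: "(\<And>i. i \<in> support w \<Longrightarrow> \<sigma> i = \<tau> i) \<Longrightarrow> map (map_letter \<sigma>) w = map (map_letter \<tau>) w"
proof (induction w)
  case (Cons z w)
  obtain a b p where z: "z = (a, b, p)" by (cases z)
  have "map (map_letter \<sigma>) w = map (map_letter \<tau>) w" using Cons.prems z by (intro Cons.IH) simp
  moreover have "\<sigma> a = \<tau> a" "\<sigma> b = \<tau> b" using Cons.prems[of a] Cons.prems[of b] z by simp_all
  ultimately show ?case using z by simp
qed simp

lemma map_letter_id: "(\<And>i. i \<in> support w \<Longrightarrow> \<sigma> i = i) \<Longrightarrow> map (map_letter \<sigma>) w = w"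
proof -
  have "map_letter (\<lambda>x. x) = (\<lambda>x. x)" by auto
  then show "(\<And>i. i \<in> support w \<Longrightarrow> \<sigma> i = i) \<Longrightarrow> ?thesis" using map_letter_cong[of w \<sigma> "\<lambda>x. x"] by simp
qed

lemma support_inv_word [simp]: "support (inv_word w) = support w"
proof (induction w)
  case (Cons z w)
  then show ?case by (cases z) (simp add: Un_commute insert_commute)
qed simp

lemma support_less: "w \<in> pv_words m \<Longrightarrow> support w \<subseteq> {..<m}"
  by (auto simp: support_def pv_words_iff)

lemma finite_support [simp]: "finite (support w)"
  by (auto simp: support_def)

text \<open>
  A word on unused slots is attached at these slots.
\<close>

lemma L_move_realise:
  assumes h: "1 \<le> m" "h \<in> pv_words m" "pv_class m h \<in> lower_central (PV m) n" "pv_class m h \<notin> lower_central (PV m) (Suc n)"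
    and \<sigma>: "inj_on \<sigma> {..<m}" "\<sigma> ` {..<m} \<subseteq> set (concat x)" "support u \<inter> \<sigma> ` {..<m} = {}"
    and x: "placed x u"
  shows "L_move n (realise x u) (realise x (u @ map (map_letter \<sigma>) h))"
proof -
  let ?A = "\<sigma> ` {..<m}"
  define lu where "lu = zip [0..<length u] u"
  define lh where "lh = zip [0..<length h] h"
  have lu: "map fst lu = [0..<length u]" "map snd lu = u" and lh: "map fst lh = [0..<length h]" "map snd lh = h"
    by (simp_all add: lu_def lh_def)
  have real: "realise x u = lreal x lu" by (simp add: realise_def lu_def)
  have dx: "distinct (concat x)" using x by (simp add: placed_def)
  define \<rho> where "\<rho> = inv_into {..<m} \<sigma>"
  have \<rho>: "\<rho> (\<sigma> r) = r" if "r < m" for r using that \<sigma>(1) by (simp add: \<rho>_def)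
  define item where "item j = (if j \<in> ?A then [Slot (\<rho> j) False] else map Old (slot_ends j lu))" for j
  define e where "e = map (\<lambda>s. concat (map item s)) x"
  have empty: "slot_ends j lu = []" if "j \<in> ?A" for j
    using that \<sigma>(3) lu(2) by (intro slot_ends_outside) blast
  have old: "concat (map old_part (map Old xs)) = xs" "concat (map slot_part (map Old xs)) = []" for xs :: "nat endpoint list"
    by (induction xs) auto
  have old_item: "concat (map old_part (item j)) = slot_ends j lu" for j
    using empty by (simp add: item_def old del: map_map)
  have slot_item: "concat (map slot_part (item j)) = (if j \<in> ?A then [\<rho> j] else [])" for j
    by (simp add: item_def old del: map_map)
  have "concat (map old_part (concat (map item s))) = concat (map (\<lambda>j. slot_ends j lu) s)" for s
    by (induction s) (simp_all add: old_item)
  then have strands_e: "map (\<lambda>s. concat (map old_part s)) e = strands (realise x u)"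
    unfolding real lreal_def e_def by simp
  have "concat (map slot_part (concat (map item s))) = concat (map (\<lambda>j. if j \<in> ?A then [\<rho> j] else []) s)" for s
    by (induction s) (simp_all add: slot_item)
  moreover have "concat e = concat (map item (concat x))" by (simp add: e_def concat_map_concat)
  ultimately have slots: "concat (map slot_part (concat e)) = concat (map (\<lambda>j. if j \<in> ?A then [\<rho> j] else []) (concat x))"
    by simp
  have emb: "embedding m (realise x u) e" unfolding embedding_def
  proof (intro conjI strands_e)
    show "distinct (concat (map slot_part (concat e)))" unfolding slots
    proof (rule distinct_concat_map[OF dx])
      fix i j :: nat assume "i \<noteq> j"
      show "set (if i \<in> ?A then [\<rho> i] else []) \<inter> set (if j \<in> ?A then [\<rho> j] else []) = {}"
      proof (cases "i \<in> ?A \<and> j \<in> ?A")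
        case True
        then have "\<rho> i \<noteq> \<rho> j" using \<open>i \<noteq> j\<close> \<rho> by auto
        then show ?thesis by auto
      qed auto
    qed simp
    have "set (concat (map slot_part (concat e))) = \<rho> ` (?A \<inter> set (concat x))" unfolding slots by auto
    also have "\<dots> = \<rho> ` ?A" using \<sigma>(2) by (simp add: Int_absorb2)
    also have "\<dots> = {..<m}" unfolding image_image using \<rho> by simp
    finally show "set (concat (map slot_part (concat e))) = {..<m}" .
  qed
  have unrev: "unreversed e"
  proof -
    have "Slot j True \<notin> set (item i)" for i j by (auto simp: item_def)
    then show ?thesis by (auto simp: unreversed_def e_def)
  qed
  define W :: "(nat + nat) lword" where "W = map (map_prod Inl id) lu @ map (map_prod Inr (map_letter \<sigma>)) lh"
  have dW: "distinct (map fst W)"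
  proof -
    have "map fst W = map Inl [0..<length u] @ map Inr [0..<length h]"
      unfolding lu(1)[symmetric] lh(1)[symmetric] by (simp add: W_def comp_def)
    then show ?thesis by (auto simp: distinct_map)
  qed
  have snd_W: "map snd W = u @ map (map_letter \<sigma>) h"
    unfolding lu(2)[symmetric] lh(2)[symmetric] by (simp add: W_def comp_def)
  have inl: "slot_ends s (map (map_prod Inl id) w) = map (map_endpoint Inl) (slot_ends s w)" for s and w :: "nat lword"
    by (induction w) auto
  have lh_letters: "a \<in> {..<m} \<and> b \<in> {..<m}" if "(q, a, b, p) \<in> set lh" for q a b p
    using h(2) that by (auto simp: lh_def pv_words_iff dest!: set_zip_rightD)
  let ?E = "lreal (columns m) lh"
  have fill_item: "concat (map (fill ?E) (item j)) = slot_ends j W" for j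
  proof (cases "j \<in> ?A")
    case True
    then obtain r where r: "r < m" "j = \<sigma> r" by auto
    have "slot_ends j (map (map_prod Inr (map_letter \<sigma>)) lh) = (map (map_endpoint Inr) (slot_ends r lh) :: (nat + nat) endpoint list)"
      unfolding r(2) using r(1) lh_letters by (intro slot_ends_relabel[OF \<sigma>(1)]) auto
    moreover have "strands ?E ! r = slot_ends r lh" using r(1) by (simp add: strands_lreal_columns)
    ultimately show ?thesis using True \<rho>[OF r(1)] empty[OF True] r(2) by (simp add: item_def W_def inl)
  next
    case False
    have "concat (map (fill ?E) (map Old xs)) = map (map_endpoint Inl) xs" for xs :: "nat endpoint list"
      by (induction xs) auto
    moreover have "slot_ends j (map (map_prod Inr (map_letter \<sigma>)) lh) = ([] :: (nat + nat) endpoint list)"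
      using lh_letters by (intro slot_ends_relabel_outside[OF False]) auto
    ultimately show ?thesis using False by (simp add: item_def W_def inl del: map_map)
  qed
  have "isotopic (attach (realise x u) (word_diagram m h) e) (attach (realise x u) ?E e)"
    using lh by (intro isotopic_attach_right[OF emb unrev realise_gauss_diagrams[OF x]]
        isotopic_word_diagram_lreal word_diagram_gauss_diagrams[OF h(2)]) simp_all
  also have "isotopic \<dots> (lreal x W)"
  proof (rule isotopic_sym, rule isotopic_same_strandsI)
    have "concat (map (fill ?E) (concat (map item s))) = concat (map (\<lambda>j. slot_ends j W) s)" for s
      by (induction s) (simp_all add: fill_item)
    then show "strands (lreal x W) = strands (attach (realise x u) ?E e)"
      unfolding unreversed_attach[OF unrev] lreal_def by (simp add: e_def)
    fix a assume "a \<in> arrows (lreal x W)"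
    then have "a \<in> fst ` set W" using arrows_lreal_subset[of x W] by auto
    then obtain z where z: "z \<in> set W" "a = fst z" by blast
    have set_W: "set W = map_prod Inl id ` set lu \<union> map_prod Inr (map_letter \<sigma>) ` set lh"
      unfolding W_def set_append set_map by (rule refl)
    show "sign (lreal x W) a = sign (attach (realise x u) ?E e) a"
    proof (cases "z \<in> map_prod Inl id ` set lu")
      case True
      then obtain y' where y': "z = map_prod Inl id y'" "y' \<in> set lu" by (rule imageE)
      obtain q i j p where q: "y' = (q, i, j, p)" by (cases y')
      have z': "z = (Inl q, i, j, p)" using y'(1) q by simp
      have "sign (lreal x W) a = (if p then 1 else -1)" using sign_lreal[OF dW] z unfolding z' by simp
      moreover have "sign (realise x u) q = (if p then 1 else -1)"
        unfolding real using sign_lreal[of lu q i j p x] lu y'(2) q by simp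
      ultimately show ?thesis using z(2) z' by simp
    next
      case False
      then have "z \<in> map_prod Inr (map_letter \<sigma>) ` set lh" using z(1) unfolding set_W by simp
      then obtain y' where y': "z = map_prod Inr (map_letter \<sigma>) y'" "y' \<in> set lh" by (rule imageE)
      obtain q i j p where q: "y' = (q, i, j, p)" by (cases y')
      have z': "z = (Inr q, \<sigma> i, \<sigma> j, p)" using y'(1) q by simp
      have "sign (lreal x W) a = (if p then 1 else -1)" using sign_lreal[OF dW] z unfolding z' by simp
      moreover have "sign ?E q = (if p then 1 else -1)"
        using sign_lreal[of lh q i j p] lh y'(2) q by simp
      ultimately show ?thesis using z(2) z' unrev by simp
    qed
  qed
  also have "isotopic \<dots> (realise x (u @ map (map_letter \<sigma>) h))"
    using isotopic_realise_lreal[OF dW, of x] unfolding snd_W .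
  finally have "isotopic (attach (realise x u) (word_diagram m h) e) (realise x (u @ map (map_letter \<sigma>) h))" .
  then show ?thesis unfolding L_move_def using h pv_class_self[OF h(2)] emb by blast
qed

lemma isotopic_realise_double:
  assumes "placed x u" "placed x v" "set (concat x) \<subseteq> {..<K}"
  shows "isotopic (realise x (u @ v)) (realise (map (\<lambda>s. concat (map (\<lambda>r. [r, r + K]) s)) x) (u @ map (map_letter (\<lambda>r. r + K)) v))"
proof -
  obtain lu lv :: "nat lword" where l: "map snd lu = u" "map snd lv = v" "distinct (map fst (lu @ lv))"
    by (rule obtain_labels)
  define lv' where "lv' = map (map_prod id (map_letter (\<lambda>r. r + K))) lv"
  have fst': "map fst lv' = map fst lv" by (simp add: lv'_def)
  have snd': "map snd lv' = map (map_letter (\<lambda>r. r + K)) v" unfolding l(2)[symmetric] lv'_def by simp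
  show ?thesis
  proof (rule isotopic_realise_subst[where w = "lu @ lv" and w' = "lu @ lv'" and f = "\<lambda>r. [r, r + K]"])
    fix r assume r: "r \<in> set (concat x)"
    have "support u \<subseteq> {..<K}" using assms(1,3) unfolding placed_def by blast
    then have "r + K \<notin> support u" by auto
    then have "slot_ends (r + K) lu = []" using slot_ends_outside l(1) by blast
    moreover have "slot_ends r lv' = []"
      unfolding lv'_def using r assms(3) by (intro slot_ends_relabel_outside[of _ _ UNIV]) auto
    moreover have "slot_ends (r + K) lv' = slot_ends r lv"
      unfolding lv'_def using slot_ends_relabel[of "\<lambda>r. r + K" UNIV r lv id] by (simp add: endpoint.map_id0 inj_on_def)
    ultimately show "concat (map (\<lambda>i. slot_ends i (lu @ lv')) [r, r + K]) = slot_ends r (lu @ lv)" by simp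
  next
    fix q i j p assume "(q, i, j, p) \<in> set (lu @ lv)"
    then show "\<exists>i' j'. (q, i', j', p) \<in> set (lu @ lv')" by (force simp: lv'_def)
  next
    show "distinct (map fst (lu @ lv'))" using l(3) by (simp only: map_append fst')
  qed (use l snd' in simp_all)
qed

lemma generated_equiv_isotopic:
  assumes "isotopic D E" "D \<in> gauss_diagrams k"
  shows "generated_equiv k R D E"
  using generated_equivI[OF assms(2) isotopic_gauss_diagrams[OF assms]] assms(1) by blast

lemma L_RII_L_move:
  assumes "L_move n (realise x u) (realise x v)" "placed x u" "placed x v"
  shows "L_RII n (length x) (realise x u) (realise x v)"
  by (rule generated_equivI[OF realise_gauss_diagrams[OF assms(2)] realise_gauss_diagrams[OF assms(3)]])
    (simp add: assms(1))

text \<open>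
  A deep word may be deeper than the moves allow. It is then inserted together with a word \<open>g\<close> that is
  not, and \<open>g\<close> is removed again by inserting its inverse.
\<close>

lemma insert_deep_word:
  assumes n: "1 \<le> n" and deep: "depth_ge n h" and placed: "placed x (u @ h)" and disj: "support u \<inter> support h = {}"
  shows "L_RII n (length x) (realise x u) (realise x (u @ h))"
proof (cases h)
  case Nil
  then show ?thesis by simp
next
  case (Cons z h')
  obtain i j p where h: "h = (i, j, p) # h'" using Cons by (cases z) auto
  obtain M where M: "h \<in> pv_words M" "pv_class M h \<in> lower_central (PV M) n"
    using depth_ge_obtain[OF deep, of 0] by blast
  interpret group "PV M" by (rule group_PV)
  have ij: "i < M" "j < M" "i \<noteq> j" using M(1) h by simp_all
  have M1: "1 \<le> M" using ij(1) by simp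
  have supp_h: "support h \<subseteq> {..<M}" using M(1) by (rule support_less)
  have px: "placed x u" "placed x h" using placed by simp_all
  have dx: "distinct (concat x)" and supp_x: "support u \<subseteq> set (concat x)" "support h \<subseteq> set (concat x)"
    using px by (simp_all add: placed_def)
  have "x \<noteq> []" using supp_x(2) h by auto
  then obtain s xs where x: "x = s # xs" by (cases x) auto
  obtain K where "\<forall>r\<in>set (concat x) \<union> {..<M}. r < K"
    using finite_nat_set_iff_bounded[of "set (concat x) \<union> {..<M}"] by auto
  then have K: "r < K" if "r \<in> set (concat x)" for r using that by blast
  \<comment> \<open>The strands of the ambient group that \<open>h\<close> does not meet get fresh slots at the end of a strand.\<close>
  define F where "F = map (\<lambda>r. r + K) (filter (\<lambda>r. r \<notin> support h) [0..<M])"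
  define x1 where "x1 = (s @ F) # xs"
  define \<sigma> where "\<sigma> r = (if r \<in> support h then r else r + K)" for r
  have len1: "length x1 = length x" by (simp add: x1_def x)
  have set_x1: "set (concat x1) = set (concat x) \<union> set F" by (auto simp: x1_def x)
  have F: "K \<le> r" if "r \<in> set F" for r using that by (auto simp: F_def)
  have dx1: "distinct (concat x1)"
  proof -
    have "set s \<subseteq> set (concat x)" "set (concat xs) \<subseteq> set (concat x)" by (simp_all add: x)
    then have "set F \<inter> (set s \<union> set (concat xs)) = {}" using F K by force
    moreover have "distinct F" by (simp add: F_def distinct_map inj_on_def)
    ultimately show ?thesis using dx by (auto simp: x1_def x)
  qed
  have to_x1: "isotopic (realise x w) (realise x1 w)" if "support w \<subseteq> set (concat x)" for w
  proof (rule isotopic_realiseI[of _ "zip [0..<length w] w" _ "zip [0..<length w] w"])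
    have "slot_ends r (zip [0..<length w] w) = []" if "r \<in> set F" for r
      using F[OF that] K \<open>support w \<subseteq> set (concat x)\<close> by (intro slot_ends_outside) force
    then have "concat (map (\<lambda>j. slot_ends j (zip [0..<length w] w)) F) = []" by simp
    then show "strands (lreal x (zip [0..<length w] w)) = strands (lreal x1 (zip [0..<length w] w))"
      by (simp add: lreal_def x x1_def)
  qed auto
  have placed1: "placed x1 w" if "placed x w" for w using that dx1 set_x1 by (auto simp: placed_def)
  have inj: "inj_on \<sigma> {..<M}"
  proof (rule inj_onI)
    fix a b assume "\<sigma> a = \<sigma> b"
    moreover have "r < K" if "r \<in> support h" for r using that supp_x(2) K by blast
    ultimately show "a = b" by (auto simp: \<sigma>_def split: if_splits)
  qed
  have im: "\<sigma> ` {..<M} \<subseteq> set (concat x1)"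
    unfolding set_x1 using supp_x(2) by (auto simp: \<sigma>_def F_def simp del: set_concat)
  have disj1: "support u \<inter> \<sigma> ` {..<M} = {}"
  proof -
    have "a \<noteq> \<sigma> b" if "a \<in> support u" for a b
      using that disj supp_x(1) K[of a] by (auto simp: \<sigma>_def simp del: set_concat)
    then show ?thesis by blast
  qed
  have fix_h: "map (map_letter \<sigma>) w = w" if "support w \<subseteq> support h" for w
    using that by (intro map_letter_id) (auto simp: \<sigma>_def)
  have "L_RII n (length x1) (realise x1 u) (realise x1 (u @ h))"
  proof (cases "pv_class M h \<in> lower_central (PV M) (Suc n)")
    case False
    have "L_move n (realise x1 u) (realise x1 (u @ map (map_letter \<sigma>) h))"
      by (rule L_move_realise[OF M1 M(1,2) False inj im disj1 placed1[OF px(1)]])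
    then show ?thesis using L_RII_L_move[of n x1 u "u @ h"] placed1 px fix_h[of h] by simp
  next
    case True
    define g where "g = engel_word i j (n - 1)"
    have g: "g \<in> pv_words M" "pv_class M g \<in> lower_central (PV M) n" "pv_class M g \<notin> lower_central (PV M) (Suc n)"
      using engel_word_pv_words[OF ij] engel_word_depth[OF ij, of "n - 1"] engel_word_not_deeper[OF ij, of "n - 1"] n
      by (simp_all add: g_def)
    have supp_g: "support g \<subseteq> support h"
      using engel_word_letters[of i j "n - 1"] h by (force simp: g_def support_def)
    have placed_g: "placed x g" "placed x (inv_word g)"
    proof -
      have ne: "\<forall>(a, b, c)\<in>set w. a \<noteq> b" if "w \<in> pv_words M" for w using that by (auto simp: pv_words_iff)
      have "inv_word g \<in> pv_words M" using g(1) by simp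
      then show "placed x g" "placed x (inv_word g)"
        unfolding placed_def support_inv_word using dx order_trans[OF supp_g supp_x(2)] ne[OF g(1)] ne
        by (intro conjI; assumption?; blast)+
    qed
    have cg: "pv_class M g \<in> carrier (PV M)" and ch: "pv_class M h \<in> carrier (PV M)" using g(1) M(1) by simp_all
    have hg: "pv_class M (h @ g) \<in> lower_central (PV M) n" "pv_class M (h @ g) \<notin> lower_central (PV M) (Suc n)"
    proof -
      have eq: "pv_class M (h @ g) = pv_class M h \<otimes>\<^bsub>PV M\<^esub> pv_class M g"
        using g(1) M(1) by (simp add: pv_class_append)
      show "pv_class M (h @ g) \<in> lower_central (PV M) n"
        unfolding eq using subgroup.m_closed[OF lower_central_subgroup M(2) g(2)] .
      show "pv_class M (h @ g) \<notin> lower_central (PV M) (Suc n)"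
      proof
        assume "pv_class M (h @ g) \<in> lower_central (PV M) (Suc n)"
        then have "inv\<^bsub>PV M\<^esub> pv_class M h \<otimes>\<^bsub>PV M\<^esub> (pv_class M h \<otimes>\<^bsub>PV M\<^esub> pv_class M g) \<in> lower_central (PV M) (Suc n)"
          unfolding eq
          using subgroup.m_closed[OF lower_central_subgroup subgroup.m_inv_closed[OF lower_central_subgroup True]] by blast
        then show False using g(3) inv_cancel_left(1)[OF ch cg] by simp
      qed
    qed
    have ig: "inv_word g \<in> pv_words M" "pv_class M (inv_word g) \<in> lower_central (PV M) n"
      "pv_class M (inv_word g) \<notin> lower_central (PV M) (Suc n)"
    proof -
      have eq: "pv_class M (inv_word g) = inv\<^bsub>PV M\<^esub> pv_class M g" using g(1) by (simp add: pv_class_inv_word)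
      show "inv_word g \<in> pv_words M" using g(1) by simp
      show "pv_class M (inv_word g) \<in> lower_central (PV M) n"
        unfolding eq by (rule subgroup.m_inv_closed[OF lower_central_subgroup g(2)])
      show "pv_class M (inv_word g) \<notin> lower_central (PV M) (Suc n)"
        unfolding eq using subgroup.m_inv_closed[OF lower_central_subgroup, of "inv\<^bsub>PV M\<^esub> pv_class M g" "Suc n"] g(3) cg by auto
    qed
    have step1: "L_RII n (length x1) (realise x1 u) (realise x1 (u @ h @ g))"
    proof (rule L_RII_L_move)
      have "L_move n (realise x1 u) (realise x1 (u @ map (map_letter \<sigma>) (h @ g)))"
        using M(1) g(1) by (intro L_move_realise[OF M1 _ hg inj im disj1 placed1[OF px(1)]]) simp
      then show "L_move n (realise x1 u) (realise x1 (u @ h @ g))" using fix_h[of "h @ g"] supp_g by simp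
    qed (use placed1 px placed_g in simp_all)
    obtain K2 where K2: "set (concat x1) \<subseteq> {..<K2}"
      using finite_nat_set_iff_bounded[of "set (concat x1)"] by blast
    \<comment> \<open>The second copies of the slots carry the inverse of \<open>g\<close>.\<close>
    define x2 where "x2 = map (\<lambda>s. concat (map (\<lambda>r. [r, r + K2]) s)) x1"
    define \<tau> where "\<tau> r = \<sigma> r + K2" for r
    have len2: "length x2 = length x1" by (simp add: x2_def)
    have concat2: "concat x2 = concat (map (\<lambda>r. [r, r + K2]) (concat x1))" by (simp add: x2_def concat_map_concat)
    have set2: "set (concat x2) = set (concat x1) \<union> (\<lambda>r. r + K2) ` set (concat x1)" unfolding concat2 by auto
    have placed2: "placed x2 w" if "placed x1 w" for w
    proof -
      have "distinct (concat x2)" unfolding concat2 using K2 by (intro distinct_concat_map[OF dx1]) force+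
      then show ?thesis using that set2 by (auto simp: placed_def)
    qed
    have p3: "placed x1 (u @ h @ g)" using placed1 px placed_g by simp
    have double: "isotopic (realise x1 ((u @ h @ g) @ w)) (realise x2 ((u @ h @ g) @ map (map_letter (\<lambda>r. r + K2)) w))"
      if "placed x1 w" for w
      unfolding x2_def by (rule isotopic_realise_double[OF p3 that K2])
    have "L_RII n (length x1) (realise x1 (u @ h @ g)) (realise x2 (u @ h @ g))"
      using double[of "[]"] dx1 realise_gauss_diagrams[OF p3]
      by (intro generated_equiv_isotopic) (simp_all add: placed_def)
    also have "L_RII n (length x1) \<dots> (realise x2 ((u @ h @ g) @ map (map_letter (\<lambda>r. r + K2)) (inv_word g)))"
    proof -
      have eq: "map (map_letter \<tau>) (inv_word g) = map (map_letter (\<lambda>r. r + K2)) (inv_word g)"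
        using supp_g by (intro map_letter_cong) (auto simp: \<tau>_def \<sigma>_def)
      have inj2: "inj_on \<tau> {..<M}" using inj by (auto simp: \<tau>_def inj_on_def)
      have im2: "\<tau> ` {..<M} \<subseteq> set (concat x2)" unfolding set2 \<tau>_def using im by blast
      have disj2: "support (u @ h @ g) \<inter> \<tau> ` {..<M} = {}"
      proof -
        have "a < K2" if "a \<in> support (u @ h @ g)" for a
          using that p3 K2 unfolding placed_def by blast
        then show ?thesis by (fastforce simp: \<tau>_def)
      qed
      have "L_move n (realise x2 (u @ h @ g)) (realise x2 ((u @ h @ g) @ map (map_letter \<tau>) (inv_word g)))"
        by (rule L_move_realise[OF M1 ig inj2 im2 disj2 placed2[OF p3]])
      moreover have "placed x2 (map (map_letter (\<lambda>r. r + K2)) (inv_word g))"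
      proof -
        have "placed x1 (inv_word g)" using placed1 placed_g by simp
        then have "support (map (map_letter (\<lambda>r. r + K2)) (inv_word g)) \<subseteq> set (concat x2)"
          "\<forall>(a, b, c)\<in>set (map (map_letter (\<lambda>r. r + K2)) (inv_word g)). a \<noteq> b"
          unfolding support_map_letter set2 placed_def by auto
        then show ?thesis using placed2[OF p3] unfolding placed_def by blast
      qed
      ultimately show ?thesis
        using L_RII_L_move[of n x2 "u @ h @ g" "(u @ h @ g) @ map (map_letter (\<lambda>r. r + K2)) (inv_word g)"]
          placed2[OF p3] eq len2 by simp
    qed
    also have "L_RII n (length x1) \<dots> (realise x1 ((u @ h @ g) @ inv_word g))"
      using placed1 placed_g realise_gauss_diagrams[of x1 "(u @ h @ g) @ inv_word g"] p3
      by (intro generated_equiv_sym[OF generated_equiv_isotopic[OF double]]) simp_all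
    also have "L_RII n (length x1) \<dots> (realise x1 (u @ h))"
    proof -
      have "generated_equiv (length x1) RII (realise x1 ((u @ h) @ (g @ inv_word g) @ [])) (realise x1 ((u @ h) @ []))"
        using placed1 px placed_g by (intro realise_free_trivial free_trivial_inv) simp
      then show ?thesis using RII_imp_L_RII by simp
    qed
    finally show ?thesis using step1 generated_equiv_trans by blast
  qed
  moreover have "L_RII n (length x) (realise x u) (realise x1 u)" "L_RII n (length x) (realise x (u @ h)) (realise x1 (u @ h))"
    using to_x1 supp_x realise_gauss_diagrams px placed by (intro generated_equiv_isotopic; simp)+
  ultimately show ?thesis
    unfolding len1 using generated_equiv_sym generated_equiv_trans by blast
qed

section \<open>Configurations of commutators\<close>

text \<open>
  The slots \<open>a\<close> and \<open>b\<close> are exchanged on their strand and every slot \<open>j\<close> is replaced by the slots \<open>f j\<close>.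
\<close>

lemma strands_swap:
  assumes x: "x = xs1 @ (s1 @ [a, b] @ s2) # xs2" and y: "y = xs1 @ (s1 @ [b, a] @ s2) # xs2"
    and dx: "distinct (concat x)"
    and other: "\<And>j. \<lbrakk>j \<in> set (concat x); j \<noteq> a; j \<noteq> b\<rbrakk> \<Longrightarrow> concat (map (\<lambda>i. slot_ends i w') (f j)) = slot_ends j w"
    and ab: "slot_ends a w @ slot_ends b w =
      concat (map (\<lambda>i. slot_ends i w') (f b)) @ concat (map (\<lambda>i. slot_ends i w') (f a))"
  shows "strands (lreal x w) = strands (lreal (map (\<lambda>s. concat (map f s)) y) w')"
proof -
  let ?c = "\<lambda>s. concat (map (\<lambda>j. concat (map (\<lambda>i. slot_ends i w') (f j))) s)"
  have eq: "?c s = concat (map (\<lambda>j. slot_ends j w) s)" if "set s \<subseteq> set (concat x) - {a, b}" for s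
  proof -
    have "map (\<lambda>j. concat (map (\<lambda>i. slot_ends i w') (f j))) s = map (\<lambda>j. slot_ends j w) s"
      using that other by (intro map_cong[OF refl]) blast
    then show ?thesis by (rule arg_cong)
  qed
  have sub: "set s1 \<subseteq> set (concat x) - {a, b}" "set s2 \<subseteq> set (concat x) - {a, b}"
    "\<And>s. s \<in> set xs1 \<union> set xs2 \<Longrightarrow> set s \<subseteq> set (concat x) - {a, b}"
    using dx unfolding x by auto
  have "strands (lreal (map (\<lambda>s. concat (map f s)) y) w') = map ?c y"
    by (simp add: lreal_def comp_def concat_map_concat[symmetric])
  also have "\<dots> = map (\<lambda>s. concat (map (\<lambda>j. slot_ends j w) s)) x"
    using eq[OF sub(1)] eq[OF sub(2)] eq[OF sub(3)] ab by (simp add: x y)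
  finally show ?thesis by (simp add: lreal_def)
qed

lemma letters_inv_word: "(\<forall>(i, j, p)\<in>set (inv_word w). i \<noteq> j) \<longleftrightarrow> (\<forall>(i, j, p)\<in>set w. i \<noteq> j)"
proof (induction w)
  case (Cons z w)
  then show ?case by (cases z) auto
qed simp

definition double_before :: "nat \<Rightarrow> nat list list \<Rightarrow> nat list list" where
  "double_before K x = map (\<lambda>s. concat (map (\<lambda>r. [r + K, r]) s)) x"

text \<open>
  Crossing two slots one of which is empty costs nothing.
\<close>

lemma isotopic_swap_double:
  assumes x: "x = xs1 @ (s1 @ [a, b] @ s2) # xs2" and y: "y = xs1 @ (s1 @ [b, a] @ s2) # xs2"
    and dx: "distinct (concat x)" and K: "set (concat x) \<subseteq> {..<K}"
    and w: "support w \<subseteq> set (concat x)" "a \<notin> support w \<or> b \<notin> support w"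
  shows "isotopic (realise x w) (realise (double_before K y) w)"
proof (rule isotopic_realiseI[of _ "zip [0..<length w] w" _ "zip [0..<length w] w"])
  let ?w = "zip [0..<length w] w"
  have out: "slot_ends (r + K) ?w = []" for r
  proof (rule slot_ends_outside)
    have "support w \<subseteq> {..<K}" using w(1) K by (rule order_trans)
    then show "r + K \<notin> support (map snd ?w)" by auto
  qed
  have "slot_ends a ?w = [] \<or> slot_ends b ?w = []"
    using w(2) slot_ends_outside[of a ?w] slot_ends_outside[of b ?w] by auto
  then show "strands (lreal x ?w) = strands (lreal (double_before K y) ?w)"
    unfolding double_before_def by (intro strands_swap[OF x y dx]) (auto simp: out)
qed auto

text \<open>
  The crossing of two adjacent slots \<open>a\<close>, \<open>b\<close> of words \<open>h\<close>, \<open>g\<close>: with both slots merged into \<open>b\<close>, the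
  word \<open>h' g\<close> is freely equal to \<open>[h', g] g h'\<close>; the commutator is then given slots of its own, each
  placed before the slot it comes from.
\<close>

lemma L_RII_swap:
  assumes x: "x = xs1 @ (s1 @ [a, b] @ s2) # xs2" and y: "y = xs1 @ (s1 @ [b, a] @ s2) # xs2"
    and K: "set (concat x) \<subseteq> {..<K}" and placed: "placed x (h @ g @ r)"
    and ab: "b \<notin> support h" "a \<notin> support g" "a \<notin> support r" "b \<notin> support r"
    and h': "h' = map (map_letter (transpose a b)) h" and c: "c = h' @ g @ inv_word h' @ inv_word g"
  shows "L_RII n (length x) (realise x (h @ g @ r)) (realise (double_before K y) (map (map_letter (\<lambda>r. r + K)) c @ g @ h @ r))"
proof -
  have dx: "distinct (concat x)" and supp: "support h \<subseteq> set (concat x)" "support g \<subseteq> set (concat x)"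
    using placed by (simp_all add: placed_def)
  have ne: "a \<noteq> b" using dx x by auto
  have in_x: "a \<in> set (concat x)" "b \<in> set (concat x)" by (simp_all add: x)
  let ?t = "transpose a b"
  have supp_h': "support h' = ?t ` support h" by (simp add: h' support_map_letter)
  have placed_h': "placed x h'"
  proof -
    have "?t i \<in> set (concat x)" if "i \<in> set (concat x)" for i using that in_x by (simp add: transpose_def)
    then have "support h' \<subseteq> set (concat x)" using supp(1) unfolding supp_h' by blast
    moreover have "\<forall>(i, j, p)\<in>set h'. i \<noteq> j"
    proof -
      have "?t i \<noteq> ?t j" if "i \<noteq> j" for i j using that by (auto simp: transpose_def)
      moreover have "\<forall>(i, j, p)\<in>set h. i \<noteq> j" using placed by (simp add: placed_def)
      ultimately have "i \<noteq> j" if "(i, j, p) \<in> set h'" for i j p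
      proof -
        have "(i, j, p) \<in> map_letter ?t ` set h" using that by (simp add: h')
        then obtain y where y: "(i, j, p) = map_letter ?t y" "y \<in> set h" by (rule imageE)
        obtain i0 j0 p0 where "y = (i0, j0, p0)" by (cases y)
        then show ?thesis using y \<open>\<forall>(i, j, p)\<in>set h. i \<noteq> j\<close> \<open>\<And>i j. i \<noteq> j \<Longrightarrow> ?t i \<noteq> ?t j\<close> by auto
      qed
      then show ?thesis by blast
    qed
    ultimately show ?thesis using dx by (simp add: placed_def)
  qed
  have placed_inv: "placed x (inv_word w)" if "placed x w" for w
    using that unfolding placed_def support_inv_word letters_inv_word .
  have pl: "placed x h'" "placed x g" "placed x (inv_word h')" "placed x (inv_word g)" "placed x r" "placed x h"
    using placed_h' placed placed_inv by simp_all
  have len: "length (double_before K y) = length x" by (simp add: double_before_def x y)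
  obtain lc l1 :: "nat lword" where l: "map snd lc = c" "map snd l1 = g @ h @ r" "distinct (map fst (lc @ l1))"
    by (rule obtain_labels)
  obtain lg l2 where l2: "l1 = lg @ l2" "map snd lg = g" "map snd l2 = h @ r" using map_eq_appendE[OF l(2)] .
  obtain lh lr where l3: "l2 = lh @ lr" "map snd lh = h" "map snd lr = r" using map_eq_appendE[OF l2(3)] .
  define lh' where "lh' = map (map_prod id (map_letter ?t)) lh"
  define lc' where "lc' = map (map_prod id (map_letter (\<lambda>r. r + K))) lc"
  have snd': "map snd lh' = h'" "map snd lc' = map (map_letter (\<lambda>r. r + K)) c"
    by (simp_all add: lh'_def lc'_def h' flip: l3(2) l(1))
  have fst': "map fst lh' = map fst lh" "map fst lc' = map fst lc" by (simp_all add: lh'_def lc'_def)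
  have ends_h': "slot_ends (?t j) lh' = slot_ends j lh" for j
    unfolding lh'_def using slot_ends_relabel[of ?t UNIV j lh id] by (simp add: endpoint.map_id0)
  have ends_c': "slot_ends (j + K) lc' = slot_ends j lc" for j
    unfolding lc'_def using slot_ends_relabel[of "\<lambda>r. r + K" UNIV j lc id] by (simp add: endpoint.map_id0 inj_on_def)
  have ends_c'_less: "slot_ends j lc' = []" if "j < K" for j
    unfolding lc'_def using that by (intro slot_ends_relabel_outside[of _ _ UNIV]) auto
  have out: "slot_ends j l = []" if "j \<notin> support w" "map snd l = w" for j w and l :: "nat lword"
    using that slot_ends_outside by blast
  have h'_other: "slot_ends j lh' = slot_ends j lh" if "j \<noteq> a" "j \<noteq> b" for j
    using ends_h'[of j] that by simp
  have h'_ab: "slot_ends b lh' = slot_ends a lh" "slot_ends a lh' = []"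
    using ends_h'[of a] ends_h'[of b] out[OF ab(1) l3(2)] by simp_all
  have g_a: "slot_ends a lg = []" and r_ab: "slot_ends a lr = []" "slot_ends b lr = []" and h_b: "slot_ends b lh = []"
    using out ab l2 l3 by blast+
  have c_a: "slot_ends a lc = []"
  proof -
    have "a \<notin> support h'" unfolding supp_h' using ab(1) by (auto simp: transpose_def split: if_splits)
    then have "a \<notin> support c" using ab(2) by (simp add: c)
    then show ?thesis using l(1) by (rule out)
  qed
  have high: "slot_ends (j + K) l = []" if "map snd l = w" "placed x w" for j w and l :: "nat lword"
  proof -
    have "support w \<subseteq> {..<K}" using that(2) K unfolding placed_def by blast
    then have "j + K \<notin> support w" by auto
    then show ?thesis using that(1) by (rule out)
  qed
  have high_ghr: "slot_ends (j + K) lg = []" "slot_ends (j + K) lh = []" "slot_ends (j + K) lr = []" for j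
    using high l2 l3 pl by blast+
  have less: "j < K" if "j \<in> set (concat x)" for j using that K by blast
  have "isotopic (realise x (h @ g @ r)) (realise x (h' @ g @ r))"
  proof (rule isotopic_realiseI[of _ "lh @ lg @ lr" _ "lh' @ lg @ lr"])
    have "strands (lreal x (lh @ lg @ lr)) = strands (lreal (map (\<lambda>s. concat (map (\<lambda>j. if j = a then [b] else if j = b then [a] else [j]) s)) y) (lh' @ lg @ lr))"
      by (rule strands_swap[OF x y dx]) (auto simp: h'_other h'_ab g_a r_ab h_b ne)
    also have "map (\<lambda>s. concat (map (\<lambda>j. if j = a then [b] else if j = b then [a] else [j]) s)) y = x"
    proof -
      have "concat (map (\<lambda>j. if j = a then [b] else if j = b then [a] else [j]) s) = s" if "set s \<inter> {a, b} = {}" for s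
        using that by (induction s) auto
      moreover have "set s \<inter> {a, b} = {}" if "s \<in> {s1, s2} \<union> set xs1 \<union> set xs2" for s
        using that dx unfolding x by auto
      ultimately show ?thesis using ne by (auto simp: x y intro!: map_idI)
    qed
    finally show "strands (lreal x (lh @ lg @ lr)) = strands (lreal x (lh' @ lg @ lr))" .
  next
    show "distinct (map fst (lh @ lg @ lr))" using l(3) l2 l3 by auto
    then show "distinct (map fst (lh' @ lg @ lr))" by (simp only: map_append fst')
    fix q i j p assume "(q, i, j, p) \<in> set (lh @ lg @ lr)"
    then show "\<exists>i' j'. (q, i', j', p) \<in> set (lh' @ lg @ lr)" by (force simp: lh'_def)
  qed (use l2 l3 snd' in simp_all)
  then have 1: "L_RII n (length x) (realise x (h @ g @ r)) (realise x (h' @ g @ r))"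
    using realise_gauss_diagrams[OF placed] by (rule generated_equiv_isotopic)
  have "generated_equiv (length x) RII (realise x (c @ g @ h' @ r)) (realise x (h' @ g @ inv_word h' @ h' @ r))"
    using realise_free_trivial[OF free_trivial_inv(2)[of g], of x "h' @ g @ inv_word h'" "h' @ r"] pl by (simp add: c)
  also have "generated_equiv (length x) RII \<dots> (realise x (h' @ g @ r))"
    using realise_free_trivial[OF free_trivial_inv(2)[of h'], of x "h' @ g" r] pl by simp
  finally have 2: "L_RII n (length x) (realise x (c @ g @ h' @ r)) (realise x (h' @ g @ r))"
    by (rule RII_imp_L_RII)
  have "isotopic (realise x (c @ g @ h' @ r)) (realise (double_before K y) (map (map_letter (\<lambda>r. r + K)) c @ g @ h @ r))"
  proof (rule isotopic_realiseI[of _ "lc @ lg @ lh' @ lr" _ "lc' @ lg @ lh @ lr"])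
    show "strands (lreal x (lc @ lg @ lh' @ lr)) = strands (lreal (double_before K y) (lc' @ lg @ lh @ lr))"
      unfolding double_before_def
    proof (rule strands_swap[OF x y dx])
      fix j assume j: "j \<in> set (concat x)" "j \<noteq> a" "j \<noteq> b"
      show "concat (map (\<lambda>i. slot_ends i (lc' @ lg @ lh @ lr)) [j + K, j]) = slot_ends j (lc @ lg @ lh' @ lr)"
        using ends_c' ends_c'_less[OF less[OF j(1)]] h'_other[OF j(2,3)] high_ghr by simp
    next
      show "slot_ends a (lc @ lg @ lh' @ lr) @ slot_ends b (lc @ lg @ lh' @ lr) =
        concat (map (\<lambda>i. slot_ends i (lc' @ lg @ lh @ lr)) [b + K, b]) @ concat (map (\<lambda>i. slot_ends i (lc' @ lg @ lh @ lr)) [a + K, a])"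
        using ends_c' ends_c'_less[OF less[OF in_x(1)]] ends_c'_less[OF less[OF in_x(2)]]
        by (simp add: h'_ab g_a r_ab h_b c_a high_ghr)
    qed
  next
    show d: "distinct (map fst (lc @ lg @ lh' @ lr))" using l(3) unfolding l2 l3 by (simp only: map_append fst')
    show "distinct (map fst (lc' @ lg @ lh @ lr))" using l(3) unfolding l2 l3 by (simp only: map_append fst')
    fix q i j p assume "(q, i, j, p) \<in> set (lc @ lg @ lh' @ lr)"
    then show "\<exists>i' j'. (q, i', j', p) \<in> set (lc' @ lg @ lh @ lr)" by (force simp: lh'_def lc'_def)
  qed (use l l2 l3 snd' in simp_all)
  moreover have "realise x (c @ g @ h' @ r) \<in> gauss_diagrams (length x)"
    using pl by (intro realise_gauss_diagrams) (simp add: c)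
  ultimately have 3: "L_RII n (length x) (realise x (c @ g @ h' @ r))
      (realise (double_before K y) (map (map_letter (\<lambda>r. r + K)) c @ g @ h @ r))"
    by (rule generated_equiv_isotopic)
  from 1 2 3 show ?thesis using generated_equiv_sym generated_equiv_trans by blast
qed

text \<open>
  A piece is a word of known depth that occupies slots of its own. Its label is the set of those among
  the \<open>n\<close> given sets of arrows that had to be used to form it; deleting one of these sets deletes the
  piece. As labels unite and depths add up under commutators, a label never exceeds the depth.
\<close>

type_synonym piece = "nat set \<times> nat \<times> pv_word"

abbreviation label :: "piece \<Rightarrow> nat set" where "label p \<equiv> fst p"
abbreviation depth :: "piece \<Rightarrow> nat" where "depth p \<equiv> fst (snd p)"
abbreviation word :: "piece \<Rightarrow> pv_word" where "word p \<equiv> snd (snd p)"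

definition piece_ok :: "nat \<Rightarrow> piece \<Rightarrow> bool" where
  "piece_ok n p \<longleftrightarrow> label p \<subseteq> {..<n} \<and> card (label p) \<le> depth p \<and> 1 \<le> depth p \<and>
     depth_ge (depth p) (word p) \<and> (\<forall>(i, j, b)\<in>set (word p). i \<noteq> j)"

definition disjoint_pieces :: "piece list \<Rightarrow> bool" where
  "disjoint_pieces = sorted_wrt (\<lambda>p q. support (word p) \<inter> support (word q) = {})"

definition configuration :: "nat \<Rightarrow> nat list list \<Rightarrow> piece list \<Rightarrow> bool" where
  "configuration n x ps \<longleftrightarrow> distinct (concat x) \<and> set (concat x) = (\<Union>p\<in>set ps. support (word p)) \<and>
     (\<forall>p\<in>set ps. piece_ok n p) \<and> disjoint_pieces ps"

definition words :: "piece list \<Rightarrow> pv_word" where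
  "words ps = concat (map word ps)"

definition killed :: "nat list list \<Rightarrow> piece list \<Rightarrow> nat set \<Rightarrow> nat gauss_diagram" where
  "killed x ps S = realise x (words (filter (\<lambda>p. label p \<inter> S = {}) ps))"

lemma words_simps [simp]: "words [] = []" "words (p # ps) = word p @ words ps" "words (ps @ qs) = words ps @ words qs"
  by (simp_all add: words_def)

lemma support_words: "support (words ps) = (\<Union>p\<in>set ps. support (word p))"
  by (induction ps) auto

lemma words_letters:
  assumes "\<And>p. p \<in> set ps \<Longrightarrow> piece_ok n p"
  shows "\<forall>(i, j, b)\<in>set (words ps). i \<noteq> j"
  using assms
proof (induction ps)
  case (Cons p ps)
  have "\<forall>(i, j, b)\<in>set (word p). i \<noteq> j" using Cons.prems[of p] by (simp add: piece_ok_def)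
  then show ?case using Cons by (simp add: ball_Un)
qed simp

lemma disjoint_pieces_move: "disjoint_pieces (A @ p # B) \<longleftrightarrow> disjoint_pieces (p # A @ B)"
  unfolding disjoint_pieces_def sorted_wrt_append sorted_wrt.simps set_append list.set ball_Un ball_simps
  by blast

lemma disjoint_pieces_eq:
  "\<lbrakk>disjoint_pieces ps; p \<in> set ps; q \<in> set ps; j \<in> support (word p); j \<in> support (word q)\<rbrakk> \<Longrightarrow> p = q"
  by (induction ps) (auto simp: disjoint_pieces_def)

lemma placed_words:
  assumes "configuration n x ps" "set qs \<subseteq> set ps"
  shows "placed x (words qs)"
proof -
  have "support (words qs) \<subseteq> set (concat x)"
    using assms unfolding configuration_def support_words by blast
  moreover have "\<forall>(i, j, b)\<in>set (words qs). i \<noteq> j"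
    using assms unfolding configuration_def by (intro words_letters) blast
  ultimately show ?thesis using assms(1) by (simp add: placed_def configuration_def)
qed

lemma killed_gauss_diagrams: "configuration n x ps \<Longrightarrow> killed x ps S \<in> gauss_diagrams (length x)"
  unfolding killed_def by (rule realise_gauss_diagrams[OF placed_words]) auto

lemma configuration_move: "configuration n x (A @ p # B) \<longleftrightarrow> configuration n x (p # A @ B)"
  unfolding configuration_def disjoint_pieces_move by (auto simp: Un_left_commute)

lemma killed_move:
  assumes "configuration n x (A @ p # B)"
  shows "isotopic (killed x (A @ p # B) S) (killed x (p # A @ B) S)"
proof (cases "label p \<inter> S = {}")
  case True
  let ?F = "filter (\<lambda>p. label p \<inter> S = {})"
  have "support (words (?F A)) \<inter> support (word p) = {}"
    using assms unfolding configuration_def disjoint_pieces_def support_words by (auto simp: sorted_wrt_append)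
  then show ?thesis
    using isotopic_realise_swap_blocks[of "words (?F A)" "word p" x "[]" "words (?F B)"] True
    by (simp add: killed_def)
qed (simp add: killed_def)

lemma configuration_front:
  assumes c: "configuration n x ps" and pq: "p \<in> set ps" "q \<in> set ps" "p \<noteq> q"
  obtains r where "configuration n x (p # q # r)" "set (p # q # r) = set ps"
    "\<And>S. L_RII m (length x) (killed x ps S) (killed x (p # q # r) S)"
proof -
  obtain A B where ps: "ps = A @ q # B" using pq(2) by (meson split_list)
  then have "p \<in> set (A @ B)" using pq by auto
  then obtain A' B' where AB: "A @ B = A' @ p # B'" by (meson split_list)
  have c1: "configuration n x (q # A @ B)" using c configuration_move unfolding ps by blast
  then have c2: "configuration n x ((q # A') @ p # B')" using AB by simp
  then have c3: "configuration n x (p # q # A' @ B')" using configuration_move[of n x "q # A'" p B'] by simp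
  have "L_RII m (length x) (killed x ps S) (killed x (p # q # A' @ B') S)" for S
  proof -
    have "isotopic (killed x ps S) (killed x (q # A @ B) S)" using killed_move c unfolding ps by blast
    also have "isotopic \<dots> (killed x (p # q # A' @ B') S)" using killed_move[OF c2] AB by simp
    finally show ?thesis using killed_gauss_diagrams[OF c] by (rule generated_equiv_isotopic)
  qed
  moreover have "set (p # q # A' @ B') = set ps"
  proof -
    have "set A \<union> set B = insert p (set A' \<union> set B')" using arg_cong[OF AB, of set] by simp
    then show ?thesis unfolding ps set_append list.set by blast
  qed
  ultimately show thesis using that c3 by blast
qed

lemma isotopic_realise_filter:
  assumes "support w \<subseteq> U"
  shows "isotopic (realise x w) (realise (map (filter (\<lambda>j. j \<in> U)) x) w)"
proof (rule isotopic_realiseI[of _ "zip [0..<length w] w" _ "zip [0..<length w] w"])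
  let ?w = "zip [0..<length w] w"
  have "slot_ends j ?w = []" if "j \<notin> U" for j using that assms slot_ends_outside[of j ?w] by auto
  then have "concat (map (\<lambda>j. slot_ends j ?w) (filter (\<lambda>j. j \<in> U) s)) = concat (map (\<lambda>j. slot_ends j ?w) s)" for s
    by (induction s) auto
  then show "strands (lreal x ?w) = strands (lreal (map (filter (\<lambda>j. j \<in> U)) x) ?w)"
    by (simp add: lreal_def)
qed auto

lemma depth_ge_antimono: "depth_ge d w \<Longrightarrow> n \<le> d \<Longrightarrow> depth_ge n w"
  unfolding depth_ge_def using group.lower_central_antimono[OF group_PV] by blast

definition used_slots :: "piece list \<Rightarrow> nat list list \<Rightarrow> nat list list" where
  "used_slots ps x = map (filter (\<lambda>j. j \<in> support (words ps))) x"

lemma drop_deep_words: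
  assumes n: "1 \<le> n" and x: "distinct (concat x)" "support (words (A @ ps)) \<subseteq> set (concat x)"
    and ok: "\<And>p. p \<in> set (A @ ps) \<Longrightarrow> piece_ok n p" and disj: "disjoint_pieces (A @ ps)"
  shows "L_RII n (length x) (realise x (words (A @ ps))) (realise x (words (A @ filter (\<lambda>p. depth p < n) ps)))"
  using x(2) ok disj
proof (induction ps arbitrary: A)
  case Nil
  then show ?case by simp
next
  case (Cons p ps)
  show ?case
  proof (cases "depth p < n")
    case True
    then show ?thesis using Cons.IH[of "A @ [p]"] Cons.prems by simp
  next
    case False
    have placed: "placed x (words (A @ p # ps))"
    proof -
      have "\<forall>(i, j, b)\<in>set (words (A @ p # ps)). i \<noteq> j"
        using Cons.prems(2) by (rule words_letters)
      then show ?thesis using x(1) Cons.prems(1) by (simp add: placed_def)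
    qed
    have d: "support (word p) \<inter> support (words ps) = {}" "support (words (A @ ps)) \<inter> support (word p) = {}"
      using Cons.prems(3) unfolding disjoint_pieces_def support_words by (auto simp: sorted_wrt_append)
    have "isotopic (realise x (words (A @ p # ps))) (realise x (words (A @ ps) @ word p))"
      using isotopic_realise_swap_blocks[OF d(1), of x "words A" "[]"] by simp
    then have "L_RII n (length x) (realise x (words (A @ p # ps))) (realise x (words (A @ ps) @ word p))"
      using realise_gauss_diagrams[OF placed] by (rule generated_equiv_isotopic)
    also have "L_RII n (length x) \<dots> (realise x (words (A @ ps)))"
    proof (rule generated_equiv_sym, rule insert_deep_word[OF n _ _ d(2)])
      show "depth_ge n (word p)" using Cons.prems(2)[of p] False by (auto simp: piece_ok_def intro: depth_ge_antimono)
      show "placed x (words (A @ ps) @ word p)" using placed by simp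
    qed
    also have "L_RII n (length x) \<dots> (realise x (words (A @ filter (\<lambda>p. depth p < n) ps)))"
    proof (rule Cons.IH)
      show "support (words (A @ ps)) \<subseteq> set (concat x)" using Cons.prems(1) by simp
      show "disjoint_pieces (A @ ps)" using Cons.prems(3) by (auto simp: disjoint_pieces_def sorted_wrt_append)
    qed (use Cons.prems(2) in auto)
    finally show ?thesis using False by simp
  qed
qed

lemma configuration_drop_deep:
  assumes n: "1 \<le> n" and x: "distinct (concat x)" "support (words ps) \<subseteq> set (concat x)"
    and ok: "\<And>p. p \<in> set ps \<Longrightarrow> piece_ok n p" and disj: "disjoint_pieces ps"
    and ps': "ps' = filter (\<lambda>p. depth p < n) ps"
  shows "configuration n (used_slots ps' x) ps'"
    "L_RII n (length x) (killed x ps S) (killed (used_slots ps' x) ps' S)"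
proof -
  have sub: "support (words ps') \<subseteq> set (concat x)"
    using x(2) unfolding ps' support_words by auto
  have eq: "concat (used_slots ps' x) = filter (\<lambda>j. j \<in> support (words ps')) (concat x)"
    by (simp add: used_slots_def filter_concat)
  have d: "disjoint_pieces ps'" using disj unfolding ps' disjoint_pieces_def by (rule sorted_wrt_filter)
  have "set (concat (used_slots ps' x)) = support (words ps')" unfolding eq using sub by auto
  then show "configuration n (used_slots ps' x) ps'"
    unfolding configuration_def
  proof (intro conjI)
    show "distinct (concat (used_slots ps' x))" unfolding eq using x(1) by (rule distinct_filter)
    show "\<forall>p\<in>set ps'. piece_ok n p" using ok unfolding ps' by simp
  qed (use d in \<open>simp_all only: support_words\<close>)
  let ?F = "filter (\<lambda>p. label p \<inter> S = {})"
  have "L_RII n (length x) (realise x (words ([] @ ?F ps))) (realise x (words ([] @ filter (\<lambda>p. depth p < n) (?F ps))))"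
  proof (rule drop_deep_words[OF n x(1)])
    show "support (words ([] @ ?F ps)) \<subseteq> set (concat x)" using x(2) unfolding support_words by auto
    show "disjoint_pieces ([] @ ?F ps)" using disj unfolding disjoint_pieces_def by (simp add: sorted_wrt_filter)
  qed (use ok in auto)
  moreover have "filter (\<lambda>p. depth p < n) (?F ps) = ?F ps'" unfolding ps' filter_filter by (rule filter_cong) auto
  ultimately have 1: "L_RII n (length x) (killed x ps S) (realise x (words (?F ps')))" by (simp add: killed_def)
  have "support (words (?F ps')) \<subseteq> support (words ps')" unfolding support_words by auto
  then have "isotopic (realise x (words (?F ps'))) (killed (used_slots ps' x) ps' S)"
    unfolding killed_def used_slots_def by (rule isotopic_realise_filter)
  moreover have "placed x (words (?F ps'))"
  proof -
    have "\<forall>(i, j, b)\<in>set (words (?F ps')). i \<noteq> j"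
      using ok unfolding ps' by (intro words_letters[of _ n]) simp
    moreover have "support (words (?F ps')) \<subseteq> set (concat x)" using sub unfolding support_words by auto
    ultimately show ?thesis using x(1) by (simp add: placed_def)
  qed
  ultimately have 2: "L_RII n (length x) (realise x (words (?F ps'))) (killed (used_slots ps' x) ps' S)"
    using realise_gauss_diagrams generated_equiv_isotopic by blast
  from 1 2 show "L_RII n (length x) (killed x ps S) (killed (used_slots ps' x) ps' S)" by (rule generated_equiv_trans)
qed

section \<open>Sorting a configuration\<close>

lemma set_double_before: "set (concat (double_before K y)) = set (concat y) \<union> (\<lambda>r. r + K) ` set (concat y)"
  by (auto simp: double_before_def)

lemma distinct_double_before:
  assumes "distinct (concat y)" "set (concat y) \<subseteq> {..<K}"
  shows "distinct (concat (double_before K y))"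
proof -
  have "concat (double_before K y) = concat (map (\<lambda>r. [r + K, r]) (concat y))"
    by (simp add: double_before_def concat_map_concat)
  then show ?thesis using assms(2) by (simp only:) (intro distinct_concat_map[OF assms(1)]; force)
qed

text \<open>
  If a deletion kills one of the two pieces that are crossed, it kills their commutator as well, and the
  crossing is an isotopy. This is why the equivalence holds after every deletion \<open>S\<close>.
\<close>

lemma configuration_step:
  assumes c: "configuration n x (P # Q # R)"
    and x: "x = xs1 @ (s1 @ [a, b] @ s2) # xs2" and y: "y = xs1 @ (s1 @ [b, a] @ s2) # xs2"
    and ab: "a \<in> support (word P)" "b \<in> support (word Q)" and K: "set (concat x) \<subseteq> {..<K}"
  obtains C where "label C = label P \<union> label Q" "depth C = depth P + depth Q" "support (word C) \<inter> {..<K} = {}"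
    "support (words (C # Q # P # R)) \<subseteq> set (concat (double_before K y))"
    "\<And>p. p \<in> set (C # Q # P # R) \<Longrightarrow> piece_ok n p" "disjoint_pieces (C # Q # P # R)"
    "\<And>S. L_RII n (length x) (killed x (P # Q # R) S) (killed (double_before K y) (C # Q # P # R) S)"
proof -
  define h' where "h' = map (map_letter (transpose a b)) (word P)"
  define c0 where "c0 = h' @ word Q @ inv_word h' @ inv_word (word Q)"
  define C :: piece where "C = (label P \<union> label Q, depth P + depth Q, map (map_letter (\<lambda>r. r + K)) c0)"
  have dx: "distinct (concat x)" and set_x: "set (concat x) = (\<Union>p\<in>set (P # Q # R). support (word p))"
    and ok: "\<And>p. p \<in> set (P # Q # R) \<Longrightarrow> piece_ok n p" and disj: "disjoint_pieces (P # Q # R)"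
    using c unfolding configuration_def by blast+
  have PQ: "support (word P) \<inter> support (word Q) = {}"
    and PR: "support (word P) \<inter> support (words R) = {}" and QR: "support (word Q) \<inter> support (words R) = {}"
    using disj by (auto simp: disjoint_pieces_def support_words)
  have set_y: "set (concat y) = set (concat x)" by (auto simp: x y)
  have supp: "support (word p) \<subseteq> set (concat x)" if "p \<in> set (P # Q # R)" for p using that set_x by blast
  have t_x: "transpose a b i \<in> set (concat x)" if "i \<in> set (concat x)" for i
    using that by (auto simp: x transpose_def)
  have supp_h': "support h' \<subseteq> set (concat x)"
    using supp[of P] t_x unfolding h'_def support_map_letter by auto
  have supp_c0: "support c0 \<subseteq> set (concat x)" using supp_h' supp[of Q] by (simp add: c0_def)
  have supp_C: "support (word C) = (\<lambda>r. r + K) ` support c0" by (simp add: C_def support_map_letter)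
  have C_high: "support (word C) \<inter> {..<K} = {}" unfolding supp_C by auto
  have C_sub: "support (words (C # Q # P # R)) \<subseteq> set (concat (double_before K y))"
  proof -
    have "support (word C) \<subseteq> (\<lambda>r. r + K) ` set (concat x)" unfolding supp_C using supp_c0 by blast
    moreover have "support (words (Q # P # R)) \<subseteq> set (concat x)" unfolding set_x support_words by auto
    ultimately show ?thesis unfolding set_double_before set_y by auto
  qed
  have C_ok: "piece_ok n C"
  proof -
    have P: "piece_ok n P" and Q: "piece_ok n Q" using ok by simp_all
    have "card (label P \<union> label Q) \<le> card (label P) + card (label Q)" by (rule card_Un_le)
    then have card: "card (label C) \<le> depth C" using P Q by (simp add: C_def piece_ok_def)
    have "depth_ge (depth P) h'" unfolding h'_def using P by (intro depth_ge_map_letter) (simp_all add: piece_ok_def)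
    then have "depth_ge (depth P + depth Q) c0"
      unfolding c0_def using P Q by (intro depth_ge_commutator) (simp_all add: piece_ok_def)
    then have d: "depth_ge (depth C) (word C)"
      by (simp add: C_def depth_ge_map_letter inj_on_def)
    have "\<exists>m. w \<in> pv_words m" if "depth_ge d w" for d w using that unfolding depth_ge_def by blast
    then obtain m where "word C \<in> pv_words m" using d by blast
    then have "\<forall>(i, j, b)\<in>set (word C). i \<noteq> j" by (auto simp: pv_words_iff)
    then show ?thesis using P Q card d unfolding piece_ok_def by (simp add: C_def)
  qed
  have C_disj: "disjoint_pieces (C # Q # P # R)"
  proof -
    have "support (word C) \<inter> support (word p) = {}" if "p \<in> set (P # Q # R)" for p
      using C_high supp[OF that] K by blast
    then have "\<forall>p\<in>set (Q # P # R). support (word C) \<inter> support (word p) = {}" by simp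
    moreover have "disjoint_pieces (Q # P # R)" using disj by (simp add: disjoint_pieces_def Int_commute)
    ultimately show ?thesis by (simp add: disjoint_pieces_def)
  qed
  have C_L: "L_RII n (length x) (killed x (P # Q # R) S) (killed (double_before K y) (C # Q # P # R) S)" for S
  proof -
    let ?F = "filter (\<lambda>p. label p \<inter> S = {})"
    have supp_R: "support (words (?F R)) \<subseteq> support (words R)" unfolding support_words by auto
    show ?thesis
    proof (cases "label P \<inter> S = {} \<and> label Q \<inter> S = {}")
      case True
      have "placed x (words [P, Q] @ words (?F R))"
        using placed_words[OF c, of "P # Q # ?F R"] by auto
      then have pl: "placed x (word P @ word Q @ words (?F R))" by simp
      have "L_RII n (length x) (realise x (word P @ word Q @ words (?F R)))
          (realise (double_before K y) (map (map_letter (\<lambda>r. r + K)) c0 @ word Q @ word P @ words (?F R)))"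
        using PQ PR QR ab supp_R by (intro L_RII_swap[OF x y K pl _ _ _ _ h'_def c0_def]) blast+
      then show ?thesis using True by (simp add: killed_def C_def Int_Un_distrib2)
    next
      case False
      then have killed_C: "label C \<inter> S \<noteq> {}" by (auto simp: C_def)
      let ?w = "words (?F (P # Q # R))"
      have eq: "words (?F (C # Q # P # R)) = ?w" using killed_C False by auto
      have sub: "support ?w \<subseteq> set (concat x)" unfolding set_x support_words by auto
      have "a \<notin> support ?w \<or> b \<notin> support ?w"
        using False PQ PR QR ab supp_R by auto
      then have "isotopic (realise x ?w) (realise (double_before K y) ?w)"
        by (rule isotopic_swap_double[OF x y dx K sub])
      then show ?thesis using killed_gauss_diagrams[OF c, of S] unfolding killed_def eq by (rule generated_equiv_isotopic)
    qed
  qed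
  have C_oks: "piece_ok n p" if "p \<in> set (C # Q # P # R)" for p
  proof -
    have "p = C \<or> p \<in> set (P # Q # R)" using that by auto
    then show ?thesis using C_ok ok by blast
  qed
  show thesis
  proof (rule that[of C])
    show "label C = label P \<union> label Q" "depth C = depth P + depth Q" by (simp_all add: C_def)
  qed (fact C_high C_sub C_oks C_disj C_L)+
qed

fun inversions :: "(nat \<Rightarrow> nat) \<Rightarrow> (nat \<Rightarrow> nat \<Rightarrow> nat) \<Rightarrow> nat list \<Rightarrow> nat multiset" where
  "inversions \<kappa> W [] = {#}"
| "inversions \<kappa> W (a # s) = image_mset (W a) (mset (filter (\<lambda>b. \<kappa> b < \<kappa> a) s)) + inversions \<kappa> W s"

lemma inversions_swap:
  assumes "\<kappa> b < \<kappa> a"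
  shows "inversions \<kappa> W (u @ [a, b] @ v) = add_mset (W a b) (inversions \<kappa> W (u @ [b, a] @ v))"
proof (induction u)
  case Nil
  then show ?case using assms by simp
next
  case (Cons c u)
  have "mset (filter (\<lambda>b. \<kappa> b < \<kappa> c) (u @ [a, b] @ v)) = mset (filter (\<lambda>b. \<kappa> b < \<kappa> c) (u @ [b, a] @ v))"
    by simp
  then show ?case using Cons by (simp del: filter_append append.simps(2) add: append_Cons[of c])
qed

lemma inversions_cong:
  assumes "\<And>i. i \<in> set s \<Longrightarrow> \<kappa> i = \<kappa>' i" "\<And>i j. \<lbrakk>i \<in> set s; j \<in> set s\<rbrakk> \<Longrightarrow> W i j = W' i j"
  shows "inversions \<kappa> W s = inversions \<kappa>' W' s"
  using assms
proof (induction s)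
  case (Cons a s)
  have "filter (\<lambda>b. \<kappa> b < \<kappa> a) s = filter (\<lambda>b. \<kappa>' b < \<kappa>' a) s"
    using Cons.prems(1) by (intro filter_cong) auto
  moreover have "image_mset (W a) (mset (filter (\<lambda>b. \<kappa>' b < \<kappa>' a) s)) = image_mset (W' a) (mset (filter (\<lambda>b. \<kappa>' b < \<kappa>' a) s))"
    using Cons.prems(2) by (intro image_mset_cong) auto
  moreover have "inversions \<kappa> W s = inversions \<kappa>' W' s" using Cons.prems by (intro Cons.IH) auto
  ultimately show ?case by simp
qed simp

lemma inversions_filter:
  "\<exists>N. inversions \<kappa> W s = inversions \<kappa> W (filter P s) + N \<and>
    (\<forall>w\<in>#N. \<exists>i\<in>set s. \<exists>j\<in>set s. w = W i j \<and> (\<not> P i \<or> \<not> P j))"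
proof (induction s)
  case (Cons a s)
  then obtain N where N: "inversions \<kappa> W s = inversions \<kappa> W (filter P s) + N"
    "\<forall>w\<in>#N. \<exists>i\<in>set s. \<exists>j\<in>set s. w = W i j \<and> (\<not> P i \<or> \<not> P j)" by blast
  let ?f = "\<lambda>s. image_mset (W a) (mset (filter (\<lambda>b. \<kappa> b < \<kappa> a) s))"
  show ?case
  proof (cases "P a")
    case True
    have split: "?f s = ?f (filter P s) + ?f (filter (\<lambda>j. \<not> P j) s)"
      by (induction s) (auto simp: filter_filter_mset)
    have "inversions \<kappa> W (a # s) = inversions \<kappa> W (filter P (a # s)) + (?f (filter (\<lambda>j. \<not> P j) s) + N)"
      unfolding inversions.simps split N(1) using True by simp
    moreover have "\<forall>w\<in>#?f (filter (\<lambda>j. \<not> P j) s) + N. \<exists>i\<in>set (a # s). \<exists>j\<in>set (a # s). w = W i j \<and> (\<not> P i \<or> \<not> P j)"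
      using N(2) by auto
    ultimately show ?thesis by blast
  next
    case False
    have "inversions \<kappa> W (a # s) = inversions \<kappa> W (filter P (a # s)) + (?f s + N)"
      unfolding inversions.simps N(1) using False by simp
    moreover have "\<forall>w\<in>#?f s + N. \<exists>i\<in>set (a # s). \<exists>j\<in>set (a # s). w = W i j \<and> (\<not> P i \<or> \<not> P j)"
      using N(2) False by auto
    ultimately show ?thesis by blast
  qed
qed simp

definition owner :: "piece list \<Rightarrow> nat \<Rightarrow> piece" where
  "owner ps j = (THE p. p \<in> set ps \<and> j \<in> support (word p))"

text \<open>
  The binary encoding of the labels is injective and monotone for inclusion.
\<close>

definition key :: "piece list \<Rightarrow> nat \<Rightarrow> nat" where
  "key ps j = set_encode (label (owner ps j))"

definition weight :: "nat \<Rightarrow> piece list \<Rightarrow> nat \<Rightarrow> nat \<Rightarrow> nat" where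
  "weight n ps i j = n - max (depth (owner ps i)) (depth (owner ps j))"

lemma owner_eq:
  assumes "disjoint_pieces ps" "p \<in> set ps" "j \<in> support (word p)"
  shows "owner ps j = p"
  unfolding owner_def
proof (rule the_equality)
  show "p \<in> set ps \<and> j \<in> support (word p)" using assms by simp
  show "q = p" if "q \<in> set ps \<and> j \<in> support (word q)" for q
    using disjoint_pieces_eq[OF assms(1) _ assms(2) _ assms(3)] that by blast
qed

lemma configuration_owner:
  assumes "configuration n x ps" "j \<in> set (concat x)"
  shows "owner ps j \<in> set ps" "j \<in> support (word (owner ps j))"
proof -
  obtain p where p: "p \<in> set ps" "j \<in> support (word p)" using assms unfolding configuration_def by blast
  then have "owner ps j = p" using assms(1) unfolding configuration_def by (intro owner_eq) auto
  then show "owner ps j \<in> set ps" "j \<in> support (word (owner ps j))" using p by auto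
qed

definition disorder :: "nat \<Rightarrow> nat list list \<Rightarrow> piece list \<Rightarrow> nat multiset" where
  "disorder n x ps = sum_list (map (inversions (key ps) (weight n ps)) x)"

lemma sum_list_extra:
  assumes "\<And>t. t \<in> set y \<Longrightarrow> \<exists>N. F t = G t + N \<and> (\<forall>w\<in>#N. w < (B :: nat))"
  shows "\<exists>N. sum_list (map F y) = sum_list (map G y) + N \<and> (\<forall>w\<in>#N. w < B)"
  using assms
proof (induction y)
  case (Cons t y)
  obtain N where N: "sum_list (map F y) = sum_list (map G y) + N" "\<forall>w\<in>#N. w < B"
    using Cons.IH Cons.prems by auto
  obtain N' where N': "F t = G t + N'" "\<forall>w\<in>#N'. w < B" using Cons.prems[of t] by auto
  show ?case using N N' by (intro exI[of _ "N' + N"]) (auto simp: ac_simps)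
qed simp

lemma not_sortedE:
  assumes "\<not> sorted (map \<kappa> s)"
  obtains u a b v where "s = u @ [a, b] @ v" "(\<kappa> b :: nat) < \<kappa> a"
proof -
  obtain i where i: "Suc i < length s" "\<kappa> (s ! Suc i) < \<kappa> (s ! i)"
    using assms by (auto simp: sorted_iff_nth_Suc not_le)
  then have "s = take i s @ [s ! i, s ! Suc i] @ drop (Suc (Suc i)) s"
    by (simp add: Cons_nth_drop_Suc id_take_nth_drop[symmetric])
  then show thesis using i(2) that by blast
qed

lemma filter_double:
  fixes K :: nat
  assumes "\<And>r. r \<in> set t \<Longrightarrow> r < K \<and> U r"
  shows "filter (\<lambda>j. j < K) (filter U (concat (map (\<lambda>r. [r + K, r]) t))) = t"
  using assms by (induction t) auto

text \<open>
  Every crossing creates only pieces that are deeper than the two that are crossed. As pieces of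
  depth \<open>n\<close> disappear, the multiset of the inversions, weighted by the remaining depth, decreases.
\<close>

lemma sort_configuration:
  assumes n: "1 \<le> n" and "configuration n x ps" "\<And>p. p \<in> set ps \<Longrightarrow> depth p < n"
  shows "\<exists>x' ps'. configuration n x' ps' \<and> (\<forall>p\<in>set ps'. depth p < n) \<and> length x' = length x \<and>
    (\<forall>s\<in>set x'. sorted (map (key ps') s)) \<and> (\<forall>S. L_RII n (length x) (killed x ps S) (killed x' ps' S))"
  using assms(2,3)
proof (induction "disorder n x ps" arbitrary: x ps rule: wf_induct_rule[OF wf_mult[OF wf_less_than]])
  case (1 x ps)
  have c: "configuration n x ps" and shallow: "\<And>p. p \<in> set ps \<Longrightarrow> depth p < n" using 1 by auto
  show ?case
  proof (cases "\<forall>s\<in>set x. sorted (map (key ps) s)")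
    case True
    then show ?thesis using c shallow by (intro exI[of _ x] exI[of _ ps]) auto
  next
    case False
    then obtain s where s: "s \<in> set x" "\<not> sorted (map (key ps) s)" by blast
    obtain s1 a b s2 where ab: "s = s1 @ [a, b] @ s2" "key ps b < key ps a" using not_sortedE[OF s(2)] .
    obtain xs1 xs2 where x: "x = xs1 @ (s1 @ [a, b] @ s2) # xs2" using s(1) ab(1) by (meson split_list)
    define y where "y = xs1 @ (s1 @ [b, a] @ s2) # xs2"
    have in_x: "a \<in> set (concat x)" "b \<in> set (concat x)" by (simp_all add: x)
    define P Q where "P = owner ps a" and "Q = owner ps b"
    have P: "P \<in> set ps" "a \<in> support (word P)" and Q: "Q \<in> set ps" "b \<in> support (word Q)"
      unfolding P_def Q_def by (rule configuration_owner[OF c in_x(1)] configuration_owner[OF c in_x(2)])+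
    have "P \<noteq> Q" using ab(2) unfolding key_def P_def Q_def by auto
    obtain R where R: "configuration n x (P # Q # R)" "set (P # Q # R) = set ps"
      "\<And>S. L_RII n (length x) (killed x ps S) (killed x (P # Q # R) S)"
      using configuration_front[OF c P(1) Q(1) \<open>P \<noteq> Q\<close>, where m = n] by blast
    obtain K where K: "set (concat x) \<subseteq> {..<K}"
      using finite_nat_set_iff_bounded[of "set (concat x)"] by blast
    obtain C where C: "label C = label P \<union> label Q" "depth C = depth P + depth Q" "support (word C) \<inter> {..<K} = {}"
      "support (words (C # Q # P # R)) \<subseteq> set (concat (double_before K y))"
      "\<And>p. p \<in> set (C # Q # P # R) \<Longrightarrow> piece_ok n p" "disjoint_pieces (C # Q # P # R)"
      "\<And>S. L_RII n (length x) (killed x (P # Q # R) S) (killed (double_before K y) (C # Q # P # R) S)"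
      using configuration_step[OF R(1) x y_def P(2) Q(2) K] by blast
    define ps' where "ps' = filter (\<lambda>p. depth p < n) (C # Q # P # R)"
    define x' where "x' = used_slots ps' (double_before K y)"
    have dx: "distinct (concat x)" using c by (simp add: configuration_def)
    have set_y: "set (concat y) = set (concat x)" by (auto simp: x y_def)
    have dy: "distinct (concat y)" using dx by (auto simp: x y_def)
    have dd: "distinct (concat (double_before K y))"
      using distinct_double_before[OF dy] K by (simp only: set_y)
    have len: "length (double_before K y) = length x" by (simp add: double_before_def x y_def)
    have c': "configuration n x' ps'" and eq': "\<And>S. L_RII n (length x) (killed (double_before K y) (C # Q # P # R) S) (killed x' ps' S)"
      using configuration_drop_deep[OF n dd C(4,5,6) ps'_def] by (simp_all only: x'_def len)
    have old: "p \<in> set ps'" if "p \<in> set ps" for p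
      using that shallow[OF that] unfolding R(2)[symmetric] ps'_def by auto
    have disj': "disjoint_pieces ps'" using c' by (simp add: configuration_def)
    have owner_old: "owner ps' r = owner ps r" if "r \<in> set (concat x)" for r
      using owner_eq[OF disj' old] configuration_owner[OF c that] by metis
    have owner_new: "owner ps' r = C" if r: "r \<in> set (concat x')" "\<not> r < K" for r
    proof -
      have "owner ps' r \<in> set ps'" "r \<in> support (word (owner ps' r))" using configuration_owner[OF c' r(1)] .
      moreover have "r \<notin> support (word p)" if "p \<in> set ps" for p
        using c that K r(2) unfolding configuration_def by blast
      moreover have "set ps' \<subseteq> insert C (set ps)" unfolding ps'_def R(2)[symmetric] set_filter by auto
      ultimately show ?thesis by blast
    qed
    have pos: "1 \<le> depth P" "1 \<le> depth Q" using C(5)[of P] C(5)[of Q] by (simp_all add: piece_ok_def)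
    have less: "weight n ps' i j < weight n ps a b"
      if "i \<in> set (concat x')" "j \<in> set (concat x')" "\<not> i < K \<or> \<not> j < K" for i j
    proof -
      have "depth C \<le> max (depth (owner ps' i)) (depth (owner ps' j))"
        using that owner_new[of i] owner_new[of j] by auto
      then show ?thesis
        using shallow[OF P(1)] shallow[OF Q(1)] pos C(2) unfolding weight_def P_def[symmetric] Q_def[symmetric] by linarith
    qed
    let ?inv = "inversions (key ps) (weight n ps)" and ?inv' = "inversions (key ps') (weight n ps')"
    let ?g = "\<lambda>t. filter (\<lambda>j. j \<in> support (words ps')) (concat (map (\<lambda>r. [r + K, r]) t))"
    have x'_map: "x' = map ?g y" by (simp add: x'_def used_slots_def double_before_def comp_def)
    have "\<exists>N. ?inv' (?g t) = ?inv t + N \<and> (\<forall>w\<in>#N. w < weight n ps a b)" if t: "t \<in> set y" for t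
    proof -
      have t_x: "r \<in> set (concat x)" if "r \<in> set t" for r using t that set_y by auto
      have g_x': "r \<in> set (concat x')" if "r \<in> set (?g t)" for r using t that unfolding x'_map by auto
      have flt: "filter (\<lambda>j. j < K) (?g t) = t"
      proof (rule filter_double)
        fix r assume "r \<in> set t"
        then have r: "r \<in> set (concat x)" by (rule t_x)
        then have "r \<in> support (words ps')"
          using configuration_owner[OF c r] old unfolding support_words by blast
        then show "r < K \<and> r \<in> support (words ps')" using r K by auto
      qed
      from inversions_filter[of "key ps'" "weight n ps'" "?g t" "\<lambda>j. j < K", unfolded flt]
      obtain N where N: "?inv' (?g t) = ?inv' t + N"
        "\<forall>w\<in>#N. \<exists>i\<in>set (?g t). \<exists>j\<in>set (?g t). w = weight n ps' i j \<and> (\<not> i < K \<or> \<not> j < K)"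
        by (elim exE conjE)
      have "?inv' t = ?inv t"
        by (rule inversions_cong) (simp_all only: key_def weight_def owner_old[OF t_x])
      then have N1: "?inv' (?g t) = ?inv t + N" using N(1) by (simp only:)
      have "\<forall>w\<in>#N. w < weight n ps a b"
      proof
        fix w assume "w \<in># N"
        then have "\<exists>i\<in>set (?g t). \<exists>j\<in>set (?g t). w = weight n ps' i j \<and> (\<not> i < K \<or> \<not> j < K)"
          by (rule bspec[OF N(2)])
        then obtain i j where ij: "i \<in> set (?g t)" "j \<in> set (?g t)" "w = weight n ps' i j" "\<not> i < K \<or> \<not> j < K"
          by (elim bexE conjE)
        then show "w < weight n ps a b" using less[OF g_x'[OF ij(1)] g_x'[OF ij(2)] ij(4)] by (simp only:)
      qed
      with N1 show ?thesis by (intro exI[of _ N] conjI)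
    qed
    then obtain N where N: "sum_list (map (\<lambda>t. ?inv' (?g t)) y) = sum_list (map ?inv y) + N" "\<forall>w\<in>#N. w < weight n ps a b"
      using sum_list_extra[of y "\<lambda>t. ?inv' (?g t)" ?inv "weight n ps a b"] by blast
    have total': "disorder n x' ps' = sum_list (map ?inv y) + N"
      unfolding disorder_def x'_map using N(1) by (simp add: comp_def)
    have total: "disorder n x ps = sum_list (map ?inv y) + {#weight n ps a b#}"
      unfolding disorder_def x y_def using inversions_swap[of "key ps", OF ab(2), of "weight n ps" s1 s2] by simp
    have dec: "(disorder n x' ps', disorder n x ps) \<in> mult less_than"
      unfolding total total' using N(2) by (intro one_step_implies_mult) auto
    have shallow': "depth p < n" if "p \<in> set ps'" for p using that by (simp only: ps'_def set_filter mem_Collect_eq)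
    have "\<exists>x'' ps''. configuration n x'' ps'' \<and> (\<forall>p\<in>set ps''. depth p < n) \<and> length x'' = length x' \<and>
        (\<forall>s\<in>set x''. sorted (map (key ps'') s)) \<and> (\<forall>S. L_RII n (length x') (killed x' ps' S) (killed x'' ps'' S))"
      by (rule 1(1)[OF dec c']) (rule shallow')
    then obtain x'' ps'' where IH: "configuration n x'' ps''" "\<forall>p\<in>set ps''. depth p < n"
      "length x'' = length x'" "\<forall>s\<in>set x''. sorted (map (key ps'') s)"
      "\<forall>S. L_RII n (length x') (killed x' ps' S) (killed x'' ps'' S)"
      by (elim exE conjE)
    have len': "length x' = length x" using len by (simp add: x'_def used_slots_def)
    have "L_RII n (length x) (killed x ps S) (killed x'' ps'' S)" for S
    proof -
      have "L_RII n (length x) (killed x' ps' S) (killed x'' ps'' S)" using IH(5) unfolding len' by (rule spec)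
      with eq' have "L_RII n (length x) (killed (double_before K y) (C # Q # P # R) S) (killed x'' ps'' S)"
        by (rule generated_equiv_trans)
      with C(7) have "L_RII n (length x) (killed x (P # Q # R) S) (killed x'' ps'' S)"
        by (rule generated_equiv_trans)
      with R(3) show ?thesis by (rule generated_equiv_trans)
    qed
    then show ?thesis using IH len' by (intro exI[of _ x''] exI[of _ ps'']) simp
  qed
qed

section \<open>Eliminating a sorted configuration\<close>

lemma isotopic_attach_trivial:
  assumes "embedding m D e"
  shows "isotopic D (attach D (trivial_diagram m :: 'b gauss_diagram) e)"
proof (rule isotopicI[of _ Inl])
  define T :: "'b gauss_diagram" where "T = trivial_diagram m"
  have "concat (map (fill T) s) = map (map_endpoint Inl) (concat (map old_part s))" if "s \<in> set e" for s
  proof -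
    have "fill T z = map (map_endpoint Inl) (old_part z)" if "z \<in> set s" for z
    proof (cases z)
      case (Slot j r)
      then have "j < m" using embedding_slot_less[OF assms \<open>s \<in> set e\<close>] that by blast
      then show ?thesis using Slot by (simp add: T_def trivial_diagram_def)
    qed simp
    then show ?thesis by (simp add: map_concat cong: map_cong)
  qed
  then have "strands (attach D T e) = map (map (map_endpoint Inl)) (map (\<lambda>s. concat (map old_part s)) e)"
    by (simp add: attach_def)
  then show "strands (attach D (trivial_diagram m :: 'b gauss_diagram) e) = map (map (map_endpoint Inl)) (strands D)"
    using assms by (simp only: embedding_def T_def)
qed (auto simp: inj_on_def)

lemma isotopic_partition:
  assumes "disjoint_pieces (A @ ps)"
  shows "isotopic (realise x (words (A @ ps))) (realise x (words (A @ filter F ps @ filter (\<lambda>p. \<not> F p) ps)))"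
  using assms
proof (induction ps arbitrary: A)
  case Nil
  then show ?case by simp
next
  case (Cons p ps)
  have IH: "isotopic (realise x (words ((A @ [p]) @ ps))) (realise x (words ((A @ [p]) @ filter F ps @ filter (\<lambda>p. \<not> F p) ps)))"
    using Cons.prems by (intro Cons.IH) simp
  show ?case
  proof (cases "F p")
    case True
    then show ?thesis using IH by simp
  next
    case False
    have "support (word p) \<inter> support (words (filter F ps)) = {}"
      using Cons.prems unfolding disjoint_pieces_def support_words sorted_wrt_append sorted_wrt.simps by auto
    from isotopic_realise_swap_blocks[OF this, of x "words A" "words (filter (\<lambda>p. \<not> F p) ps)"]
    have "isotopic (realise x (words ((A @ [p]) @ filter F ps @ filter (\<lambda>p. \<not> F p) ps)))
        (realise x (words (A @ filter F (p # ps) @ filter (\<lambda>p. \<not> F p) (p # ps))))"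
      using False by simp
    with IH have "isotopic (realise x (words ((A @ [p]) @ ps))) (realise x (words (A @ filter F (p # ps) @ filter (\<lambda>p. \<not> F p) (p # ps))))"
      by (rule isotopic_trans)
    then show ?thesis by simp
  qed
qed

text \<open>
  If on every strand the slots of a word \<open>u\<close> precede those of a word \<open>v\<close>, the diagram is the stack of
  the two diagrams: that of \<open>u\<close> is attached to that of \<open>v\<close> at the beginnings of the strands.
\<close>

lemma L_RII_stack:
  assumes placed: "placed x (u @ v)" and disj: "support u \<inter> support v = {}"
    and order: "\<And>s. s \<in> set x \<Longrightarrow> sorted_wrt (\<lambda>j i. \<not> (j \<in> support v \<and> i \<in> support u)) s"
    and m: "length x = m" and triv: "L_RII n m (realise x u) (trivial_diagram m)"
  shows "L_RII n m (realise x (u @ v)) (realise x v)"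
proof -
  obtain lu lv :: "nat lword" where l: "map snd lu = u" "map snd lv = v" "distinct (map fst (lu @ lv))"
    by (rule obtain_labels)
  have du: "distinct (map fst lu)" and dv: "distinct (map fst lv)" using l(3) by auto
  let ?D = "lreal x lv" and ?E = "lreal x lu"
  have pu: "placed x u" and pv: "placed x v" using placed by simp_all
  have gd: "?D \<in> gauss_diagrams m" "?E \<in> gauss_diagrams m"
    using lreal_gauss_diagrams[of x lv] lreal_gauss_diagrams[of x lu] pu pv du dv by (simp_all only: l m)
  define e where "e = map (\<lambda>t. Slot t False # map Old (strands ?D ! t)) [0..<m]"
  have len: "length (strands ?D) = m" by (simp add: lreal_def m)
  have old: "concat (map old_part (map Old xs)) = xs" "concat (map slot_part (map Old xs)) = []" for xs :: "nat endpoint list"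
    by (induction xs) auto
  have slots: "concat (map slot_part (concat e)) = [0..<m]"
  proof -
    have "concat (map slot_part (concat e)) = concat (map (\<lambda>t. [t]) [0..<m])"
      unfolding concat_map_concat[symmetric] e_def map_map comp_def
      by (rule arg_cong[of _ _ concat], rule map_cong[OF refl]) (simp add: old del: map_map)
    then show ?thesis by simp
  qed
  have emb: "embedding m ?D e" unfolding embedding_def slots
  proof (intro conjI)
    show "map (\<lambda>s. concat (map old_part s)) e = strands ?D"
      using len by (intro nth_equalityI) (simp_all add: e_def old del: map_map)
  qed auto
  have unrev: "unreversed e" by (auto simp: unreversed_def e_def)
  define W :: "(nat + nat) lword" where "W = map (map_prod Inr id) lu @ map (map_prod Inl id) lv"
  have dW: "distinct (map fst W)"
  proof -
    have eq: "map fst W = map Inr (map fst lu) @ map Inl (map fst lv)" by (simp add: W_def comp_def)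
    have "distinct (map Inr xs @ map Inl ys :: (nat + nat) list)" if "distinct xs" "distinct ys" for xs ys
      using that by (auto simp: distinct_map)
    then show ?thesis unfolding eq using du dv .
  qed
  have snd_W: "map snd W = u @ v" using l by (simp add: W_def comp_def)
  have inj_ends: "slot_ends s (map (map_prod f id) w) = map (map_endpoint f) (slot_ends s w)"
    for s and w :: "nat lword" and f :: "nat \<Rightarrow> nat + nat"
    by (induction w) auto
  have split: "concat (map (\<lambda>j. slot_ends j W) s) =
      concat (map (\<lambda>j. map (map_endpoint Inr) (slot_ends j lu)) s) @ concat (map (\<lambda>j. map (map_endpoint Inl) (slot_ends j lv)) s)"
    if "sorted_wrt (\<lambda>j i. \<not> (j \<in> support v \<and> i \<in> support u)) s" for s
    using that
  proof (induction s)
    case (Cons j s)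
    have IH: "concat (map (\<lambda>j. slot_ends j W) s) =
      concat (map (\<lambda>j. map (map_endpoint Inr) (slot_ends j lu)) s) @ concat (map (\<lambda>j. map (map_endpoint Inl) (slot_ends j lv)) s)"
      using Cons by simp
    show ?case
    proof (cases "j \<in> support v")
      case True
      then have "slot_ends i lu = []" if "i \<in> set (j # s)" for i
        using Cons.prems disj that l(1) by (intro slot_ends_outside) auto
      then have e: "slot_ends j lu = []"
        "concat (map (\<lambda>j. map (map_endpoint Inr) (slot_ends j lu)) s) = ([] :: (nat + nat) endpoint list)" by simp_all
      show ?thesis unfolding list.map concat.simps IH e by (simp add: W_def inj_ends e(1))
    next
      case False
      then have "slot_ends j lv = []" using l(2) by (intro slot_ends_outside) simp
      then show ?thesis using IH by (simp add: W_def inj_ends)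
    qed
  qed simp
  have "isotopic (realise x (u @ v)) (lreal x W)"
    using isotopic_sym[OF isotopic_realise_lreal[OF dW, of x]] unfolding snd_W .
  also have "isotopic \<dots> (attach ?D ?E e)"
  proof (rule isotopic_same_strandsI)
    show "strands (lreal x W) = strands (attach ?D ?E e)"
    proof (rule nth_equalityI)
      show "length (strands (lreal x W)) = length (strands (attach ?D ?E e))"
        by (simp add: lreal_def attach_def e_def m)
      fix t assume "t < length (strands (lreal x W))"
      then have t: "t < m" "t < length x" by (simp_all add: lreal_def m)
      have "concat (map (fill ?E) (map Old xs)) = map (map_endpoint Inl) xs" for xs :: "nat endpoint list"
        by (induction xs) auto
      then have "strands (attach ?D ?E e) ! t = map (map_endpoint Inr) (strands ?E ! t) @ map (map_endpoint Inl) (strands ?D ! t)"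
        unfolding unreversed_attach[OF unrev] gauss_diagram.sel unfolding e_def using t by (simp del: map_map)
      also have "\<dots> = concat (map (\<lambda>j. slot_ends j W) (x ! t))"
        using split[OF order[OF nth_mem[OF t(2)]]] t(2) by (simp add: lreal_def map_concat comp_def)
      finally show "strands (lreal x W) ! t = strands (attach ?D ?E e) ! t" using t by (simp add: lreal_def)
    qed
    fix a assume "a \<in> arrows (lreal x W)"
    then have "a \<in> fst ` set W" using arrows_lreal_subset[of x W] by auto
    then obtain z where z: "z \<in> set W" "a = fst z" by blast
    obtain i j p where ijp: "z = (a, i, j, p)" using z(2) by (cases z) auto
    have sW: "sign (lreal x W) a = (if p then 1 else -1)" using sign_lreal[OF dW] z(1) ijp by simp
    have set_W: "set W = map_prod Inr id ` set lu \<union> map_prod Inl id ` set lv"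
      unfolding W_def set_append set_map by (rule refl)
    show "sign (lreal x W) a = sign (attach ?D ?E e) a"
    proof (cases "z \<in> map_prod Inr id ` set lu")
      case True
      then obtain y where y: "z = map_prod Inr id y" "y \<in> set lu" by (rule imageE)
      obtain q where q: "y = (q, i, j, p)" "a = Inr q" using y(1) ijp by (cases y) auto
      then show ?thesis using sW sign_lreal[OF du] y(2) unrev by simp
    next
      case False
      then have "z \<in> map_prod Inl id ` set lv" using z(1) unfolding set_W by simp
      then obtain y where y: "z = map_prod Inl id y" "y \<in> set lv" by (rule imageE)
      obtain q where q: "y = (q, i, j, p)" "a = Inl q" using y(1) ijp by (cases y) auto
      then show ?thesis using sW sign_lreal[OF dv] y(2) by simp
    qed
  qed
  also have "isotopic \<dots> (attach_nat ?D ?E e)" by (rule isotopic_attach_nat)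
  finally have iso: "isotopic (realise x (u @ v)) (attach_nat ?D ?E e)" .
  have "L_RII n m (realise x (u @ v)) (attach_nat ?D ?E e)"
    using realise_gauss_diagrams[OF placed] m by (intro generated_equiv_isotopic[OF iso]) simp
  also have "L_RII n m \<dots> (attach_nat ?D (trivial_diagram m) e)"
  proof (rule L_RII_attach[OF emb unrev gd(1)])
    have "isotopic ?E (realise x u)" using isotopic_realise_lreal[OF du, of x] unfolding l(1) .
    then have "L_RII n m ?E (realise x u)" using gd(2) by (rule generated_equiv_isotopic)
    then show "L_RII n m ?E (trivial_diagram m)" using triv by (rule generated_equiv_trans)
  qed
  also have "L_RII n m \<dots> (realise x v)"
  proof (rule generated_equiv_sym, rule generated_equiv_isotopic)
    have "isotopic (realise x v) ?D" using isotopic_sym[OF isotopic_realise_lreal[OF dv, of x]] unfolding l(2) .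
    also have "isotopic \<dots> (attach ?D (trivial_diagram m :: nat gauss_diagram) e)" by (rule isotopic_attach_trivial[OF emb])
    also have "isotopic \<dots> (attach_nat ?D (trivial_diagram m) e)" by (rule isotopic_attach_nat)
    finally show "isotopic (realise x v) (attach_nat ?D (trivial_diagram m) e)" .
    show "realise x v \<in> gauss_diagrams m" using realise_gauss_diagrams[OF pv] m by simp
  qed
  finally show ?thesis .
qed

lemma set_encode_mono: "finite B \<Longrightarrow> A \<subseteq> B \<Longrightarrow> set_encode A \<le> set_encode B"
  unfolding set_encode_def by (rule sum_mono2) auto

lemma set_encode_inj: "finite A \<Longrightarrow> finite B \<Longrightarrow> set_encode A = set_encode B \<Longrightarrow> A = B"
  using set_encode_inverse by metis

text \<open>
  The pieces with label \<open>T\<close> are what remains at the beginning of the strands when the complement of \<open>T\<close> is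
  deleted and the pieces with smaller labels are already gone. As depths are below \<open>n\<close>, the
  complement of \<open>T\<close> is not empty.
\<close>

lemma eliminate_configuration:
  assumes n: "1 \<le> n" and c: "configuration n x ps" and shallow: "\<And>p. p \<in> set ps \<Longrightarrow> depth p < n"
    and sorted: "\<And>s. s \<in> set x \<Longrightarrow> sorted (map (key ps) s)" and m: "length x = m"
    and triv: "\<And>S. \<lbrakk>S \<noteq> {}; S \<subseteq> {..<n}\<rbrakk> \<Longrightarrow> L_RII n m (killed x ps S) (trivial_diagram m)"
  shows "L_RII n m (killed x ps S) (trivial_diagram m)"
proof -
  let ?k = "\<lambda>p. set_encode (label p)"
  define above where "above N = filter (\<lambda>p. N \<le> ?k p) ps" for N
  have label: "label p \<subseteq> {..<n}" "finite (label p)" if "p \<in> set ps" for p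
  proof -
    show "label p \<subseteq> {..<n}" using c that unfolding configuration_def piece_ok_def by blast
    then show "finite (label p)" using finite_subset by blast
  qed
  have disj: "disjoint_pieces ps" using c by (simp add: configuration_def)
  have key: "key ps j = ?k p" if "p \<in> set ps" "j \<in> support (word p)" for p j
    using owner_eq[OF disj that] by (simp add: key_def)
  have step: "L_RII n m (killed x (above N) S) (killed x (above (Suc N)) S)"
    if prev: "\<And>S. L_RII n m (killed x ps S) (killed x (above N) S)" for N S
  proof (cases "\<exists>p\<in>set ps. ?k p = N")
    case False
    then have "above N = above (Suc N)" unfolding above_def by (intro filter_cong) (auto simp: Suc_le_eq le_less)
    then show ?thesis by simp
  next
    case True
    then obtain p0 where p0: "p0 \<in> set ps" "?k p0 = N" by blast
    define T where "T = label p0"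
    have N_iff: "?k p = N \<longleftrightarrow> label p = T" if "p \<in> set ps" for p
      using set_encode_inj[OF label(2)[OF that] label(2)[OF p0(1)]] p0(2) by (auto simp: T_def)
    show ?thesis
    proof (cases "T \<inter> S = {}")
      case False
      have "filter (\<lambda>p. label p \<inter> S = {}) (above N) = filter (\<lambda>p. label p \<inter> S = {}) (above (Suc N))"
        unfolding above_def filter_filter
      proof (rule filter_cong[OF refl])
        fix p assume "p \<in> set ps"
        then show "(N \<le> ?k p \<and> label p \<inter> S = {}) = (Suc N \<le> ?k p \<and> label p \<inter> S = {})"
          using False N_iff[of p] by (auto simp: Suc_le_eq le_less)
      qed
      then show ?thesis by (simp add: killed_def)
    next
      case T_S: True
      define A where "A = filter (\<lambda>p. ?k p = N) ps"
      define B where "B = filter (\<lambda>p. label p \<inter> S = {}) (above (Suc N))"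
      have "card T < n" using c p0(1) shallow[OF p0(1)] unfolding configuration_def piece_ok_def T_def by fastforce
      then have "T \<noteq> {..<n}" by auto
      then have "{..<n} - T \<noteq> {}" using label(1)[OF p0(1)] unfolding T_def by blast
      then have "L_RII n m (killed x ps ({..<n} - T)) (trivial_diagram m)" by (intro triv) auto
      then have "L_RII n m (killed x (above N) ({..<n} - T)) (trivial_diagram m)"
        using generated_equiv_sym[OF prev] generated_equiv_trans by blast
      moreover have "filter (\<lambda>p. label p \<inter> ({..<n} - T) = {}) (above N) = A"
        unfolding above_def A_def filter_filter
      proof (rule filter_cong[OF refl])
        fix p assume p: "p \<in> set ps"
        have "label p \<inter> ({..<n} - T) = {} \<longleftrightarrow> label p \<subseteq> T" using label(1)[OF p] by blast
        moreover have "?k p \<le> N" if "label p \<subseteq> T"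
          using set_encode_mono[OF label(2)[OF p0(1)], of "label p"] that p0(2) by (simp add: T_def)
        ultimately show "(N \<le> ?k p \<and> label p \<inter> ({..<n} - T) = {}) = (?k p = N)"
          using N_iff[OF p] by auto
      qed
      ultimately have A_triv: "L_RII n m (realise x (words A)) (trivial_diagram m)" by (simp add: killed_def)
      let ?Q = "filter (\<lambda>p. label p \<inter> S = {}) (above N)"
      have Q: "disjoint_pieces ?Q" using disj unfolding disjoint_pieces_def above_def by (intro sorted_wrt_filter)
      have sub: "set ?Q \<subseteq> set ps" by (auto simp: above_def)
      have fA: "filter (\<lambda>p. ?k p = N) ?Q = A"
        unfolding above_def A_def filter_filter using N_iff T_S by (intro filter_cong) auto
      have fB: "filter (\<lambda>p. ?k p \<noteq> N) ?Q = B"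
        unfolding above_def B_def filter_filter by (intro filter_cong) auto
      have "isotopic (killed x (above N) S) (realise x (words A @ words B))"
        using isotopic_partition[of "[]" ?Q x "\<lambda>p. ?k p = N"] Q fA fB by (simp add: killed_def)
      moreover have "killed x (above N) S \<in> gauss_diagrams m"
        unfolding killed_def m[symmetric] by (rule realise_gauss_diagrams[OF placed_words[OF c sub]])
      ultimately have "L_RII n m (killed x (above N) S) (realise x (words A @ words B))"
        by (rule generated_equiv_isotopic)
      also have "L_RII n m \<dots> (realise x (words B))"
      proof (rule L_RII_stack[OF _ _ _ m A_triv])
        have AB: "set A \<subseteq> set ps" "set B \<subseteq> set ps" by (auto simp: A_def B_def above_def)
        show "placed x (words A @ words B)" using placed_words[OF c AB(1)] placed_words[OF c AB(2)] by simp
        have kA: "key ps j = N" if "j \<in> support (words A)" for j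
          using that key unfolding support_words A_def by auto
        have kB: "N < key ps j" if "j \<in> support (words B)" for j
          using that key unfolding support_words B_def above_def by fastforce
        show "support (words A) \<inter> support (words B) = {}" using kA kB by fastforce
        fix s assume "s \<in> set x"
        then have "sorted_wrt (\<lambda>i j. key ps i \<le> key ps j) s" using sorted by (simp add: sorted_map)
        then show "sorted_wrt (\<lambda>j i. \<not> (j \<in> support (words B) \<and> i \<in> support (words A))) s"
        proof (rule sorted_wrt_mono_rel[rotated])
          fix j i assume "key ps j \<le> key ps i"
          then show "\<not> (j \<in> support (words B) \<and> i \<in> support (words A))" using kA[of i] kB[of j] by linarith
        qed
      qed
      finally show ?thesis by (simp add: killed_def B_def)
    qed
  qed
  have all: "L_RII n m (killed x ps S) (killed x (above N) S)" for N S
  proof (induction N arbitrary: S)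
    case 0
    have "above 0 = ps" by (simp add: above_def)
    then show ?case by simp
  next
    case (Suc N)
    show ?case using Suc[of S] step[OF Suc, of S] by (rule generated_equiv_trans)
  qed
  have "above (Suc (set_encode {..<n})) = []"
  proof -
    have "?k p \<le> set_encode {..<n}" if "p \<in> set ps" for p
      using set_encode_mono[OF _ label(1)[OF that]] by simp
    then show ?thesis unfolding above_def filter_empty_conv by fastforce
  qed
  then have "killed x (above (Suc (set_encode {..<n}))) S = realise x []" by (simp add: killed_def)
  with all[of S "Suc (set_encode {..<n})"] have "L_RII n m (killed x ps S) (realise x [])" by simp
  also have "L_RII n m \<dots> (trivial_diagram m)"
  proof (rule generated_equiv_isotopic)
    show "isotopic (realise x []) (trivial_diagram m :: nat gauss_diagram)" using isotopic_realise_Nil[of x] m by simp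
    have "placed x []" using c by (simp add: placed_def configuration_def)
    then show "realise x [] \<in> gauss_diagrams m" using realise_gauss_diagrams m by blast
  qed
  finally show ?thesis .
qed

section \<open>From variations to deep words\<close>

text \<open>
  At first every endpoint has a slot of its own, and every arrow is a piece of depth one, labelled with
  the index of the given set that contains it, if there is one.
\<close>

lemma n_trivial_L_RII:
  fixes E :: "nat gauss_diagram"
  assumes n: "1 \<le> n" and E: "E \<in> gauss_diagrams m" and triv: "n_trivial m (n - 1) E"
  shows "L_RII n m E (trivial_diagram m)"
proof -
  obtain A where A: "disjoint_family_on A {..n - 1}"
    "\<And>S. \<lbrakk>S \<noteq> {}; S \<subseteq> {..n - 1}\<rbrakk> \<Longrightarrow> generated_equiv m RII (delete_arrows (\<Union>(A ` S)) E) (trivial_diagram m)"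
    using triv unfolding n_trivial_def by blast
  have le: "{..n - 1} = {..<n}" using n by auto
  define as where "as = sorted_list_of_set (arrows E)"
  have "finite (arrows E)" by (simp add: arrows_def endpoints_def)
  then have as: "set as = arrows E" "distinct as" by (simp_all add: as_def)
  define letter where "letter a = (2 * a, Suc (2 * a), sign E a = 1)" for a
  define w where "w = map (\<lambda>a. (a, letter a)) as"
  define slot where "slot z = (case z of Tail a \<Rightarrow> 2 * a | Head a \<Rightarrow> Suc (2 * a))" for z :: "nat endpoint"
  define x where "x = map (map slot) (strands E)"
  have len: "length x = m" using E by (simp add: x_def gauss_diagrams_def)
  have fst_w: "map fst w = as" and snd_w: "map snd w = map letter as" by (simp_all add: w_def comp_def)
  have parity: "Suc (2 * a) \<noteq> 2 * b" "2 * b \<noteq> Suc (2 * a)" for a b :: nat by presburger+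
  have inj_slot: "slot y = slot z \<longleftrightarrow> y = z" for y z
    by (cases y; cases z) (simp_all add: slot_def parity)
  have dx: "distinct (concat x)"
  proof -
    have "concat x = map slot (concat (strands E))" by (simp add: x_def map_concat)
    moreover have "distinct (concat (strands E))" using E by (simp add: gauss_diagrams_def)
    ultimately show ?thesis by (simp add: distinct_map inj_on_def inj_slot)
  qed
  have set_x: "set (concat x) = slot ` endpoints E"
    by (simp add: x_def endpoints_def image_UN)
  have ends: "slot_ends (slot z) w = [z]" if "arrow_of z \<in> set as" for z
  proof -
    have none: "slot_ends (slot z) (map (\<lambda>a. (a, letter a)) bs) = []" if "arrow_of z \<notin> set bs" for bs
      using that by (induction bs) (cases z; simp add: letter_def slot_def parity)+
    have "slot_ends (slot z) (map (\<lambda>a. (a, letter a)) bs) = [z]" if "arrow_of z \<in> set bs" "distinct bs" for bs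
      using that
    proof (induction bs)
      case (Cons b bs)
      show ?case
      proof (cases "b = arrow_of z")
        case True
        then have "slot_ends (slot z) (map (\<lambda>a. (a, letter a)) bs) = []" using Cons.prems(2) by (intro none) simp
        moreover have "letter_ends (slot z) (b, letter b) = [z]"
          using True by (cases z) (simp_all add: letter_def slot_def parity)
        ultimately show ?thesis by simp
      next
        case False
        then have "letter_ends (slot z) (b, letter b) = []"
          by (cases z) (auto simp: letter_def slot_def parity)
        then show ?thesis using Cons False by simp
      qed
    qed simp
    then show ?thesis unfolding w_def using that as(2) .
  qed
  have strands: "strands (lreal x w) = strands E"
  proof -
    have "concat (map (\<lambda>j. slot_ends j w) (map slot s)) = s" if "s \<in> set (strands E)" for s
    proof -
      have "arrow_of z \<in> set as" if "z \<in> set s" for z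
        using that \<open>s \<in> set (strands E)\<close> unfolding as(1) arrows_def endpoints_def by auto
      then have "map (\<lambda>z. slot_ends (slot z) w) s = map (\<lambda>z. [z]) s" using ends by (intro map_cong[OF refl]) blast
      then have "concat (map (\<lambda>z. slot_ends (slot z) w) s) = concat (map (\<lambda>z. [z]) s)" by (rule arg_cong)
      then show ?thesis by (simp add: comp_def)
    qed
    then show ?thesis by (simp add: lreal_def x_def comp_def cong: map_cong)
  qed
  have sgn: "sign E a = sign (lreal x w) a" if "a \<in> arrows E" for a
  proof -
    have "(a, 2 * a, Suc (2 * a), sign E a = 1) \<in> set w" using that as(1) by (auto simp: w_def letter_def)
    then have "sign (lreal x w) a = (if sign E a = 1 then 1 else -1)"
      using as(2) fst_w by (intro sign_lreal) simp_all
    moreover have "sign E a = 1 \<or> sign E a = -1" using E that by (simp add: gauss_diagrams_def)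
    ultimately show ?thesis by auto
  qed
  define ps where "ps = map (\<lambda>a. ({i. i < n \<and> a \<in> A i}, 1 :: nat, [letter a])) as"
  have killed: "isotopic (delete_arrows (\<Union>(A ` S)) E) (killed x ps S)" if S: "S \<subseteq> {..<n}" for S
  proof -
    let ?B = "\<Union>(A ` S)"
    have flt: "map snd (filter (\<lambda>(q, l). q \<notin> ?B) w) = words (filter (\<lambda>p. label p \<inter> S = {}) ps)"
    proof -
      have "label ({i. i < n \<and> a \<in> A i}, 1 :: nat, [letter a]) \<inter> S = {} \<longleftrightarrow> a \<notin> ?B" for a using S by auto
      then show ?thesis unfolding w_def ps_def by (induction as) auto
    qed
    have "isotopic (delete_arrows ?B E) (delete_arrows ?B (lreal x w))"
      using strands sgn by (intro isotopic_same_strandsI) (auto simp: strands_delete_arrows)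
    also have "isotopic \<dots> (lreal x (filter (\<lambda>(q, l). q \<notin> ?B) w))"
      using as(2) fst_w by (intro isotopic_delete_lreal) simp
    also have "isotopic \<dots> (realise x (map snd (filter (\<lambda>(q, l). q \<notin> ?B) w)))"
      using as(2) fst_w by (intro isotopic_realise_lreal distinct_map_filter) simp
    finally show ?thesis unfolding flt killed_def .
  qed
  have killed_triv: "L_RII n m (killed x ps S) (trivial_diagram m)" if S: "S \<noteq> {}" "S \<subseteq> {..<n}" for S
  proof -
    have "L_RII n m (delete_arrows (\<Union>(A ` S)) E) (killed x ps S)"
      using killed[OF S(2)] delete_arrows_gauss_diagrams[OF E] by (rule generated_equiv_isotopic)
    then have "L_RII n m (killed x ps S) (delete_arrows (\<Union>(A ` S)) E)" by (rule generated_equiv_sym)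
    moreover have "L_RII n m (delete_arrows (\<Union>(A ` S)) E) (trivial_diagram m)"
      using A(2)[OF S(1)] S(2) unfolding le by (intro RII_imp_L_RII) simp
    ultimately show ?thesis by (rule generated_equiv_trans)
  qed
  have ok: "piece_ok n p" if in_ps: "p \<in> set ps" for p
  proof -
    obtain a where p: "p = ({i. i < n \<and> a \<in> A i}, 1, [letter a])" using in_ps by (auto simp: ps_def)
    have "i = j" if "i < n" "a \<in> A i" "j < n" "a \<in> A j" for i j
      using A(1) that unfolding le disjoint_family_on_def by auto
    then have "card {i. i < n \<and> a \<in> A i} \<le> 1" by (auto simp: card_le_Suc0_iff_eq)
    moreover have "depth_ge 1 [letter a]" by (rule depth_ge_1) (auto simp: letter_def)
    ultimately show ?thesis by (auto simp: p piece_ok_def letter_def)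
  qed
  have supp: "support (words ps) \<subseteq> set (concat x)"
  proof -
    have "{2 * a, Suc (2 * a)} \<subseteq> set (concat x)" if "a \<in> set as" for a
      using arrow_endpoints[OF E] that unfolding set_x as(1) by (force simp: slot_def)
    then show ?thesis unfolding support_words by (auto simp: ps_def letter_def simp del: set_concat)
  qed
  have disj: "disjoint_pieces ps"
    using as(2) unfolding ps_def disjoint_pieces_def sorted_wrt_map
    by (induction as) (auto simp: letter_def parity)
  define ps' where "ps' = filter (\<lambda>p. depth p < n) ps"
  define x' where "x' = used_slots ps' x"
  have c': "configuration n x' ps'" and eq': "L_RII n m (killed x ps S) (killed x' ps' S)" for S
    using configuration_drop_deep[OF n dx supp ok disj ps'_def] unfolding x'_def len by blast+
  have len': "length x' = m" using len by (simp add: x'_def used_slots_def)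
  have shallow: "depth p < n" if "p \<in> set ps'" for p using that by (simp only: ps'_def set_filter mem_Collect_eq)
  have "\<exists>y qs. configuration n y qs \<and> (\<forall>p\<in>set qs. depth p < n) \<and> length y = length x' \<and>
      (\<forall>s\<in>set y. sorted (map (key qs) s)) \<and> (\<forall>S. L_RII n (length x') (killed x' ps' S) (killed y qs S))"
    by (rule sort_configuration[OF n c' shallow])
  then obtain y qs where q: "configuration n y qs" "\<forall>p\<in>set qs. depth p < n" "length y = m"
    "\<forall>s\<in>set y. sorted (map (key qs) s)" "\<forall>S. L_RII n m (killed x' ps' S) (killed y qs S)"
    unfolding len' by (elim exE conjE)
  have to_y: "L_RII n m (killed x ps S) (killed y qs S)" for S
    using eq' q(5)[rule_format] by (rule generated_equiv_trans)
  have "L_RII n m (killed y qs {}) (trivial_diagram m)"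
  proof (rule eliminate_configuration[OF n q(1) _ _ q(3)])
    show "L_RII n m (killed y qs S) (trivial_diagram m)" if "S \<noteq> {}" "S \<subseteq> {..<n}" for S
      using generated_equiv_sym[OF to_y] killed_triv[OF that] by (rule generated_equiv_trans)
  qed (use q(2,4) in blast)+
  with to_y have "L_RII n m (killed x ps {}) (trivial_diagram m)" by (rule generated_equiv_trans)
  moreover have "isotopic E (killed x ps {})"
  proof -
    have "isotopic E (delete_arrows (\<Union>(A ` {})) E)"
      by (rule isotopic_same_strandsI) (auto simp: strands_delete_arrows intro!: map_idI[symmetric])
    also have "isotopic \<dots> (killed x ps {})" by (rule killed) simp
    finally show ?thesis .
  qed
  then have "L_RII n m E (killed x ps {})" using E by (rule generated_equiv_isotopic)
  ultimately show ?thesis using generated_equiv_trans by blast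
qed

lemma variation_L_equivalent:
  assumes n: "1 \<le> n" and var: "variation n D D'" and D: "D \<in> gauss_diagrams k" "D' \<in> gauss_diagrams k"
  shows "L_equivalent k n D D'"
proof -
  obtain m and E :: "nat gauss_diagram" and e where E: "E \<in> gauss_diagrams m" "n_trivial m (n - 1) E"
    "embedding m D e" "isotopic (attach D E e) D'"
    using var unfolding variation_def by blast
  define E' where "E' = reverse_strands {j. Slot j True \<in> set (concat e)} E"
  define f where "f = map_unreversed e"
  have f: "embedding m D f" "unreversed f"
    unfolding f_def using embedding_map_unreversed[OF E(3)] unreversed_map_unreversed by blast+
  have "length (strands E) = m" using E(1) by (simp add: gauss_diagrams_def)
  then have "attach D E e = attach D E' f"
    unfolding E'_def f_def by (rule attach_reverse_strands[OF E(3)])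
  then have D': "isotopic (attach_nat D E' f) D'"
    using isotopic_trans[OF isotopic_sym[OF isotopic_attach_nat]] E(4) by metis
  have E': "E' \<in> gauss_diagrams m" "n_trivial m (n - 1) E'"
    unfolding E'_def using reverse_strands_gauss_diagrams n_trivial_reverse_strands E by blast+
  have "L_RII n k (attach_nat D E' f) (attach_nat D (trivial_diagram m) f)"
    by (rule L_RII_attach[OF f D(1) n_trivial_L_RII[OF n E']])
  moreover have "L_RII n k D (attach_nat D (trivial_diagram m) f)"
    using isotopic_trans[OF isotopic_attach_trivial[OF f(1)] isotopic_attach_nat] D(1)
    by (rule generated_equiv_isotopic)
  moreover have "L_RII n k (attach_nat D E' f) D'"
    using D' attach_nat_gauss_diagrams[OF f(1) D(1) E'(1)] by (rule generated_equiv_isotopic)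
  ultimately have "L_RII n k D D'" using generated_equiv_sym generated_equiv_trans by blast
  then show ?thesis unfolding L_equivalent_def
    by (rule generated_equiv_mono) (auto intro: generated_equivI simp: reidemeister_def)
qed

theorem theorem5p4:
  fixes n k :: nat and D D' :: "nat gauss_diagram"
  assumes "n \<ge> 1" and "k \<ge> 1"
    and "D \<in> gauss_diagrams k" and "D' \<in> gauss_diagrams k"
  shows "L_equivalent k n D D' \<longleftrightarrow> n_equivalent k (n - 1) D D'"
proof
  have n: "Suc (n - 1) = n" using assms(1) by simp
  assume "L_equivalent k n D D'"
  then show "n_equivalent k (n - 1) D D'"
    unfolding L_equivalent_def n_equivalent_def
  proof (rule generated_equiv_mono)
    fix D E :: "nat gauss_diagram" assume gd: "D \<in> gauss_diagrams k" "E \<in> gauss_diagrams k"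
    assume "L_move n D E \<or> reidemeister D E"
    then show "generated_equiv k (\<lambda>D D'. variation (n - 1 + 1) D D' \<or> reidemeister D D') D E"
    proof
      assume "L_move n D E"
      then have "L_move (Suc (n - 1)) D E" by (simp only: n)
      then show ?thesis using L_move_n_equivalent[OF _ gd] unfolding n_equivalent_def by blast
    next
      assume "reidemeister D E"
      then show ?thesis using gd by (intro generated_equivI) simp_all
    qed
  qed
next
  have n: "n - 1 + 1 = n" using assms(1) by simp
  assume "n_equivalent k (n - 1) D D'"
  then show "L_equivalent k n D D'"
    unfolding L_equivalent_def n_equivalent_def n
  proof (rule generated_equiv_mono)
    fix D E :: "nat gauss_diagram" assume gd: "D \<in> gauss_diagrams k" "E \<in> gauss_diagrams k"
    assume "variation n D E \<or> reidemeister D E"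
    then show "generated_equiv k (\<lambda>D D'. L_move n D D' \<or> reidemeister D D') D E"
    proof
      assume "variation n D E"
      from variation_L_equivalent[OF assms(1) this gd] show ?thesis unfolding L_equivalent_def .
    next
      assume "reidemeister D E"
      then show ?thesis using gd by (intro generated_equivI) simp_all
    qed
  qed
qed

end
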